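(* Let $\alpha,\beta>0$, let $\psi\in W$ or $\psi\in L^1(\mathbb R)\cap\widehat W$, and assume that $(T_{\alpha k}M_{\beta\ell}\psi)_{k,\ell\in\mathbb Z}$ is a (Gabor) frame for $L^2(\mathbb R)$. For $\lambda\in[0,\frac{2\pi}\alpha)$ and $\ell\in\mathbb Z$ let $h_{\lambda,\ell}\in AP_2(\mathbb R)$ be the element whose Fourier coefficient at $\mu=\lambda+\frac{2\pi}\alpha p$ is $\widehat\psi(\lambda+\frac{2\pi}\alpha p-\beta\ell)$ for each $p\in\mathbb Z$, and whose Fourier coefficients at all other $\mu\in\mathbb R$ are $0$. Let $M\subset\mathbb R$ be countable, let $AP_2(M)$ be the closed subspace of those $f\in AP_2(\mathbb R)$ whose spectrum is contained in $M$, and let $\pi_M:AP_2(\mathbb R)\to AP_2(M)$ be the orthogonal projection. Then $AP_2(M)$ is a separable Hilbert space and the family $\big(\pi_M(h_{\lambda,\ell})\big)_{(\lambda,\ell)\in E}$, $E=[0,\frac{2\pi}\alpha)\times\mathbb Z$, is a Hilbert frame in $AP_2(M)$, i.e. there are constants $A,B>0$ with $$A\|f\|_{AP}^2\le\sum_{(\lambda,\ell)\in E}\big|(f,\pi_M(h_{\lambda,\ell}))_{AP_2}\big|^2\le B\|f\|_{AP}^2$$ for every $f\in AP_2(M)$.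
   Context: $AP(\mathbb R)$ is the space of Bohr almost periodic functions: continuous $f:\mathbb R\to\mathbb C$ such that for every $\epsilon>0$ there is $L>0$ such that every interval of length greater than $L$ contains $\tau$ with $\sup_t|f(t+\tau)-f(t)|\le\epsilon$. It carries the inner product $(f,g)_{AP}=\lim_{T\to\infty}\frac1{2T}\int_{-T}^Tf(t)\overline{g(t)}\,dt$, with norm $\|\cdot\|_{AP}$. $AP_2(\mathbb R)$ is the Hilbert space completion of $(AP(\mathbb R),\|\cdot\|_{AP})$, with inner product denoted $(\cdot,\cdot)_{AP_2}$ and norm still $\|\cdot\|_{AP}$; the functions $e_\lambda(t)=e^{i\lambda t}$, $\lambda\in\mathbb R$, form an orthonormal basis of it. The $\mu$-Fourier coefficient of $f\in AP_2(\mathbb R)$ is $(f,e_\mu)_{AP_2}$, and the spectrum of $f$ is the set of $\mu$ for which it is nonzero. $W$ is the Wiener space of $\psi\in L^\infty(\mathbb R)$ with $\|\psi\|_W=\sum_{k\in\mathbb Z}\operatorname{ess\,sup}_{x\in[0,1]}|\psi(x-k)|<\infty$ (so $W\subset L^1(\mathbb R)$). $\widehat W$ is the set of Fourier transforms of elements of $W$; thus $\psi\in L^1(\mathbb R)\cap\widehat W$ means $\psi\in L^1(\mathbb R)$ and $\widehat\psi\in W$. $\widehat\psi(\lambda)=\int_{\mathbb R}\psi(t)e^{-i\lambda t}\,dt$, $T_x\psi(t)=\psi(t-x)$, $M_\omega\psi(t)=e^{i\omega t}\psi(t)$. Under the hypotheses on $\psi$ one has $\sup_\lambda\sum_p|\widehat\psi(\lambda+\frac{2\pi}\alpha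 p)|^2<\infty$, so the $h_{\lambda,\ell}$ are well defined. *)

theory Defs
  imports "HOL-Analysis.Analysis" "HOL-Probability.Essential_Supremum" "HOL-Real_Asymp.Real_Asymp"
begin

section \<open>Bohr almost periodic functions and their mean\<close>

definition bohr_ap :: "(real \<Rightarrow> complex) \<Rightarrow> bool" where
  "bohr_ap f \<longleftrightarrow> continuous_on UNIV f \<and>
     (\<forall>\<epsilon>>0. \<exists>L>0. \<forall>a b. b - a > L \<longrightarrow> (\<exists>\<tau>\<in>{a..b}. \<forall>t. cmod (f (t + \<tau>) - f t) \<le> \<epsilon>))"

lemma bohr_apE:
  assumes "bohr_ap f" "\<epsilon> > 0"
  obtains L where "L > 0" "\<And>a. \<exists>\<tau>. \<tau> \<in> {a..a+L} \<and> (\<forall>t. cmod (f (t + \<tau>) - f t) \<le> \<epsilon>)"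
proof -
  from assms obtain L where L: "L > 0"
    "\<forall>a b. b - a > L \<longrightarrow> (\<exists>\<tau>\<in>{a..b}. \<forall>t. cmod (f (t + \<tau>) - f t) \<le> \<epsilon>)"
    unfolding bohr_ap_def by blast
  have "\<exists>\<tau>. \<tau> \<in> {a..a+(L+1)} \<and> (\<forall>t. cmod (f (t + \<tau>) - f t) \<le> \<epsilon>)" for a
  proof -
    have "a + (L+1) - a > L" by simp
    with L(2) show ?thesis by blast
  qed
  then show ?thesis using L(1) by (intro that[of "L+1"]) auto
qed

lemma bohr_ap_bounded:
  assumes "bohr_ap f"
  obtains K where "K > 0" "\<And>t. cmod (f t) \<le> K"
proof -
  obtain L where L: "L > 0"
    "\<And>a. \<exists>\<tau>. \<tau> \<in> {a..a+L} \<and> (\<forall>t. cmod (f (t + \<tau>) - f t) \<le> 1)"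
    by (rule bohr_apE[OF assms(1), of "1"]) (use assms in auto)
  have "continuous_on {0..L} f" using assms unfolding bohr_ap_def
    by (meson continuous_on_subset subset_UNIV)
  then have "bounded (f ` {0..L})" 
    by (intro compact_imp_bounded compact_continuous_image) auto
  then obtain K where K: "\<And>t. t \<in> {0..L} \<Longrightarrow> cmod (f t) \<le> K"
    unfolding bounded_iff by blast
  have "cmod (f t) \<le> max K 0 + 1" for t
  proof -
    obtain \<tau> where \<tau>: "\<tau> \<in> {-t..-t+L}" "\<And>t. cmod (f (t + \<tau>) - f t) \<le> 1"
      using L(2)[of "-t"] by blast
    have "cmod (f (t+\<tau>)) \<le> K" using \<tau>(1) by (intro K) auto
    moreover have "cmod (f t) \<le> cmod (f (t+\<tau>)) + cmod (f (t+\<tau>) - f t)"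
      by (metis add.commute norm_minus_commute norm_triangle_sub)
    ultimately show ?thesis using \<tau>(2)[of t] by linarith
  qed
  then show ?thesis by (intro that[of "max K 0 + 1"]) auto
qed

lemma bohr_ap_uniform:
  assumes "bohr_ap f" "\<epsilon> > 0"
  obtains \<delta> where "\<delta> > 0" "\<And>s t. \<bar>s - t\<bar> < \<delta> \<Longrightarrow> cmod (f s - f t) < \<epsilon>"
proof -
  obtain L where L: "L > 0"
    "\<And>a. \<exists>\<tau>. \<tau> \<in> {a..a+L} \<and> (\<forall>t. cmod (f (t + \<tau>) - f t) \<le> \<epsilon>/3)"
    by (rule bohr_apE[OF assms(1), of "\<epsilon>/3"]) (use assms in auto)
  have "continuous_on {-1..L+1} f" using assms unfolding bohr_ap_def
    by (meson continuous_on_subset subset_UNIV)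
  then have "uniformly_continuous_on {-1..L+1} f"
    by (intro compact_uniformly_continuous) auto
  then obtain d where d: "d > 0" "\<And>s t. s \<in> {-1..L+1} \<Longrightarrow> t \<in> {-1..L+1} \<Longrightarrow> \<bar>s - t\<bar> < d \<Longrightarrow> cmod (f s - f t) < \<epsilon>/3"
    unfolding uniformly_continuous_on_def dist_norm real_norm_def
    using divide_pos_pos[OF assms(2) zero_less_numeral[of "num.Bit1 num.One"]] by meson
  have "cmod (f s - f t) < \<epsilon>" if "\<bar>s - t\<bar> < min d 1" for s t
  proof -
    obtain \<tau> where \<tau>: "\<tau> \<in> {-t..-t+L}" "\<And>t. cmod (f (t + \<tau>) - f t) \<le> \<epsilon>/3"
      using L(2)[of "-t"] by blast
    have "cmod (f (s+\<tau>) - f (t+\<tau>)) < \<epsilon>/3" using \<tau>(1) that L(1) by (intro d) auto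
    moreover
    have "cmod (f s - f t) \<le> cmod (f s - f (s+\<tau>)) + cmod (f (s+\<tau>) - f (t+\<tau>)) + cmod (f (t+\<tau>) - f t)"
      by (rule norm_diff_triangle_le[OF norm_diff_triangle_le[OF order_refl order_refl] order_refl])
    moreover have "cmod (f s - f (s+\<tau>)) = cmod (f (s+\<tau>) - f s)" by (rule norm_minus_commute)
    ultimately show ?thesis using \<tau>(2)[of t] \<tau>(2)[of s] by linarith
  qed
  then show ?thesis using d(1) by (intro that[of "min d 1"]) auto
qed

lemma bohr_ap_net:
  assumes "bohr_ap f" "\<epsilon> > 0"
  obtains S where "finite S" "\<And>s. \<exists>s'\<in>S. \<forall>t. cmod (f (t + s) - f (t + s')) \<le> \<epsilon>"
proof -
  obtain L where L: "L > 0"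
    "\<And>a. \<exists>\<tau>. \<tau> \<in> {a..a+L} \<and> (\<forall>t. cmod (f (t + \<tau>) - f t) \<le> \<epsilon>/2)"
    by (rule bohr_apE[OF assms(1), of "\<epsilon>/2"]) (use assms in auto)
  obtain d where d: "d > 0" "\<And>s t. \<bar>s - t\<bar> < d \<Longrightarrow> cmod (f s - f t) < \<epsilon>/2"
    using bohr_ap_uniform[OF assms(1), of "\<epsilon>/2"] assms(2) by auto
  have "seq_compact {0..L}"
    using compact_imp_seq_compact by blast
  then obtain S where S: "finite S" "{0..L} \<subseteq> (\<Union>x\<in>S. ball x d)"
    using seq_compact_imp_totally_bounded[of "{0..L}", rule_format, OF _ d(1)] by blast
  have "\<exists>s'\<in>S. \<forall>t. cmod (f (t + s) - f (t + s')) \<le> \<epsilon>" for s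
  proof -
    obtain \<tau> where \<tau>: "\<tau> \<in> {s-L..s-L+L}" "\<And>t. cmod (f (t + \<tau>) - f t) \<le> \<epsilon>/2"
      using L(2)[of "s-L"] by blast
    then have "s - \<tau> \<in> {0..L}" by auto
    then have "s - \<tau> \<in> (\<Union>x\<in>S. ball x d)" using S(2) by blast
    then obtain s' where s': "s' \<in> S" "\<bar>s' - (s - \<tau>)\<bar> < d"
      by (auto simp: dist_real_def)
    have "cmod (f (t + s) - f (t + s')) \<le> \<epsilon>" for t
    proof -
      have "cmod (f (t + s - \<tau> + \<tau>) - f (t + s - \<tau>)) \<le> \<epsilon>/2" by (rule \<tau>(2))
      moreover have "cmod (f (t + s - \<tau>) - f (t + s')) < \<epsilon>/2" using s'(2) by (intro d) auto
      moreover have "cmod (f (t + s) - f (t + s')) \<le> cmod (f (t + s) - f (t+s-\<tau>)) + cmod (f (t + s - \<tau>) - f (t + s'))"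
        by (rule norm_diff_triangle_le[OF order_refl order_refl])
      ultimately show ?thesis by simp
    qed
    then show ?thesis using s'(1) by blast
  qed
  then show ?thesis using S(1) that by blast
qed

lemma bohr_apI_net:
  assumes "continuous_on UNIV f"
    and "\<And>\<epsilon>. \<epsilon> > 0 \<Longrightarrow> \<exists>S. finite S \<and> (\<forall>s. \<exists>s'\<in>S. \<forall>t. cmod (f (t + s) - f (t + s')) \<le> \<epsilon>)"
  shows "bohr_ap f"
  unfolding bohr_ap_def
proof (intro conjI allI impI assms(1))
  fix \<epsilon> :: real assume "\<epsilon> > 0"
  then obtain S where S: "finite S" "\<And>s. \<exists>s'\<in>S. \<forall>t. cmod (f (t + s) - f (t + s')) \<le> \<epsilon>"
    using assms(2) by blast
  obtain R where R: "R > 0" "\<And>s. s \<in> S \<Longrightarrow> \<bar>s\<bar> \<le> R"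
    using finite_imp_bounded[OF S(1)] unfolding bounded_pos by auto
  show "\<exists>L>0. \<forall>a b. b - a > L \<longrightarrow> (\<exists>\<tau>\<in>{a..b}. \<forall>t. cmod (f (t + \<tau>) - f t) \<le> \<epsilon>)"
  proof (intro exI[of _ "2*R"] conjI allI impI)
    fix a b assume ab: "b - a > 2 * R"
    obtain s' where s': "s' \<in> S" "\<And>t. cmod (f (t + (a+b)/2) - f (t + s')) \<le> \<epsilon>"
      using S(2) by blast
    show "\<exists>\<tau>\<in>{a..b}. \<forall>t. cmod (f (t + \<tau>) - f t) \<le> \<epsilon>"
    proof (intro bexI[of _ "(a+b)/2 - s'"] allI)
      fix t show "cmod (f (t + ((a+b)/2 - s')) - f t) \<le> \<epsilon>"
        using s'(2)[of "t - s'"] by (simp add: algebra_simps)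
      show "(a+b)/2 - s' \<in> {a..b}" using R(2)[OF s'(1)] ab by (auto simp: field_simps abs_le_iff)
    qed
  qed (use R in auto)
qed

lemma bohr_ap_dominated:
  assumes f: "bohr_ap f" and g: "bohr_ap g" and h: "continuous_on UNIV h" and K: "K > 0"
    and le: "\<And>t u. cmod (h t - h u) \<le> K * (cmod (f t - f u) + cmod (g t - g u))"
  shows "bohr_ap h"
proof (rule bohr_apI_net[OF h])
  fix \<epsilon> :: real assume "\<epsilon> > 0"
  then have e: "\<epsilon>/(4*K) > 0" using K by simp
  obtain S where S: "finite S" "\<And>s. \<exists>s'\<in>S. \<forall>t. cmod (f (t + s) - f (t + s')) \<le> \<epsilon>/(4*K)"
    using bohr_ap_net[OF f e] by blast
  obtain S' where S': "finite S'" "\<And>s. \<exists>s'\<in>S'. \<forall>t. cmod (g (t + s) - g (t + s')) \<le> \<epsilon>/(4*K)"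
    using bohr_ap_net[OF g e] by blast
  obtain c where c: "\<And>s. c s \<in> S" "\<And>s t. cmod (f (t + s) - f (t + c s)) \<le> \<epsilon>/(4*K)"
    using S(2) by metis
  obtain c' where c': "\<And>s. c' s \<in> S'" "\<And>s t. cmod (g (t + s) - g (t + c' s)) \<le> \<epsilon>/(4*K)"
    using S'(2) by metis
  define C where "C = (\<lambda>s. (c s, c' s))"
  have "range C \<subseteq> S \<times> S'" using c(1) c'(1) by (auto simp: C_def)
  then have fin: "finite (range C)" using S(1) S'(1) by (meson finite_SigmaI finite_subset)
  show "\<exists>S. finite S \<and> (\<forall>s. \<exists>s'\<in>S. \<forall>t. cmod (h (t + s) - h (t + s')) \<le> \<epsilon>)"
  proof (intro exI[of _ "inv C ` range C"] conjI allI)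
    show "finite (inv C ` range C)" using fin by simp
    fix s
    define r where "r = inv C (C s)"
    have "C r = C s" unfolding r_def by (simp add: f_inv_into_f)
    then have r: "c r = c s" "c' r = c' s" by (auto simp: C_def)
    have "cmod (h (t + s) - h (t + r)) \<le> \<epsilon>" for t
    proof -
      have "cmod (f (t + s) - f (t + r)) \<le> \<epsilon>/(4*K) + \<epsilon>/(4*K)"
        using c(2)[of t r] norm_minus_commute[of "f (t + r)" "f (t + c s)"] unfolding r
        by (intro norm_diff_triangle_le[OF c(2)[of t s]]) simp
      moreover have "cmod (g (t + s) - g (t + r)) \<le> \<epsilon>/(4*K) + \<epsilon>/(4*K)"
        using c'(2)[of t r] norm_minus_commute[of "g (t + r)" "g (t + c' s)"] unfolding r
        by (intro norm_diff_triangle_le[OF c'(2)[of t s]]) simp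
      ultimately have "cmod (f (t + s) - f (t + r)) + cmod (g (t + s) - g (t + r)) \<le> \<epsilon>/K"
        by simp
      then have "K * (cmod (f (t + s) - f (t + r)) + cmod (g (t + s) - g (t + r))) \<le> \<epsilon>"
        using K by (simp add: field_simps)
      with le show ?thesis by (meson order_trans)
    qed
    then show "\<exists>s'\<in>inv C ` range C. \<forall>t. cmod (h (t + s) - h (t + s')) \<le> \<epsilon>"
      by (intro bexI[of _ r]) (auto simp: r_def)
  qed
qed

lemma bohr_ap_const: "bohr_ap (\<lambda>_. c)"
  unfolding bohr_ap_def
proof (intro conjI allI impI)
  fix \<epsilon> :: real assume "\<epsilon> > 0"
  then have *: "\<exists>\<tau>\<in>{a..b}. \<forall>t::real. cmod (c - c) \<le> \<epsilon>" if "b - a > 1" for a b :: real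
    using that by (intro bexI[of _ a]) auto
  show "\<exists>L>0. \<forall>a b::real. b - a > L \<longrightarrow> (\<exists>\<tau>\<in>{a..b}. \<forall>t::real. cmod (c - c) \<le> \<epsilon>)"
    by (intro exI[of _ 1] conjI allI impI *) simp_all
qed auto

lemma bohr_ap_add: assumes "bohr_ap f" "bohr_ap g" shows "bohr_ap (\<lambda>t. f t + g t)"
proof (rule bohr_ap_dominated[OF assms, of _ 1])
  show "continuous_on UNIV (\<lambda>t. f t + g t)"
    using assms unfolding bohr_ap_def by (auto intro!: continuous_intros)
  fix t u show "cmod (f t + g t - (f u + g u)) \<le> 1 * (cmod (f t - f u) + cmod (g t - g u))"
    using norm_triangle_ineq[of "f t - f u" "g t - g u"] by (simp add: algebra_simps)
qed auto

lemma bohr_ap_mult: assumes "bohr_ap f" "bohr_ap g" shows "bohr_ap (\<lambda>t. f t * g t)"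
proof -
  obtain K where K: "K > 0" "\<And>t. cmod (f t) \<le> K" using bohr_ap_bounded[OF assms(1)] by blast
  obtain K' where K': "K' > 0" "\<And>t. cmod (g t) \<le> K'" using bohr_ap_bounded[OF assms(2)] by blast
  show ?thesis
  proof (rule bohr_ap_dominated[OF assms, of _ "K + K'"])
    show "continuous_on UNIV (\<lambda>t. f t * g t)"
      using assms unfolding bohr_ap_def by (auto intro!: continuous_intros)
    fix t u
    have "f t * g t - f u * g u = (f t - f u) * g t + f u * (g t - g u)"
      by (simp add: algebra_simps)
    then have "cmod (f t * g t - f u * g u) \<le> cmod (f t - f u) * cmod (g t) + cmod (f u) * cmod (g t - g u)"
      by (metis norm_mult norm_triangle_ineq)
    also have "\<dots> \<le> cmod (f t - f u) * (K+K') + (K+K') * cmod (g t - g u)"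
      using K(1) K'(1) K(2)[of u] K'(2)[of t]
      by (intro add_mono mult_left_mono mult_right_mono) auto
    finally show "cmod (f t * g t - f u * g u) \<le> (K+K') * (cmod (f t - f u) + cmod (g t - g u))"
      by (simp add: algebra_simps)
  qed (use K K' in auto)
qed

lemma bohr_ap_cnj: assumes "bohr_ap f" shows "bohr_ap (\<lambda>t. cnj (f t))"
proof (rule bohr_ap_dominated[OF assms assms, of _ 1])
  show "continuous_on UNIV (\<lambda>t. cnj (f t))"
    using assms unfolding bohr_ap_def by (auto intro!: continuous_intros)
  fix t u show "cmod (cnj (f t) - cnj (f u)) \<le> 1 * (cmod (f t - f u) + cmod (f t - f u))"
    by (metis complex_cnj_diff complex_mod_cnj le_add_same_cancel1 mult_1 norm_ge_zero)
qed auto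

lemma bohr_ap_exp: "bohr_ap (\<lambda>t. exp (\<i> * of_real (w * t)))"
proof (cases "w = 0")
  case True then show ?thesis using bohr_ap_const[of 1] by simp
next
  case False
  define P where "P = 2 * pi / \<bar>w\<bar>"
  have P: "P > 0" using False by (simp add: P_def)
  have per: "exp (\<i> * of_real (w * (t + of_int n * P))) = exp (\<i> * of_real (w * t))" for t n
  proof -
    have "w * (t + of_int n * P) = w * t + 2 * pi * of_int (n * (if w > 0 then 1 else -1))"
      using False by (auto simp: P_def field_simps)
    then show ?thesis
      by (metis cis_conv_exp cis_mult cis_multiple_2pi Ints_of_int mult.right_neutral)
  qed
  show ?thesis unfolding bohr_ap_def
  proof (intro conjI allI impI)
    fix \<epsilon> :: real assume "\<epsilon> > 0"
    show "\<exists>L>0. \<forall>a b. b - a > L \<longrightarrow> (\<exists>\<tau>\<in>{a..b}. \<forall>t. cmod (exp (\<i> * of_real (w * (t + \<tau>))) - exp (\<i> * of_real (w * t))) \<le> \<epsilon>)"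
    proof (intro exI[of _ P] conjI allI impI P)
      fix a b assume ab: "b - a > P"
      show "\<exists>\<tau>\<in>{a..b}. \<forall>t. cmod (exp (\<i> * of_real (w * (t + \<tau>))) - exp (\<i> * of_real (w * t))) \<le> \<epsilon>"
      proof (intro bexI[of _ "of_int \<lceil>a/P\<rceil> * P"] allI)
        have "a / P \<le> \<lceil>a/P\<rceil>" "\<lceil>a/P\<rceil> < a / P + 1" by linarith+
        then have "a \<le> of_int \<lceil>a/P\<rceil> * P" "of_int \<lceil>a/P\<rceil> * P < a + P" using P by (simp_all only: pos_divide_le_eq[OF P]) (simp add: field_simps)
        then show "of_int \<lceil>a/P\<rceil> * P \<in> {a..b}" using ab by auto
      qed (use \<open>\<epsilon> > 0\<close> in \<open>simp only: per, simp\<close>)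
    qed
  qed (auto intro!: continuous_intros)
qed

definition ap_mean :: "(real \<Rightarrow> complex) \<Rightarrow> complex" where
  "ap_mean f = Lim at_top (\<lambda>T. integral {-T..T} f / of_real (2 * T))"

lemma bohr_ap_cont: "bohr_ap f \<Longrightarrow> continuous_on A f"
  unfolding bohr_ap_def by (meson continuous_on_subset subset_UNIV)

lemma bohr_ap_integrable: "bohr_ap f \<Longrightarrow> f integrable_on {a..b}"
  by (intro integrable_continuous_real bohr_ap_cont)

lemma cont_shift:
  assumes "continuous_on UNIV f" shows "continuous_on A (\<lambda>t. f (r + t :: real) :: complex)"
  by (rule continuous_on_compose2[OF assms]) (auto intro!: continuous_intros)

lemma integral_shift_diff:
  fixes f :: "real \<Rightarrow> complex"
  assumes c: "continuous_on UNIV f" and K: "\<And>t. cmod (f t) \<le> K" and T: "T \<ge> 0"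
  shows "cmod (integral {-T..T} (\<lambda>t. f (r + t)) - integral {-T..T} f) \<le> 2 * K * \<bar>r\<bar>"
proof -
  define R where "R = T + \<bar>r\<bar>"
  obtain F where F: "\<And>x. x \<in> {-R..R} \<Longrightarrow> (F has_vector_derivative f x) (at x within {-R..R})"
    using antiderivative_continuous[of "-R" R f] c by (meson continuous_on_subset subset_UNIV)
  have F': "(f has_integral (F b - F a)) {a..b}" if "a \<le> b" "-R \<le> a" "b \<le> R" for a b
    using that by (intro fundamental_theorem_of_calculus)
       (auto intro!: has_vector_derivative_within_subset[OF F, where T="{a..b}"])
  have Fd: "cmod (F b - F a) \<le> K * (b - a)" if "a \<le> b" "-R \<le> a" "b \<le> R" for a b
    using has_integral_bound[OF _ F'[OF that, folded cbox_interval]] K order_trans[OF norm_ge_zero K] that by auto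
  have 1: "integral {-T..T} f = F T - F (-T)"
    using F'[of "-T" T] T by (auto simp: R_def intro!: integral_unique)
  have "integral {-T..T} (\<lambda>t. f (r + t)) = integral {-T+r..T+r} f"
    using integral_shift_Icc_real[of "-T" T f r] by (simp add: o_def)
  also have "\<dots> = F (T + r) - F (-T + r)"
    using F'[of "-T+r" "T+r"] T by (auto simp: R_def intro!: integral_unique)
  finally have 2: "integral {-T..T} (\<lambda>t. f (r + t)) - integral {-T..T} f = (F (T+r) - F T) - (F (-T+r) - F (-T))"
    using 1 by simp
  have "cmod (F (x+r) - F x) \<le> K * \<bar>r\<bar>" if "\<bar>x\<bar> \<le> T" for x
  proof (cases "r \<ge> 0")
    case True then show ?thesis using Fd[of x "x+r"] that by (auto simp: R_def)
  next
    case False then show ?thesis using Fd[of "x+r" x] that by (auto simp: R_def norm_minus_commute)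
  qed
  from this[of T] this[of "-T"] show ?thesis unfolding 2
    using norm_triangle_ineq4[of "F (T+r) - F T" "F (-T+r) - F (-T)"] T by auto
qed

lemma ap_mean_aux:
  assumes f: "bohr_ap f" and e: "\<epsilon> > 0"
  obtains C where "C \<ge> 0" "\<And>a T. T > 0 \<Longrightarrow>
    cmod (integral {-T..T} (\<lambda>t. f (a + t)) - integral {-T..T} f) \<le> 2 * T * \<epsilon> + C"
proof -
  obtain K where K: "K > 0" "\<And>t. cmod (f t) \<le> K" using bohr_ap_bounded[OF f] by blast
  obtain S where S: "finite S" "\<And>s. \<exists>s'\<in>S. \<forall>t. cmod (f (t + s) - f (t + s')) \<le> \<epsilon>"
    using bohr_ap_net[OF f e] by blast
  obtain R where R: "R > 0" "\<And>s. s \<in> S \<Longrightarrow> \<bar>s\<bar> \<le> R"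
    using finite_imp_bounded[OF S(1)] unfolding bounded_pos by auto
  have c: "continuous_on UNIV f" using f bohr_ap_cont by blast
  have "cmod (integral {-T..T} (\<lambda>t. f (a + t)) - integral {-T..T} f) \<le> 2 * T * \<epsilon> + 2 * K * R" if T: "T > 0" for a T
  proof -
    obtain s where s: "s \<in> S" "\<And>t. cmod (f (t + a) - f (t + s)) \<le> \<epsilon>" using S(2) by blast
    have i: "(\<lambda>t. f (r + t)) integrable_on {-T..T}" for r
      by (intro integrable_continuous_real cont_shift c)
    have "cmod (integral {-T..T} (\<lambda>t. f (a + t) - f (s + t))) \<le> \<epsilon> * (T - (-T))"
      using s(2) T by (intro integral_bound continuous_intros cont_shift c) (auto simp: add.commute)
    then have "cmod (integral {-T..T} (\<lambda>t. f (a + t)) - integral {-T..T} (\<lambda>t. f (s + t))) \<le> 2 * T * \<epsilon>"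
      using integral_diff[OF i i, of a s] by (simp add: mult.commute)
    moreover have "cmod (integral {-T..T} (\<lambda>t. f (s + t)) - integral {-T..T} f) \<le> 2 * K * \<bar>s\<bar>"
      using T by (intro integral_shift_diff c K) auto
    moreover have "2 * K * \<bar>s\<bar> \<le> 2 * K * R" using K(1) R(2)[OF s(1)] by simp
    ultimately show ?thesis using norm_diff_triangle_le by fastforce
  qed
  then show ?thesis using K(1) R(1) by (intro that[of "2 * K * R"]) auto
qed

lemma ap_mean_cauchy:
  assumes f: "bohr_ap f" and e: "\<epsilon> > 0"
  obtains T0 where "T0 > 0" "\<And>S T. S > T0 \<Longrightarrow> T > T0 \<Longrightarrow>
    cmod (integral {-S..S} f / of_real (2 * S) - integral {-T..T} f / of_real (2 * T)) \<le> \<epsilon>"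
proof -
  have c: "continuous_on UNIV f" using f bohr_ap_cont by blast
  have "\<epsilon>/4 > 0" using e by simp
  then obtain C where C: "C \<ge> 0" "\<And>a T. T > 0 \<Longrightarrow>
    cmod (integral {-T..T} (\<lambda>t. f (a + t)) - integral {-T..T} f) \<le> 2 * T * (\<epsilon>/4) + C"
    using ap_mean_aux[OF f] by metis
  define I where "I = (\<lambda>S T. integral {-S..S} (\<lambda>a. integral {-T..T} (\<lambda>t. f (a + t))))"
  have cont2: "continuous_on X (\<lambda>(x, y). f (x + y))" for X
    unfolding case_prod_unfold
    by (rule continuous_on_compose2[OF c]) (auto intro!: continuous_intros)
  have sw: "I S T = I T S" for S T
    unfolding I_def
    using integral_swap_continuous[of "-S" "-T" S T "\<lambda>x y. f (x + y)"] cont2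
    by (simp add: cbox_interval add.commute)
  have ic: "continuous_on {-S..S} (\<lambda>a. integral {-T..T} (\<lambda>t. f (a + t)))" for S T
    using integral_continuous_on_param[of "{-S..S}" "-T" T "\<lambda>x y. f (x + y)"] cont2[of "{-S..S} \<times> {-T..T}"]
    by (simp add: cbox_interval)
  have b: "cmod (I S T / of_real (4 * S * T) - integral {-T..T} f / of_real (2 * T)) \<le> \<epsilon>/4 + C / (2*T)"
    if S: "S > 0" and T: "T > 0" for S T
  proof -
    have "cmod (integral {-S..S} (\<lambda>a. integral {-T..T} (\<lambda>t. f (a + t)) - integral {-T..T} f)) \<le> (2 * T * (\<epsilon>/4) + C) * (S - (-S))"
      using S T C(2)[OF T] by (intro integral_bound continuous_intros ic) auto
    also have "integral {-S..S} (\<lambda>a. integral {-T..T} (\<lambda>t. f (a + t)) - integral {-T..T} f) = I S T - of_real (2 * S) * integral {-T..T} f"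
      unfolding I_def using S
      by (subst integral_diff) (auto intro!: integrable_continuous_real ic simp: scaleR_conv_of_real)
    finally have "cmod (I S T - of_real (2 * S) * integral {-T..T} f) \<le> (2 * T * (\<epsilon>/4) + C) * (2 * S)" by simp
    then have "cmod (I S T - of_real (2 * S) * integral {-T..T} f) / (4 * S * T) \<le> (2 * T * (\<epsilon>/4) + C) * (2 * S) / (4 * S * T)"
      using S T by (intro divide_right_mono) auto
    also have "(2 * T * (\<epsilon>/4) + C) * (2 * S) / (4 * S * T) = \<epsilon>/4 + C / (2*T)"
      using S T by (simp add: field_simps)
    also have "cmod (I S T - of_real (2 * S) * integral {-T..T} f) / (4 * S * T) = cmod ((I S T - of_real (2 * S) * integral {-T..T} f) / of_real (4 * S * T))"
      using S T by (simp add: norm_divide norm_mult)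
    also have "(I S T - of_real (2 * S) * integral {-T..T} f) / of_real (4 * S * T) = I S T / of_real (4 * S * T) - integral {-T..T} f / of_real (2 * T)"
      using S T by (simp add: field_simps)
    finally show ?thesis .
  qed
  define T0 where "T0 = max 1 (2 * C / \<epsilon>)"
  show ?thesis
  proof (rule that[of T0])
    show "T0 > 0" by (simp add: T0_def)
    fix S T assume ST: "S > T0" "T > T0"
    then have pos: "S > 0" "T > 0" by (auto simp: T0_def)
    have "C / (2*T) \<le> \<epsilon>/4" "C / (2*S) \<le> \<epsilon>/4"
      using ST pos e C(1) by (auto simp: T0_def field_simps)
    moreover have "cmod (I S T / of_real (4 * S * T) - integral {-T..T} f / of_real (2 * T)) \<le> \<epsilon>/4 + C / (2*T)"
      using b pos by blast
    moreover have "cmod (I S T / of_real (4 * S * T) - integral {-S..S} f / of_real (2 * S)) \<le> \<epsilon>/4 + C / (2*S)"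
      using b[OF pos(2) pos(1)] sw[of S T] by (simp add: mult_ac)
    ultimately have "cmod (integral {-S..S} f / of_real (2 * S) - I S T / of_real (4 * S * T)) \<le> \<epsilon>/2"
      "cmod (I S T / of_real (4 * S * T) - integral {-T..T} f / of_real (2 * T)) \<le> \<epsilon>/2"
      by (auto simp: norm_minus_commute)
    from norm_diff_triangle_le[OF this]
    show "cmod (integral {-S..S} f / of_real (2 * S) - integral {-T..T} f / of_real (2 * T)) \<le> \<epsilon>" by simp
  qed
qed

lemma ap_mean_tendsto:
  assumes f: "bohr_ap f"
  shows "((\<lambda>T. integral {-T..T} f / of_real (2 * T)) \<longlongrightarrow> ap_mean f) at_top"
proof -
  define m where "m = (\<lambda>T. integral {-T..T} f / of_real (2 * T))"
  have c: "\<exists>T0>0. \<forall>S T. S > T0 \<longrightarrow> T > T0 \<longrightarrow> dist (m S) (m T) < \<epsilon>" if "\<epsilon> > 0" for \<epsilon>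
  proof -
    from that have h: "\<epsilon>/2 > 0" by simp
    obtain T0 where "T0 > 0" "\<And>S T. S > T0 \<Longrightarrow> T > T0 \<Longrightarrow> cmod (m S - m T) \<le> \<epsilon>/2"
      using ap_mean_cauchy[OF f h] unfolding m_def by metis
    then show ?thesis using that by (intro exI[of _ T0]) (force simp: dist_norm)
  qed
  have "Cauchy (\<lambda>n. m (real n))"
  proof (rule metric_CauchyI)
    fix \<epsilon> :: real assume "\<epsilon> > 0"
    then obtain T0 where T0: "T0 > 0" "\<forall>S T. S > T0 \<longrightarrow> T > T0 \<longrightarrow> dist (m S) (m T) < \<epsilon>" using c by blast
    obtain N where "real N > T0" using reals_Archimedean2 by blast
    then show "\<exists>M. \<forall>k\<ge>M. \<forall>n\<ge>M. dist (m (real k)) (m (real n)) < \<epsilon>"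
      using T0(2) by (intro exI[of _ N]) auto
  qed
  then obtain l where l: "(\<lambda>n. m (real n)) \<longlonglongrightarrow> l"
    using Cauchy_convergent convergent_def by blast
  have "(m \<longlongrightarrow> l) at_top"
  proof (rule tendstoI)
    fix \<epsilon> :: real assume "\<epsilon> > 0"
    then have h: "\<epsilon>/2 > 0" by simp
    obtain T0 where T0: "T0 > 0" "\<forall>S T. S > T0 \<longrightarrow> T > T0 \<longrightarrow> dist (m S) (m T) < \<epsilon>/2" using c[OF h] by blast
    have "\<forall>\<^sub>F n in sequentially. dist (m (real n)) l < \<epsilon>/2" using tendstoD[OF l h] .
    moreover have "\<forall>\<^sub>F n in sequentially. real n > T0"
      using filterlim_real_sequentially filterlim_at_top_dense by blast
    ultimately have "\<forall>\<^sub>F n in sequentially. dist (m (real n)) l < \<epsilon>/2 \<and> real n > T0" by eventually_elim auto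
    then obtain n where n: "dist (m (real n)) l < \<epsilon>/2" "real n > T0"
      using eventually_happens' sequentially_bot by blast
    have "dist (m T) l < \<epsilon>" if "T > T0" for T
    proof -
      have "dist (m T) (m (real n)) < \<epsilon>/2" using T0(2) that n(2) by blast
      then show ?thesis using dist_triangle[of "m T" l "m (real n)"] n(1) by linarith
    qed
    then show "\<forall>\<^sub>F T in at_top. dist (m T) l < \<epsilon>"
      by (rule eventually_mono[OF eventually_gt_at_top[of T0]])
  qed
  moreover from this have "Lim at_top m = l" by (intro tendsto_Lim) auto
  ultimately show ?thesis unfolding ap_mean_def m_def by simp
qed

lemma ap_mean_eqI:
  assumes "((\<lambda>T. integral {-T..T} f / of_real (2 * T)) \<longlongrightarrow> l) at_top"
  shows "ap_mean f = l"
  unfolding ap_mean_def using assms by (intro tendsto_Lim) auto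

lemma ap_mean_add:
  assumes "bohr_ap f" "bohr_ap g" shows "ap_mean (\<lambda>t. f t + g t) = ap_mean f + ap_mean g"
  using tendsto_add[OF ap_mean_tendsto[OF assms(1)] ap_mean_tendsto[OF assms(2)]]
  by (intro ap_mean_eqI) (simp add: integral_add bohr_ap_integrable assms add_divide_distrib)

lemma ap_mean_cmult:
  assumes "bohr_ap f" shows "ap_mean (\<lambda>t. c * f t) = c * ap_mean f"
  using tendsto_mult_left[OF ap_mean_tendsto[OF assms], of c]
  by (intro ap_mean_eqI) simp

lemma ap_mean_cnj:
  assumes "bohr_ap f" shows "ap_mean (\<lambda>t. cnj (f t)) = cnj (ap_mean f)"
  using tendsto_cnj[OF ap_mean_tendsto[OF assms]]
  by (intro ap_mean_eqI) (simp add: integral_cnj)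

lemma bohr_ap_shift: assumes "bohr_ap f" shows "bohr_ap (\<lambda>t. f (r + t))"
  unfolding bohr_ap_def
proof (intro conjI allI impI)
  show "continuous_on UNIV (\<lambda>t. f (r + t))" using assms by (intro cont_shift bohr_ap_cont)
  fix \<epsilon> :: real assume "\<epsilon> > 0"
  then obtain L where "L > 0" "\<forall>a b. b - a > L \<longrightarrow> (\<exists>\<tau>\<in>{a..b}. \<forall>t. cmod (f (t + \<tau>) - f t) \<le> \<epsilon>)"
    using assms unfolding bohr_ap_def by blast
  then show "\<exists>L>0. \<forall>a b. b - a > L \<longrightarrow> (\<exists>\<tau>\<in>{a..b}. \<forall>t. cmod (f (r + (t + \<tau>)) - f (r + t)) \<le> \<epsilon>)"
    by (intro exI[of _ L]) (metis add.assoc)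
qed

lemma ap_mean_shift:
  assumes f: "bohr_ap f" shows "ap_mean (\<lambda>t. f (r + t)) = ap_mean f"
proof -
  obtain K where K: "K > 0" "\<And>t. cmod (f t) \<le> K" using bohr_ap_bounded[OF f] by blast
  have "((\<lambda>T. (integral {-T..T} (\<lambda>t. f (r + t)) - integral {-T..T} f) / of_real (2 * T)) \<longlongrightarrow> 0) at_top"
  proof (rule Lim_null_comparison)
    show "\<forall>\<^sub>F T in at_top. cmod ((integral {-T..T} (\<lambda>t. f (r + t)) - integral {-T..T} f) / of_real (2 * T)) \<le> (2 * K * \<bar>r\<bar>) / (2 * T)"
      using eventually_gt_at_top[of "0::real"]
    proof eventually_elim
      case (elim T)
      have "cmod (integral {-T..T} (\<lambda>t. f (r + t)) - integral {-T..T} f) \<le> 2 * K * \<bar>r\<bar>"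
        using elim f by (intro integral_shift_diff K bohr_ap_cont) auto
      then have "cmod (integral {-T..T} (\<lambda>t. f (r + t)) - integral {-T..T} f) / (2 * T) \<le> (2 * K * \<bar>r\<bar>) / (2 * T)"
        using elim by (intro divide_right_mono) auto
      then show ?case using elim by (simp add: norm_divide norm_mult)
    qed
    show "((\<lambda>T. (2 * K * \<bar>r\<bar>) / (2 * T)) \<longlongrightarrow> 0) at_top" by real_asymp
  qed
  from tendsto_add[OF this ap_mean_tendsto[OF f]] show ?thesis
    by (intro ap_mean_eqI) (simp add: diff_divide_distrib)
qed

lemma ap_mean_Re_mono:
  assumes f: "bohr_ap f" and g: "bohr_ap g" and le: "\<And>t. Re (f t) \<le> Re (g t)"
  shows "Re (ap_mean f) \<le> Re (ap_mean g)"
proof (rule tendsto_le)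
  show "((\<lambda>T. Re (integral {-T..T} f / of_real (2 * T))) \<longlongrightarrow> Re (ap_mean f)) at_top"
    "((\<lambda>T. Re (integral {-T..T} g / of_real (2 * T))) \<longlongrightarrow> Re (ap_mean g)) at_top"
    by (intro tendsto_Re ap_mean_tendsto f g)+
  show "\<forall>\<^sub>F T in at_top. Re (integral {-T..T} f / of_real (2 * T)) \<le> Re (integral {-T..T} g / of_real (2 * T))"
    using eventually_gt_at_top[of "0::real"]
  proof eventually_elim
    case (elim T)
    have "Re (integral {-T..T} f) \<le> Re (integral {-T..T} g)"
      using integral_component_le[of 1 f "{-T..T}" g] le f g
      by (simp add: Basis_complex_def bohr_ap_integrable)
    then show ?case using elim by (simp add: Re_divide_of_real divide_right_mono del: of_real_mult)
  qed
qed simp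

lemma ap_mean_const: "ap_mean (\<lambda>_. c) = c"
proof (rule ap_mean_eqI)
  have "\<forall>\<^sub>F T in at_top. c = integral {-T..T} (\<lambda>_. c) / of_real (2 * T)"
    using eventually_gt_at_top[of "0::real"] by eventually_elim (simp add: scaleR_conv_of_real)
  then show "((\<lambda>T. integral {-T..T} (\<lambda>_. c) / of_real (2 * T)) \<longlongrightarrow> c) at_top"
    by (rule Lim_transform_eventually[OF tendsto_const])
qed

lemma ap_mean_sum:
  assumes "finite S" "\<And>s. s \<in> S \<Longrightarrow> bohr_ap (f s)"
  shows "bohr_ap (\<lambda>t. \<Sum>s\<in>S. f s t) \<and> ap_mean (\<lambda>t. \<Sum>s\<in>S. f s t) = (\<Sum>s\<in>S. ap_mean (f s))"
  using assms by (induction S rule: finite_induct) (auto simp: bohr_ap_const ap_mean_const bohr_ap_add ap_mean_add)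

lemma ap_mean_pos_definite:
  assumes f: "bohr_ap f" and nn: "\<And>t. Re (f t) \<ge> 0" and z: "Re (ap_mean f) = 0"
  shows "Re (f t0) = 0"
proof (rule ccontr)
  assume "Re (f t0) \<noteq> 0"
  with nn[of t0] have pos: "Re (f t0) / 2 > 0" by simp
  obtain S where S: "finite S" "\<And>s. \<exists>s'\<in>S. \<forall>t. cmod (f (t + s) - f (t + s')) \<le> Re (f t0) / 2"
    using bohr_ap_net[OF f pos] by blast
  define g where "g = (\<lambda>t. \<Sum>s\<in>S. f (t0 - s + t))"
  have g: "bohr_ap g" "ap_mean g = (\<Sum>s\<in>S. ap_mean f)"
    unfolding g_def using ap_mean_sum[of S "\<lambda>s t. f (t0 - s + t)"] S(1) f by (auto simp: bohr_ap_shift ap_mean_shift)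
  have "Re (f t0) / 2 \<le> Re (g t)" for t
  proof -
    obtain s where s: "s \<in> S" "\<And>u. cmod (f (u + t) - f (u + s)) \<le> Re (f t0) / 2" using S(2) by blast
    have "cmod (f (t0 - s + t) - f t0) \<le> Re (f t0) / 2" using s(2)[of "t0 - s"] by simp
    then have "Re (f t0) / 2 \<le> Re (f (t0 - s + t))"
      using abs_Re_le_cmod[of "f (t0 - s + t) - f t0"] by simp
    also have "\<dots> \<le> (\<Sum>s\<in>S. Re (f (t0 - s + t)))"
      using member_le_sum[of s S "\<lambda>s. Re (f (t0 - s + t))"] s(1) nn S(1) by simp
    finally show ?thesis by (simp add: g_def)
  qed
  then have "Re (ap_mean (\<lambda>_. of_real (Re (f t0) / 2))) \<le> Re (ap_mean g)"
    by (intro ap_mean_Re_mono g bohr_ap_const) auto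
  then show False using pos z by (simp add: ap_mean_const g)
qed

section \<open>Complex inner product spaces\<close>

text \<open>
  The inner product is linear in the first and conjugate linear in the second argument.
  The real structure (norm, distance, topology) comes from \<open>real_inner\<close>;
  \<open>1 *\<^sub>C x = x\<close> follows from \<open>scaleR_scaleC\<close>.
\<close>

class complex_inner = real_inner +
  fixes scaleC :: "complex \<Rightarrow> 'a \<Rightarrow> 'a" (infixr \<open>*\<^sub>C\<close> 75)
    and cinner :: "'a \<Rightarrow> 'a \<Rightarrow> complex"
  assumes scaleC_add_right: "a *\<^sub>C (x + y) = a *\<^sub>C x + a *\<^sub>C y"
    and scaleC_add_left: "(a + b) *\<^sub>C x = a *\<^sub>C x + b *\<^sub>C x"
    and scaleC_scaleC: "a *\<^sub>C (b *\<^sub>C x) = (a * b) *\<^sub>C x"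
    and scaleR_scaleC: "r *\<^sub>R x = of_real r *\<^sub>C x"
    and cinner_add_left: "cinner (x + y) z = cinner x z + cinner y z"
    and cinner_scaleC_left: "cinner (a *\<^sub>C x) y = a * cinner x y"
    and cinner_commute: "cinner x y = cnj (cinner y x)"
    and inner_eq_Re_cinner: "inner x y = Re (cinner x y)"

section \<open>The inner product space AP\<close>

typedef ap = "{f. bohr_ap f}" morphisms ap_fun Abs_ap
  using bohr_ap_const by blast

setup_lifting type_definition_ap

instantiation ap :: complex_inner
begin

lift_definition zero_ap :: ap is "\<lambda>_. 0" by (rule bohr_ap_const)
lift_definition plus_ap :: "ap \<Rightarrow> ap \<Rightarrow> ap" is "\<lambda>f g t. f t + g t" by (rule bohr_ap_add)
lift_definition scaleC_ap :: "complex \<Rightarrow> ap \<Rightarrow> ap" is "\<lambda>c f t. c * f t"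
  by (rule bohr_ap_mult[OF bohr_ap_const])
lift_definition uminus_ap :: "ap \<Rightarrow> ap" is "\<lambda>f t. - f t"
  using bohr_ap_mult[OF bohr_ap_const[of "-1"]] by simp
lift_definition minus_ap :: "ap \<Rightarrow> ap \<Rightarrow> ap" is "\<lambda>f g t. f t - g t"
  using bohr_ap_add[OF _ bohr_ap_mult[OF bohr_ap_const[of "-1"]]] by simp
lift_definition scaleR_ap :: "real \<Rightarrow> ap \<Rightarrow> ap" is "\<lambda>r f t. of_real r * f t"
  by (rule bohr_ap_mult[OF bohr_ap_const])
lift_definition cinner_ap :: "ap \<Rightarrow> ap \<Rightarrow> complex" is "\<lambda>f g. ap_mean (\<lambda>t. f t * cnj (g t))" .

definition "inner_ap (f::ap) g = Re (cinner f g)"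
definition "norm_ap (f::ap) = sqrt (inner f f)"
definition "sgn_ap (f::ap) = inverse (norm f) *\<^sub>R f"
definition "dist_ap (f::ap) g = norm (f - g)"
definition uniformity_ap :: "(ap \<times> ap) filter" where
  "uniformity_ap = (INF e\<in>{0 <..}. principal {(f, g). dist f g < e})"
definition open_ap :: "ap set \<Rightarrow> bool" where
  "open_ap U = (\<forall>f\<in>U. \<forall>\<^sub>F (f', g) in uniformity. f' = f \<longrightarrow> g \<in> U)"

instance
proof
  fix f g h :: ap and r s :: real and a b :: complex
  show "f + g + h = f + (g + h)" by transfer (simp add: add.assoc)
  show "f + g = g + f" by transfer (simp add: add.commute)
  show "0 + f = f" by transfer simp
  show "- f + f = 0" by transfer simp
  show "f - g = f + - g" by transfer simp
  show "r *\<^sub>R (f + g) = r *\<^sub>R f + r *\<^sub>R g" by transfer (simp add: algebra_simps)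
  show "(r + s) *\<^sub>R f = r *\<^sub>R f + s *\<^sub>R f" by transfer (simp add: algebra_simps)
  show "r *\<^sub>R s *\<^sub>R f = (r * s) *\<^sub>R f" by transfer (simp add: algebra_simps)
  show "1 *\<^sub>R f = f" by transfer simp
  show "sgn f = inverse (norm f) *\<^sub>R f" by (rule sgn_ap_def)
  show "dist f g = norm (f - g)" by (rule dist_ap_def)
  show "uniformity = (INF e\<in>{0 <..}. principal {(x::ap, y). dist x y < e})" by (rule uniformity_ap_def)
  show "open U = (\<forall>x\<in>U. \<forall>\<^sub>F (x', y) in uniformity. x' = x \<longrightarrow> y \<in> U)" for U :: "ap set"
    by (rule open_ap_def)
  show sc: "r *\<^sub>R f = of_real r *\<^sub>C f" by transfer simp
  show "a *\<^sub>C (f + g) = a *\<^sub>C f + a *\<^sub>C g" by transfer (simp add: algebra_simps)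
  show "(a + b) *\<^sub>C f = a *\<^sub>C f + b *\<^sub>C f" by transfer (simp add: algebra_simps)
  show "a *\<^sub>C b *\<^sub>C f = (a * b) *\<^sub>C f" by transfer (simp add: algebra_simps)
  show cadd: "cinner (f + g) h = cinner f h + cinner g h"
    by transfer (simp add: ring_distribs ap_mean_add bohr_ap_mult bohr_ap_cnj)
  show csc: "cinner (a *\<^sub>C f) g = a * cinner f g" for a
    by transfer (simp add: mult.assoc ap_mean_cmult bohr_ap_mult bohr_ap_cnj)
  show com: "cinner f g = cnj (cinner g f)"
    by transfer (subst ap_mean_cnj[symmetric], auto simp: mult.commute bohr_ap_mult bohr_ap_cnj)
  show "inner f g = Re (cinner f g)" by (rule inner_ap_def)
  show "inner f g = inner g f" unfolding inner_ap_def by (subst com) simp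
  show "inner (f + g) h = inner f h + inner g h" by (simp add: inner_ap_def cadd)
  show "inner (r *\<^sub>R f) g = r * inner f g" by (simp add: inner_ap_def sc csc)
  show "0 \<le> inner f f" unfolding inner_ap_def
    by transfer (use ap_mean_Re_mono[OF bohr_ap_const[of 0]] ap_mean_const[of 0] in
      \<open>force simp: bohr_ap_mult bohr_ap_cnj\<close>)
  show "inner f f = 0 \<longleftrightarrow> f = 0" unfolding inner_ap_def
  proof (transfer, intro iffI ext)
    fix f t assume f: "bohr_ap f" and z: "Re (ap_mean (\<lambda>t. f t * cnj (f t))) = 0"
    have "Re (f t * cnj (f t)) = 0"
      by (rule ap_mean_pos_definite[where f = "\<lambda>t. f t * cnj (f t)"])
         (use f z in \<open>auto simp: bohr_ap_mult bohr_ap_cnj\<close>)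
    then show "f t = 0"
      by (metis Re_complex_of_real complex_norm_square norm_eq_zero power_eq_0_iff)
  qed (simp add: ap_mean_const)
  show "norm f = sqrt (inner f f)" by (rule norm_ap_def)
qed

end

lift_definition ap_exp :: "real \<Rightarrow> ap" is "\<lambda>w t. exp (\<i> * of_real (w * t))"
  by (rule bohr_ap_exp)

section \<open>The Hilbert space completion of a complex inner product space\<close>

lemma cinner_scaleC_right: "cinner x (a *\<^sub>C y) = cnj a * cinner x y"
proof -
  have "cinner x (a *\<^sub>C y) = cnj (cinner (a *\<^sub>C y) x)" by (rule cinner_commute)
  also have "\<dots> = cnj a * cnj (cinner y x)" by (simp add: cinner_scaleC_left)
  also have "cnj (cinner y x) = cinner x y" by (rule cinner_commute[symmetric])
  finally show ?thesis .
qed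

lemma Im_cinner: "Im (cinner x y) = inner x (\<i> *\<^sub>C y)"
  by (simp add: inner_eq_Re_cinner cinner_scaleC_right)

lemma norm_scaleC: "norm (a *\<^sub>C x) = cmod a * norm x" for x :: "'a::complex_inner"
proof -
  have "cinner (a *\<^sub>C x) (a *\<^sub>C x) = (a * cnj a) * cinner x x"
    by (simp add: cinner_scaleC_left cinner_scaleC_right mult.assoc)
  also have "a * cnj a = of_real ((cmod a)\<^sup>2)" by (rule complex_norm_square[symmetric])
  finally have "inner (a *\<^sub>C x) (a *\<^sub>C x) = (cmod a)\<^sup>2 * inner x x"
    by (simp only: inner_eq_Re_cinner Re_complex_of_real) simp
  then show ?thesis by (simp add: norm_eq_sqrt_inner real_sqrt_mult)
qed

lemma scaleC_diff_right: "a *\<^sub>C (x - y) = a *\<^sub>C x - a *\<^sub>C (y :: 'a::complex_inner)"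
  by (metis add_diff_cancel_right' diff_add_cancel scaleC_add_right)

lemma Cauchy_add': "Cauchy X \<Longrightarrow> Cauchy Y \<Longrightarrow> Cauchy (\<lambda>n. X n + Y n :: 'a::real_normed_vector)"
proof (rule metric_CauchyI)
  fix e :: real assume C: "Cauchy X" "Cauchy Y" and "e > 0"
  then have e: "e/2 > 0" by simp
  obtain M where M: "\<forall>m\<ge>M. \<forall>n\<ge>M. dist (X m) (X n) < e/2" using metric_CauchyD[OF C(1) e] by blast
  obtain N where N: "\<forall>m\<ge>N. \<forall>n\<ge>N. dist (Y m) (Y n) < e/2" using metric_CauchyD[OF C(2) e] by blast
  show "\<exists>M. \<forall>m\<ge>M. \<forall>n\<ge>M. dist (X m + Y m) (X n + Y n) < e"
  proof (intro exI[of _ "max M N"] allI impI)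
    fix m n assume "m \<ge> max M N" "n \<ge> max M N"
    then have "dist (X m) (X n) < e/2" "dist (Y m) (Y n) < e/2" using M N by auto
    moreover have "dist (X m + Y m) (X n + Y n) \<le> dist (X m) (X n) + dist (Y m) (Y n)"
      by (rule dist_triangle_add)
    ultimately show "dist (X m + Y m) (X n + Y n) < e" by linarith
  qed
qed

lemma Cauchy_scaleC: assumes "Cauchy X" shows "Cauchy (\<lambda>n. a *\<^sub>C X n :: 'a::complex_inner)"
proof (rule metric_CauchyI)
  fix e :: real assume e: "e > 0"
  then have e': "e / (cmod a + 1) > 0" by (simp add: add_nonneg_pos)
  obtain M where M: "\<forall>m\<ge>M. \<forall>n\<ge>M. dist (X m) (X n) < e / (cmod a + 1)" using metric_CauchyD[OF assms e'] by blast
  have "dist (a *\<^sub>C X m) (a *\<^sub>C X n) < e" if "m \<ge> M" "n \<ge> M" for m n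
  proof -
    have "dist (a *\<^sub>C X m) (a *\<^sub>C X n) = cmod a * dist (X m) (X n)"
      by (simp add: dist_norm scaleC_diff_right[symmetric] norm_scaleC)
    also have "\<dots> \<le> (cmod a + 1) * dist (X m) (X n)" by (intro mult_right_mono) auto
    also have "\<dots> < e" using M that by (simp add: pos_less_divide_eq add_nonneg_pos mult.commute)
    finally show ?thesis .
  qed
  then show "\<exists>M. \<forall>m\<ge>M. \<forall>n\<ge>M. dist (a *\<^sub>C X m) (a *\<^sub>C X n) < e" by blast
qed

lemma convergent_norm_Cauchy: assumes "Cauchy (X :: nat \<Rightarrow> 'a::real_normed_vector)" shows "convergent (\<lambda>n. norm (X n))"
proof -
  have "Cauchy (\<lambda>n. norm (X n))"
  proof (rule metric_CauchyI)
    fix e :: real assume "e > 0"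
    then obtain M where M: "\<forall>m\<ge>M. \<forall>n\<ge>M. dist (X m) (X n) < e" using metric_CauchyD[OF assms] by blast
    have "dist (norm (X m)) (norm (X n)) \<le> dist (X m) (X n)" for m n
      by (simp add: dist_norm norm_triangle_ineq3)
    then show "\<exists>M. \<forall>m\<ge>M. \<forall>n\<ge>M. dist (norm (X m)) (norm (X n)) < e"
      using M by (meson le_less_trans)
  qed
  then show ?thesis by (simp add: Cauchy_convergent_iff)
qed

lemma tendsto_norm_cong:
  assumes "(\<lambda>n. X n - Y n :: 'a::real_normed_vector) \<longlonglongrightarrow> 0" "(\<lambda>n. norm (X n)) \<longlonglongrightarrow> l"
  shows "(\<lambda>n. norm (Y n)) \<longlonglongrightarrow> l"
proof -
  have "(\<lambda>n. norm (Y n) - norm (X n)) \<longlonglongrightarrow> 0"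
  proof (rule Lim_null_comparison[OF always_eventually tendsto_norm_zero[OF assms(1)]], rule allI)
    fix n show "norm (norm (Y n) - norm (X n)) \<le> norm (X n - Y n)"
      using norm_triangle_ineq3[of "Y n" "X n"] by (simp add: norm_minus_commute)
  qed
  from tendsto_add[OF this assms(2)] show ?thesis by simp
qed

text \<open>Cauchy sequences modulo null sequences.\<close>

definition completion_rel :: "(nat \<Rightarrow> 'a::complex_inner) \<Rightarrow> (nat \<Rightarrow> 'a) \<Rightarrow> bool" where
  "completion_rel X Y \<longleftrightarrow> Cauchy X \<and> Cauchy Y \<and> (\<lambda>n. X n - Y n) \<longlonglongrightarrow> 0"

lemma part_equivp_completion_rel: "part_equivp completion_rel"
proof (rule part_equivpI)
  show "\<exists>X. completion_rel X (X :: nat \<Rightarrow> 'a)"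
    by (intro exI[of _ "\<lambda>_. 0"]) (simp add: completion_rel_def Cauchy_def)
  show "symp (completion_rel :: (nat \<Rightarrow> 'a) \<Rightarrow> _)"
  proof (rule sympI)
    fix X Y :: "nat \<Rightarrow> 'a" assume "completion_rel X Y"
    then show "completion_rel Y X"
      using tendsto_minus[of "\<lambda>n. X n - Y n" 0] by (simp add: completion_rel_def)
  qed
  show "transp (completion_rel :: (nat \<Rightarrow> 'a) \<Rightarrow> _)"
  proof (rule transpI)
    fix X Y Z :: "nat \<Rightarrow> 'a" assume "completion_rel X Y" "completion_rel Y Z"
    then show "completion_rel X Z"
      using tendsto_add[of "\<lambda>n. X n - Y n" 0 _ "\<lambda>n. Y n - Z n" 0] by (simp add: completion_rel_def)
  qed
qed

quotient_type (overloaded) 'a completion = "nat \<Rightarrow> 'a::complex_inner" / partial: completion_rel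
  by (rule part_equivp_completion_rel)

lemma convergent_inner_Cauchy:
  assumes "Cauchy X" "Cauchy (Y :: nat \<Rightarrow> 'a::real_inner)"
  shows "convergent (\<lambda>n. inner (X n) (Y n))"
proof -
  have "(\<lambda>n. inner (X n) (Y n)) = (\<lambda>n. ((norm (X n + Y n))\<^sup>2 - (norm (X n))\<^sup>2 - (norm (Y n))\<^sup>2) / 2)"
    by (simp add: dot_norm)
  moreover have "convergent \<dots>"
  proof -
    obtain p q r where "(\<lambda>n. norm (X n)) \<longlonglongrightarrow> p" "(\<lambda>n. norm (Y n)) \<longlonglongrightarrow> q" "(\<lambda>n. norm (X n + Y n)) \<longlonglongrightarrow> r"
      using convergent_norm_Cauchy[OF assms(1)] convergent_norm_Cauchy[OF assms(2)]
        convergent_norm_Cauchy[OF Cauchy_add'[OF assms]] unfolding convergent_def by blast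
    note l = this
    have "(\<lambda>n. ((norm (X n + Y n))\<^sup>2 - (norm (X n))\<^sup>2 - (norm (Y n))\<^sup>2) / 2) \<longlonglongrightarrow> (r\<^sup>2 - p\<^sup>2 - q\<^sup>2) / 2"
      by (intro tendsto_divide tendsto_diff tendsto_power tendsto_const l) simp
    then show ?thesis by (rule convergentI)
  qed
  ultimately show ?thesis by simp
qed

lemma tendsto_inner_cong:
  assumes "completion_rel X X'" "completion_rel Y Y'" "(\<lambda>n. inner (X n) (Y n)) \<longlonglongrightarrow> l"
  shows "(\<lambda>n. inner (X' n) (Y' n)) \<longlonglongrightarrow> l"
proof -
  have c: "Cauchy X" "Cauchy Y" "Cauchy X'" "Cauchy Y'" "(\<lambda>n. X n - X' n) \<longlonglongrightarrow> 0" "(\<lambda>n. Y n - Y' n) \<longlonglongrightarrow> 0"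
    using assms(1,2) by (auto simp: completion_rel_def)
  obtain p q r where l: "(\<lambda>n. norm (X n)) \<longlonglongrightarrow> p" "(\<lambda>n. norm (Y n)) \<longlonglongrightarrow> q" "(\<lambda>n. norm (X n + Y n)) \<longlonglongrightarrow> r"
    using convergent_norm_Cauchy[OF c(1)] convergent_norm_Cauchy[OF c(2)]
      convergent_norm_Cauchy[OF Cauchy_add'[OF c(1,2)]] unfolding convergent_def by blast
  have "(\<lambda>n. (X n + Y n) - (X' n + Y' n)) \<longlonglongrightarrow> 0"
    using tendsto_add[OF c(5,6)] by (simp add: algebra_simps)
  note l' = tendsto_norm_cong[OF c(5) l(1)] tendsto_norm_cong[OF c(6) l(2)] tendsto_norm_cong[OF this l(3)]
  have "(\<lambda>n. inner (X n) (Y n)) \<longlonglongrightarrow> (r\<^sup>2 - p\<^sup>2 - q\<^sup>2) / 2" unfolding dot_norm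
    by (intro tendsto_divide tendsto_diff tendsto_power tendsto_const l) simp
  moreover have "(\<lambda>n. inner (X' n) (Y' n)) \<longlonglongrightarrow> (r\<^sup>2 - p\<^sup>2 - q\<^sup>2) / 2" unfolding dot_norm
    by (intro tendsto_divide tendsto_diff tendsto_power tendsto_const l') simp
  ultimately show ?thesis using assms(3) LIMSEQ_unique by blast
qed

lemma completion_rel_scaleC:
  assumes "completion_rel X Y" shows "completion_rel (\<lambda>n. a *\<^sub>C X n) (\<lambda>n. a *\<^sub>C Y n)"
proof -
  have "(\<lambda>n. norm (X n - Y n)) \<longlonglongrightarrow> 0" using assms tendsto_norm_zero[of "\<lambda>n. X n - Y n"] by (simp add: completion_rel_def)
  from tendsto_mult_right_zero[OF this, of "cmod a"]
  have "(\<lambda>n. norm (a *\<^sub>C X n - a *\<^sub>C Y n)) \<longlonglongrightarrow> 0"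
    by (simp only: scaleC_diff_right[symmetric] norm_scaleC)
  then have "(\<lambda>n. a *\<^sub>C X n - a *\<^sub>C Y n) \<longlonglongrightarrow> 0" by (rule tendsto_norm_zero_cancel)
  then show ?thesis using assms unfolding completion_rel_def by (blast intro: Cauchy_scaleC)
qed

lemma completion_rel_add:
  assumes "completion_rel X Y" "completion_rel X' Y'"
  shows "completion_rel (\<lambda>n. X n + X' n) (\<lambda>n. Y n + Y' n)"
proof -
  have "(\<lambda>n. (X n - Y n) + (X' n - Y' n)) \<longlonglongrightarrow> 0 + 0"
    using assms by (intro tendsto_add) (auto simp: completion_rel_def)
  then have "(\<lambda>n. X n + X' n - (Y n + Y' n)) \<longlonglongrightarrow> 0" by (simp add: algebra_simps)
  then show ?thesis using assms unfolding completion_rel_def by (blast intro: Cauchy_add')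
qed

lemma scaleC_minus1: "(-1) *\<^sub>C x = - (x :: 'a::complex_inner)"
  using scaleR_scaleC[of "-1" x] by simp

lemma completion_rel_uminus: "completion_rel X Y \<Longrightarrow> completion_rel (\<lambda>n. - X n) (\<lambda>n. - Y n)"
  using completion_rel_scaleC[of X Y "-1"] by (simp add: scaleC_minus1)

lemma completion_rel_minus:
  assumes "completion_rel X Y" "completion_rel X' Y'"
  shows "completion_rel (\<lambda>n. X n - X' n) (\<lambda>n. Y n - Y' n)"
  using completion_rel_add[OF assms(1) completion_rel_uminus[OF assms(2)]] by simp

lemma completion_rel_const: "completion_rel (\<lambda>_. x) (\<lambda>_. x)"
  by (simp add: completion_rel_def Cauchy_def)

lemma cinner_Complex: "cinner x y = Complex (inner x y) (inner x (\<i> *\<^sub>C y))"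
  by (simp add: complex_eq_iff Im_cinner inner_eq_Re_cinner[symmetric])

lemma tendsto_cinner_cong:
  assumes "completion_rel X X'" "completion_rel Y Y'" "(\<lambda>n. cinner (X n) (Y n)) \<longlonglongrightarrow> l"
  shows "(\<lambda>n. cinner (X' n) (Y' n)) \<longlonglongrightarrow> l"
proof -
  have "(\<lambda>n. inner (X n) (Y n)) \<longlonglongrightarrow> Re l" "(\<lambda>n. inner (X n) (\<i> *\<^sub>C Y n)) \<longlonglongrightarrow> Im l"
    using tendsto_Re[OF assms(3)] tendsto_Im[OF assms(3)] by (simp_all add: inner_eq_Re_cinner Im_cinner)
  note l = this
  from tendsto_Complex[OF tendsto_inner_cong[OF assms(1,2) l(1)]
      tendsto_inner_cong[OF assms(1) completion_rel_scaleC[OF assms(2)] l(2)]] show ?thesis by (simp only: cinner_Complex[symmetric] complex_surj)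
qed

lemma cinner_LIMSEQ_Cauchy:
  assumes "Cauchy X" "Cauchy Y"
  shows "(\<lambda>n. cinner (X n) (Y n :: 'a::complex_inner)) \<longlonglongrightarrow> lim (\<lambda>n. cinner (X n) (Y n))"
proof -
  obtain a b where "(\<lambda>n. inner (X n) (Y n)) \<longlonglongrightarrow> a" "(\<lambda>n. inner (X n) (\<i> *\<^sub>C Y n)) \<longlonglongrightarrow> b"
    using convergent_inner_Cauchy[OF assms] convergent_inner_Cauchy[OF assms(1) Cauchy_scaleC[OF assms(2)]]
    unfolding convergent_def by blast
  from tendsto_Complex[OF this] have "(\<lambda>n. cinner (X n) (Y n)) \<longlonglongrightarrow> Complex a b"
    by (simp only: cinner_Complex[symmetric])
  with limI[OF this] show ?thesis by simp
qed

lemma lim_cinner_cong: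
  assumes "completion_rel X X'" "completion_rel Y Y'"
  shows "lim (\<lambda>n. cinner (X n) (Y n)) = lim (\<lambda>n. cinner (X' n) (Y' n))"
proof -
  have "Cauchy X" "Cauchy Y" using assms by (auto simp: completion_rel_def)
  from tendsto_cinner_cong[OF assms cinner_LIMSEQ_Cauchy[OF this]] show ?thesis
    by (rule limI[symmetric])
qed

instantiation completion :: (complex_inner) complex_inner
begin

lift_definition zero_completion :: "'a completion" is "\<lambda>_. 0" by (rule completion_rel_const)
lift_definition plus_completion :: "'a completion \<Rightarrow> 'a completion \<Rightarrow> 'a completion"
  is "\<lambda>X Y n. X n + Y n" by (rule completion_rel_add)
lift_definition uminus_completion :: "'a completion \<Rightarrow> 'a completion" is "\<lambda>X n. - X n"
  by (rule completion_rel_uminus)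
lift_definition minus_completion :: "'a completion \<Rightarrow> 'a completion \<Rightarrow> 'a completion"
  is "\<lambda>X Y n. X n - Y n"
  by (rule completion_rel_minus)
lift_definition scaleC_completion :: "complex \<Rightarrow> 'a completion \<Rightarrow> 'a completion"
  is "\<lambda>a X n. a *\<^sub>C X n" by (rule completion_rel_scaleC)
lift_definition cinner_completion :: "'a completion \<Rightarrow> 'a completion \<Rightarrow> complex"
  is "\<lambda>X Y. lim (\<lambda>n. cinner (X n) (Y n))" by (rule lim_cinner_cong)

definition "scaleR_completion r (x :: 'a completion) = complex_of_real r *\<^sub>C x"
definition "inner_completion (x :: 'a completion) y = Re (cinner x y)"
definition "norm_completion (x :: 'a completion) = sqrt (inner x x)"
definition "sgn_completion (x :: 'a completion) = inverse (norm x) *\<^sub>R x"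
definition "dist_completion (x :: 'a completion) y = norm (x - y)"
definition uniformity_completion :: "('a completion \<times> 'a completion) filter" where
  "uniformity_completion = (INF e\<in>{0 <..}. principal {(x, y). dist x y < e})"
definition open_completion :: "'a completion set \<Rightarrow> bool" where
  "open_completion U = (\<forall>x\<in>U. \<forall>\<^sub>F (x', y) in uniformity. x' = x \<longrightarrow> y \<in> U)"

instance
proof
  fix x y z :: "'a completion" and r s :: real and a b :: complex
  have rel: "completion_rel X X \<Longrightarrow> X = Y \<Longrightarrow> completion_rel X Y" for X Y :: "nat \<Rightarrow> 'a" by simp
  show "x + y + z = x + (y + z)"
    by transfer (rule rel, intro completion_rel_add, auto simp: add.assoc)
  show "x + y = y + x"
    by transfer (rule rel, intro completion_rel_add, auto simp: add.commute)
  show "0 + x = x" by transfer simp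
  show "- x + x = 0" by transfer (simp add: completion_rel_const)
  show "x - y = x + - y"
    by transfer (rule rel, auto intro!: completion_rel_minus)
  show c1: "a *\<^sub>C (x + y) = a *\<^sub>C x + a *\<^sub>C y" for a
    by transfer (rule rel, intro completion_rel_scaleC completion_rel_add, auto simp: scaleC_add_right)
  show c2: "(a + b) *\<^sub>C x = a *\<^sub>C x + b *\<^sub>C x" for a b
    by transfer (rule rel, intro completion_rel_scaleC, auto simp: scaleC_add_left)
  show c3: "a *\<^sub>C b *\<^sub>C x = (a * b) *\<^sub>C x" for a b
    by transfer (rule rel, intro completion_rel_scaleC, auto simp: scaleC_scaleC)
  have c4: "1 *\<^sub>C x = x"
    by transfer (simp add: scaleR_scaleC[of 1, simplified, symmetric])
  show sc: "r *\<^sub>R x = of_real r *\<^sub>C x" by (rule scaleR_completion_def)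
  show "r *\<^sub>R (x + y) = r *\<^sub>R x + r *\<^sub>R y" by (simp add: scaleR_completion_def c1)
  show "(r + s) *\<^sub>R x = r *\<^sub>R x + s *\<^sub>R x" by (simp add: scaleR_completion_def c2)
  show "r *\<^sub>R s *\<^sub>R x = (r * s) *\<^sub>R x" by (simp add: scaleR_completion_def c3)
  show "1 *\<^sub>R x = x" by (simp add: scaleR_completion_def c4)
  show "sgn x = inverse (norm x) *\<^sub>R x" by (rule sgn_completion_def)
  show "dist x y = norm (x - y)" by (rule dist_completion_def)
  show "uniformity = (INF e\<in>{0 <..}. principal {(x::'a completion, y). dist x y < e})"
    by (rule uniformity_completion_def)
  show "open U = (\<forall>x\<in>U. \<forall>\<^sub>F (x', y) in uniformity. x' = x \<longrightarrow> y \<in> U)" for U :: "'a completion set"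
    by (rule open_completion_def)
  show cadd: "cinner (x + y) z = cinner x z + cinner y z"
  proof transfer
    fix X Y Z :: "nat \<Rightarrow> 'a" assume "completion_rel X X" "completion_rel Y Y" "completion_rel Z Z"
    then have "(\<lambda>n. cinner (X n) (Z n) + cinner (Y n) (Z n)) \<longlonglongrightarrow> lim (\<lambda>n. cinner (X n) (Z n)) + lim (\<lambda>n. cinner (Y n) (Z n))"
      by (intro tendsto_add cinner_LIMSEQ_Cauchy) (auto simp: completion_rel_def)
    then show "lim (\<lambda>n. cinner (X n + Y n) (Z n)) = lim (\<lambda>n. cinner (X n) (Z n)) + lim (\<lambda>n. cinner (Y n) (Z n))"
      by (intro limI) (simp add: cinner_add_left)
  qed
  show csc: "cinner (a *\<^sub>C x) y = a * cinner x y" for a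
  proof (transfer fixing: a)
    fix X Y :: "nat \<Rightarrow> 'a" assume "completion_rel X X" "completion_rel Y Y"
    then have "(\<lambda>n. a * cinner (X n) (Y n)) \<longlonglongrightarrow> a * lim (\<lambda>n. cinner (X n) (Y n))"
      by (intro tendsto_mult_left cinner_LIMSEQ_Cauchy) (auto simp: completion_rel_def)
    then show "lim (\<lambda>n. cinner (a *\<^sub>C X n) (Y n)) = a * lim (\<lambda>n. cinner (X n) (Y n))"
      by (intro limI) (simp add: cinner_scaleC_left)
  qed
  show com: "cinner x y = cnj (cinner y x)"
  proof transfer
    fix X Y :: "nat \<Rightarrow> 'a" assume "completion_rel X X" "completion_rel Y Y"
    then have "(\<lambda>n. cnj (cinner (Y n) (X n))) \<longlonglongrightarrow> cnj (lim (\<lambda>n. cinner (Y n) (X n)))"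
      by (intro tendsto_cnj cinner_LIMSEQ_Cauchy) (auto simp: completion_rel_def)
    then show "lim (\<lambda>n. cinner (X n) (Y n)) = cnj (lim (\<lambda>n. cinner (Y n) (X n)))"
      by (intro limI) (simp only: cinner_commute[symmetric])
  qed
  show "inner x y = Re (cinner x y)" by (rule inner_completion_def)
  show "inner x y = inner y x" unfolding inner_completion_def by (subst com) simp
  show "inner (x + y) z = inner x z + inner y z" by (simp add: inner_completion_def cadd)
  show "inner (r *\<^sub>R x) y = r * inner x y" by (simp add: inner_completion_def sc csc)
  have nn: "(\<lambda>n. (norm (X n))\<^sup>2) \<longlonglongrightarrow> Re (lim (\<lambda>n. cinner (X n) (X n)))"
    if "completion_rel X X" for X :: "nat \<Rightarrow> 'a"
    using tendsto_Re[OF cinner_LIMSEQ_Cauchy[of X X]] that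
    by (simp add: completion_rel_def inner_eq_Re_cinner[symmetric] power2_norm_eq_inner)
  show "0 \<le> inner x x" unfolding inner_completion_def
    by transfer (rule LIMSEQ_le_const[OF nn], auto)
  show "inner x x = 0 \<longleftrightarrow> x = 0" unfolding inner_completion_def
  proof transfer
    fix X :: "nat \<Rightarrow> 'a" assume X: "completion_rel X X"
    show "(Re (lim (\<lambda>n. cinner (X n) (X n))) = 0) = completion_rel X (\<lambda>_. 0)"
    proof
      assume "Re (lim (\<lambda>n. cinner (X n) (X n))) = 0"
      then have "(\<lambda>n. sqrt ((norm (X n))\<^sup>2)) \<longlonglongrightarrow> sqrt 0" using nn[OF X] by (intro tendsto_real_sqrt) simp
      then have "X \<longlonglongrightarrow> 0" by (simp add: tendsto_norm_zero_iff)
      then show "completion_rel X (\<lambda>_. 0)" using X by (simp add: completion_rel_def Cauchy_def)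
    next
      assume "completion_rel X (\<lambda>_. 0)"
      then have "X \<longlonglongrightarrow> 0" by (simp add: completion_rel_def)
      from tendsto_power[OF tendsto_norm_zero[OF this], of 2] LIMSEQ_unique[OF nn[OF X]]
      show "Re (lim (\<lambda>n. cinner (X n) (X n))) = 0" by simp
    qed
  qed
  show "norm x = sqrt (inner x x)" by (rule norm_completion_def)
qed

end

lift_definition to_completion :: "'a::complex_inner \<Rightarrow> 'a completion" is "\<lambda>x _. x"
  by (rule completion_rel_const)

lemma to_completion_diff: "to_completion x - to_completion y = to_completion (x - y)"
  by transfer (rule completion_rel_const)

lemma to_completion_add: "to_completion (x + y) = to_completion x + to_completion y"
  by transfer (rule completion_rel_const)

lemma to_completion_scaleC: "to_completion (a *\<^sub>C x) = a *\<^sub>C to_completion x"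
  by transfer (rule completion_rel_const)

lemma cinner_to_completion: "cinner (to_completion x) (to_completion y) = cinner x y"
  by transfer (rule limI[OF tendsto_const])

lemma completion_norm_LIMSEQ:
  assumes "Cauchy X"
  shows "(\<lambda>n. norm (X n)) \<longlonglongrightarrow> norm (abs_completion X)"
proof -
  have X: "completion_rel X X" using assms by (simp add: completion_rel_def)
  have c: "cinner (abs_completion X) (abs_completion X) = lim (\<lambda>n. cinner (X n) (X n))"
    by (rule cinner_completion.abs_eq[OF X X])
  have "(\<lambda>n. sqrt (Re (cinner (X n) (X n)))) \<longlonglongrightarrow> sqrt (Re (lim (\<lambda>n. cinner (X n) (X n))))"
    by (intro tendsto_real_sqrt tendsto_Re cinner_LIMSEQ_Cauchy assms)
  then show ?thesis by (simp add: norm_eq_sqrt_inner inner_eq_Re_cinner c)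
qed

lemma norm_to_completion: "norm (to_completion x) = norm x"
proof -
  have "Cauchy (\<lambda>_::nat. x)" by (simp add: Cauchy_def)
  from completion_norm_LIMSEQ[OF this] have "(\<lambda>_::nat. norm x) \<longlonglongrightarrow> norm (to_completion x)"
    by (simp only: to_completion.abs_eq)
  then show ?thesis by (simp add: LIMSEQ_const_iff)
qed

lemma dist_to_completion_lim:
  assumes "Cauchy X" shows "(\<lambda>n. dist (X n) a) \<longlonglongrightarrow> dist (abs_completion X) (to_completion a)"
proof -
  have X: "completion_rel X X" using assms by (simp add: completion_rel_def)
  have "Cauchy (\<lambda>_::nat. - a)" by (simp add: Cauchy_def)
  from Cauchy_add'[OF assms this] have C: "Cauchy (\<lambda>n. X n - a)" by simp
  have "abs_completion X - to_completion a = abs_completion (\<lambda>n. X n - a)"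
    unfolding to_completion.abs_eq by (rule minus_completion.abs_eq[OF X completion_rel_const])
  then show ?thesis using completion_norm_LIMSEQ[OF C] by (simp only: dist_norm)
qed

lemma to_completion_tendsto:
  assumes "Cauchy X" shows "(\<lambda>n. to_completion (X n)) \<longlonglongrightarrow> abs_completion X"
proof (rule metric_LIMSEQ_I)
  fix e :: real assume "e > 0"
  then have e: "e/2 > 0" by simp
  obtain N where N: "\<forall>m\<ge>N. \<forall>n\<ge>N. dist (X m) (X n) < e/2" using metric_CauchyD[OF assms e] by blast
  have "dist (to_completion (X n)) (abs_completion X) < e" if "n \<ge> N" for n
  proof -
    have "dist (abs_completion X) (to_completion (X n)) \<le> e/2"
      by (rule LIMSEQ_le_const2[OF dist_to_completion_lim[OF assms]])
         (use N that in \<open>auto intro!: exI[of _ N] less_imp_le\<close>)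
    then show ?thesis using e by (simp add: dist_commute)
  qed
  then show "\<exists>N. \<forall>n\<ge>N. dist (to_completion (X n)) (abs_completion X) < e" by blast
qed

lemma completion_cases:
  obtains X where "Cauchy X" "x = abs_completion X"
proof -
  have "completion_rel (rep_completion x) (rep_completion x)" "x = abs_completion (rep_completion x)"
    by (rule Quotient3_rep_reflp[OF Quotient3_completion], rule Quotient3_abs_rep[OF Quotient3_completion, symmetric])
  then show ?thesis using that by (simp add: completion_rel_def)
qed

lemma closure_to_completion: "closure (range to_completion) = UNIV"
proof -
  have "x \<in> closure (range to_completion)" for x :: "'a completion"
  proof -
    obtain X where X: "Cauchy X" "x = abs_completion X" by (rule completion_cases)
    show ?thesis unfolding closure_sequential X(2)
      by (intro exI[of _ "\<lambda>n. to_completion (X n)"] conjI allI to_completion_tendsto X(1)) simp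
  qed
  then show ?thesis by blast
qed

instance completion :: (complex_inner) complete_space
proof
  fix x :: "nat \<Rightarrow> 'a completion" assume x: "Cauchy x"
  have "\<exists>a. dist (to_completion a) (x n) < 1 / real (Suc n)" for n
  proof -
    have "x n \<in> closure (range to_completion)" by (simp add: closure_to_completion)
    then have "\<exists>y\<in>range to_completion. dist y (x n) < 1 / real (Suc n)"
      unfolding closure_approachable by simp
    then show ?thesis by blast
  qed
  then obtain a where a: "\<And>n. dist (to_completion (a n)) (x n) < 1 / real (Suc n)" by metis
  have "(\<lambda>n. to_completion (a n) - x n) \<longlonglongrightarrow> 0"
  proof (rule Lim_null_comparison)
    show "\<forall>\<^sub>F n in sequentially. norm (to_completion (a n) - x n) \<le> 1 / real (Suc n)"
      using a by (intro always_eventually allI less_imp_le) (simp add: dist_norm)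
    show "(\<lambda>n. 1 / real (Suc n)) \<longlonglongrightarrow> 0" using LIMSEQ_inverse_real_of_nat by (simp add: divide_inverse)
  qed
  note lim0 = this
  then have "Cauchy (\<lambda>n. to_completion (a n) - x n)" by (rule LIMSEQ_imp_Cauchy)
  from Cauchy_add'[OF this x] have "Cauchy (\<lambda>n. to_completion (a n))" by simp
  then have "Cauchy a"
    unfolding Cauchy_def by (simp add: dist_norm to_completion_diff norm_to_completion)
  from tendsto_diff[OF to_completion_tendsto[OF this] lim0]
  show "convergent x" by (auto simp: convergent_def)
qed

section \<open>The space AP_2\<close>

type_synonym ap2 = "ap completion"

definition fourier_coeff :: "ap2 \<Rightarrow> real \<Rightarrow> complex" where
  "fourier_coeff f \<mu> = cinner f (to_completion (ap_exp \<mu>))"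

definition ap2_spectrum :: "ap2 \<Rightarrow> real set" where
  "ap2_spectrum f = {\<mu>. fourier_coeff f \<mu> \<noteq> 0}"

definition AP2_on :: "real set \<Rightarrow> ap2 set" where
  "AP2_on M = {f. ap2_spectrum f \<subseteq> M}"

section \<open>Subspaces, projections and frames\<close>

definition complex_subspace :: "'a::complex_inner set \<Rightarrow> bool" where
  "complex_subspace V \<longleftrightarrow> 0 \<in> V \<and> (\<forall>x\<in>V. \<forall>y\<in>V. x + y \<in> V) \<and> (\<forall>a. \<forall>x\<in>V. a *\<^sub>C x \<in> V)"

text \<open>Hilbert spaces that occur as subsets of an ambient inner product space.\<close>

definition separable_hilbert_space :: "'a::complex_inner set \<Rightarrow> bool" where
  "separable_hilbert_space V \<longleftrightarrow>
     complex_subspace V \<and> complete V \<and> separable_space (top_of_set V)"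

definition orth_proj :: "'a::complex_inner set \<Rightarrow> 'a \<Rightarrow> 'a" where
  "orth_proj V f = (THE g. g \<in> V \<and> (\<forall>v\<in>V. cinner (f - g) v = 0))"

text \<open>
  The inner product is a parameter, so that the definition also covers \<open>L\<^sup>2\<close>, whose elements are
  represented by functions; \<open>Re (ip f f)\<close> is the square of the norm of \<open>f\<close>.
\<close>

definition hilbert_frame ::
  "'v set \<Rightarrow> ('v \<Rightarrow> 'v \<Rightarrow> complex) \<Rightarrow> 'i set \<Rightarrow> ('i \<Rightarrow> 'v) \<Rightarrow> bool" where
  "hilbert_frame V ip I g \<longleftrightarrow>
     (\<forall>i\<in>I. g i \<in> V) \<and>
     (\<exists>A>0. \<exists>B>0. \<forall>f\<in>V.
        (\<lambda>i. (cmod (ip f (g i)))\<^sup>2) summable_on I \<and>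
        A * Re (ip f f) \<le> (\<Sum>\<^sub>\<infinity>i\<in>I. (cmod (ip f (g i)))\<^sup>2) \<and>
        (\<Sum>\<^sub>\<infinity>i\<in>I. (cmod (ip f (g i)))\<^sup>2) \<le> B * Re (ip f f))"

section \<open>Functions on the real line\<close>

definition L2_space :: "(real \<Rightarrow> complex) set" where
  "L2_space = {f \<in> borel_measurable lebesgue. integrable lebesgue (\<lambda>t. (cmod (f t))\<^sup>2)}"

definition L2_inner :: "(real \<Rightarrow> complex) \<Rightarrow> (real \<Rightarrow> complex) \<Rightarrow> complex" where
  "L2_inner f g = (LINT t|lebesgue. f t * cnj (g t))"

definition Linf_space :: "(real \<Rightarrow> complex) set" where
  "Linf_space = {f \<in> borel_measurable lebesgue. esssup lebesgue (\<lambda>t. ereal (cmod (f t))) < \<infinity>}"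

definition wiener_norm :: "(real \<Rightarrow> complex) \<Rightarrow> ennreal" where
  "wiener_norm f = (\<Sum>\<^sub>\<infinity>k\<in>(UNIV :: int set).
     e2ennreal (esssup (restrict_space lebesgue {0..1}) (\<lambda>x. ereal (cmod (f (x - of_int k))))))"

definition wiener_space :: "(real \<Rightarrow> complex) set" where
  "wiener_space = {f \<in> Linf_space. wiener_norm f < \<infinity>}"

definition fourier_transform :: "(real \<Rightarrow> complex) \<Rightarrow> real \<Rightarrow> complex" where
  "fourier_transform f w = (LINT t|lebesgue. f t * exp (- (\<i> * of_real (w * t))))"

definition translation :: "real \<Rightarrow> (real \<Rightarrow> complex) \<Rightarrow> real \<Rightarrow> complex" where
  "translation x f = (\<lambda>t. f (t - x))"

definition modulation :: "real \<Rightarrow> (real \<Rightarrow> complex) \<Rightarrow> real \<Rightarrow> complex" where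
  "modulation w f = (\<lambda>t. exp (\<i> * of_real (w * t)) * f t)"

definition gabor_frame :: "(real \<Rightarrow> complex) \<Rightarrow> real \<Rightarrow> real \<Rightarrow> bool" where
  "gabor_frame \<psi> \<alpha> \<beta> \<longleftrightarrow>
     hilbert_frame L2_space L2_inner (UNIV :: (int \<times> int) set)
       (\<lambda>(k, l). translation (\<alpha> * of_int k) (modulation (\<beta> * of_int l) \<psi>))"

text \<open>
  The element \<open>h\<close> is unique because the functions \<open>ap_exp \<mu>\<close> form an orthonormal basis of \<open>ap2\<close>.
\<close>

definition ap2_gabor :: "(real \<Rightarrow> complex) \<Rightarrow> real \<Rightarrow> real \<Rightarrow> real \<times> int \<Rightarrow> ap2" where
  "ap2_gabor \<psi> \<alpha> \<beta> = (\<lambda>(w, l). THE h. \<forall>\<mu>. fourier_coeff h \<mu> =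
     (if \<exists>p::int. \<mu> = w + 2 * pi / \<alpha> * of_int p
      then fourier_transform \<psi> (\<mu> - \<beta> * of_int l) else 0))"

end

theory Submission
  imports Defs "HOL-Probability.Characteristic_Functions"
begin

text \<open>
  Proof idea. The fiber at \<open>w\<close> is tested with \<open>f t = (\<Sum>\<mu>\<in>G. c \<mu> * cis (\<mu> * t)) * W (\<epsilon> * t)\<close>,
  where \<open>G\<close> is a finite subset of \<open>w + (2 * pi / \<alpha>) * \<int>\<close> and \<open>W\<close> is the Fourier transform of an
  indicator function. Since the trigonometric factor is \<open>\<alpha>\<close>-periodic up to a phase, as \<open>\<epsilon> \<rightarrow> 0\<close>
  the Gabor coefficients of \<open>f\<close> factor into samples of \<open>W\<close> and the fiber coefficients
  \<open>\<Sum>\<mu>\<in>G. c \<mu> * cnj (fourier_transform \<psi> (\<mu> - \<beta> * l))\<close>, up to an error that is negligible by Bessel's inequality;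
  the Wiener condition makes this uniform in \<open>l\<close>. So the frame inequality in \<open>L\<^sup>2\<close> passes to every
  fiber, with constants that do not depend on \<open>w\<close>. Summing over the fibers gives the frame inequality
  for trigonometric polynomials in \<open>AP\<^sub>2\<close>, hence for all of \<open>AP\<^sub>2\<close> by density.

  The density is Bohr's theorem. If all Fourier coefficients of \<open>u\<close> vanish, approximate \<open>u\<close> by almost
  periodic \<open>f\<close>: the means of \<open>f\<close> against exponentials over long intervals are small, uniformly in the
  frequency. These means control the Fourier transform of the truncated autocorrelation of \<open>f\<close>, which is
  nonnegative, so its \<open>L\<^sup>2\<close> norm is small. In the limit the autocorrelation of \<open>u\<close>, an almost
  periodic function with value the squared norm of \<open>u\<close> at \<open>0\<close>, has mean square \<open>0\<close>.
\<close>

section \<open>Periodization and Bessel's inequality\<close>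

text \<open>Exponentials are not square integrable, so a fiber cannot be tested directly; the window
  makes the test function admissible, at the price of a squared norm that grows like 1 / \<epsilon>.
  All estimates are therefore relative to Q = 2 * pi / (\<epsilon> * \<alpha>). The window samples
  along a translate of \<alpha> * \<int> have energy at most Q by Bessel's inequality on [0,1], and
  at least Q / (32 * pi) by those near 0; this ratio is the origin of the factors 32 * pi in the
  fiber bounds. The two hypotheses on \<psi> require two error estimates. If \<psi> is in the Wiener
  space, Bessel's inequality in the time variable sums over l. If its transform is, Fubini moves the
  error to the variable y of the window integral, where Bessel's inequality sums over k. The index
  set of the frame in \<open>ap2\<close> is uncountable, but a trigonometric polynomial meets only
  finitely many fibers. Bohr's theorem serves twice: for density, and for the uniqueness behind the
  definition of \<open>ap2_gabor\<close>. An element of the completion is no function; its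
  autocorrelation, obtained as a uniform limit, replaces it.\<close>

lemma nn_integral_periodization:
  fixes f :: "real \<Rightarrow> ennreal"
  assumes [measurable]: "f \<in> borel_measurable borel" and P: "P > 0"
  shows "(\<integral>\<^sup>+x. f x \<partial>lborel) =
    (\<integral>\<^sup>+x. (\<Sum>n. f (x + P * of_int (int_decode n))) * indicator {0..<P} x \<partial>lborel)"
proof -
  \<comment> \<open>The integers are enumerated by \<open>int_decode\<close>, so that the sum over
    periods becomes an \<open>ennreal\<close> series and can be exchanged with the integral.\<close>
  define I where "I n = {P * of_int (int_decode n)..<P * of_int (int_decode n) + P}" for n
  have I: "x \<in> I n \<longleftrightarrow> int_decode n = \<lfloor>x / P\<rfloor>" for x n
    using P unfolding I_def
    by (simp add: eq_commute[of "int_decode n"] floor_eq_iff pos_le_divide_eq pos_divide_less_eq algebra_simps)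
  have Im[measurable]: "I n \<in> sets borel" for n by (simp add: I_def)
  have d: "disjoint_family I"
    unfolding disjoint_family_on_def
  proof (intro ballI impI)
    fix m n :: nat assume "m \<noteq> n"
    then have "int_decode m \<noteq> int_decode n" using injD[OF inj_int_decode] by blast
    then show "I m \<inter> I n = {}" using I by force
  qed
  have "f x = (\<Sum>n. f x * indicator (I n) x)" for x
  proof -
    have "x \<in> I (int_encode \<lfloor>x / P\<rfloor>)" by (simp add: I)
    from suminf_cmult_indicator[OF d this, of "\<lambda>_. f x"] show ?thesis by simp
  qed
  then have "(\<integral>\<^sup>+x. f x \<partial>lborel) = (\<integral>\<^sup>+x. (\<Sum>n. f x * indicator (I n) x) \<partial>lborel)" by simp
  also have "\<dots> = (\<Sum>n. \<integral>\<^sup>+x. f x * indicator (I n) x \<partial>lborel)"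
    by (rule nn_integral_suminf) simp
  also have "(\<lambda>n. \<integral>\<^sup>+x. f x * indicator (I n) x \<partial>lborel) =
      (\<lambda>n. \<integral>\<^sup>+x. f (x + P * of_int (int_decode n)) * indicator {0..<P} x \<partial>lborel)"
    by (rule ext, subst nn_integral_real_affine[of _ 1 "P * of_int (int_decode n)"])
       (auto intro!: nn_integral_cong simp: I_def indicator_def add.commute)
  also have "(\<Sum>n. \<integral>\<^sup>+x. f (x + P * of_int (int_decode n)) * indicator {0..<P} x \<partial>lborel) =
      (\<integral>\<^sup>+x. (\<Sum>n. f (x + P * of_int (int_decode n)) * indicator {0..<P} x) \<partial>lborel)"
    by (rule nn_integral_suminf[symmetric]) simp
  finally show ?thesis by simp
qed

lemma norm_square_sum:
  fixes z :: "'i \<Rightarrow> complex"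
  shows "of_real ((cmod (\<Sum>i\<in>G. z i))\<^sup>2) = (\<Sum>i\<in>G. \<Sum>j\<in>G. z i * cnj (z j))"
  by (simp only: complex_norm_square cnj_sum sum_product)

lemma has_bochner_integral_cis_period:
  assumes P: "P > 0"
  shows "has_bochner_integral lborel (\<lambda>s. indicator {0..<P} s *\<^sub>R cis (2 * pi / P * of_int p * s))
    (if p = 0 then of_real P else 0)"
proof -
  have 1: "has_bochner_integral lborel (\<lambda>s. indicator {0..P} s *\<^sub>R cis (2 * pi / P * of_int p * s))
    (if p = 0 then of_real P else 0)"
  proof (cases "p = 0")
    case True
    then show ?thesis
      using has_bochner_integral_real_indicator[of "{0..P}" lborel] P
      by (simp add: has_bochner_integral_of_real[where 'a=complex, of lborel "indicator {0..P}" P] scaleR_conv_of_real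
          flip: of_real_mult)
  next
    case False
    define k where "k = 2 * pi / P * of_int p"
    have k: "k \<noteq> 0" using False P by (simp add: k_def)
    have "has_bochner_integral lborel (\<lambda>s. indicator {0..P} s *\<^sub>R cis (k * s))
      (cis (k * P) / (\<i> * of_real k) - cis (k * 0) / (\<i> * of_real k))"
    proof (rule has_bochner_integral_FTC_Icc)
      fix x show "((\<lambda>x. cis (k * x) / (\<i> * of_real k)) has_vector_derivative cis (k * x)) (at x within {0..P})"
        unfolding cis_conv_exp of_real_mult
        by (rule has_vector_derivative_real_field[where f="\<lambda>z. exp (\<i> * (of_real k * z)) / (\<i> * of_real k)"])
           ((rule derivative_eq_intros refl | use k in \<open>simp add: field_simps\<close>)+)
    qed (use P in \<open>auto intro!: continuous_intros simp: cis_conv_exp\<close>)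
    moreover have "cis (k * P) = 1" using P cis_multiple_2pi[of "of_int p"] by (simp add: k_def)
    ultimately show ?thesis using False by (simp add: k_def)
  qed
  \<comment> \<open>The fundamental theorem needs the closed interval, the tiling of the line by
    periods the half-open one; they differ by a null set.\<close>
  have "AE s in lborel. indicator {0..P} s *\<^sub>R cis (2 * pi / P * of_int p * s) = indicator {0..<P} s *\<^sub>R cis (2 * pi / P * of_int p * s)"
    using AE_lborel_singleton[of P] by eventually_elim (auto simp: indicator_def)
  then show ?thesis using 1 by (subst has_bochner_integral_cong_AE) (auto elim: eventually_mono simp: cis_conv_exp)
qed

text \<open>Parseval's identity over one period. A common offset of the frequencies cancels in each
  product of a term with a conjugate, so only differences have to lie in the lattice; the
  frequencies of a fiber have such an offset.\<close>

lemma trig_poly_norm_period: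
  fixes c :: "'i \<Rightarrow> complex" and \<omega> :: "'i \<Rightarrow> real"
  assumes P: "P > 0" and G: "finite G"
    and \<omega>: "\<And>i j. i \<in> G \<Longrightarrow> j \<in> G \<Longrightarrow> i \<noteq> j \<Longrightarrow> \<exists>p::int. p \<noteq> 0 \<and> \<omega> i - \<omega> j = 2 * pi / P * of_int p"
  shows "(\<integral>\<^sup>+s. ennreal ((cmod (\<Sum>i\<in>G. c i * cis (\<omega> i * s)))\<^sup>2) * indicator {0..<P} s \<partial>lborel) = ennreal (P * (\<Sum>i\<in>G. (cmod (c i))\<^sup>2))"
proof -
  have h: "has_bochner_integral lborel (\<lambda>s. indicator {0..<P} s *\<^sub>R (c i * cis (\<omega> i * s) * cnj (c j * cis (\<omega> j * s))))
     (if i = j then of_real (P * (cmod (c i))\<^sup>2) else 0)" if ij: "i \<in> G" "j \<in> G" for i j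
  proof -
    obtain p :: int where p: "(p = 0) = (i = j)" "\<omega> i - \<omega> j = 2 * pi / P * of_int p"
    proof (cases "i = j")
      case True then show ?thesis using that[of 0] by simp
    next
      case False then show ?thesis using \<omega>[OF ij] that by metis
    qed
    have *: "(indicator {0..<P} s *\<^sub>R cis (2 * pi / P * of_int p * s)) * (c i * cnj (c j)) =
        indicator {0..<P} s *\<^sub>R (c i * cis (\<omega> i * s) * cnj (c j * cis (\<omega> j * s)))" for s
    proof -
      have "cis (2 * pi / P * of_int p * s) = cis (\<omega> i * s) * cis (- (\<omega> j * s))"
        unfolding p(2)[symmetric] by (simp add: cis_mult algebra_simps)
      then show ?thesis by (simp add: cis_cnj mult_ac)
    qed
    show ?thesis
      using has_bochner_integral_mult_left[OF has_bochner_integral_cis_period[OF P, of p], of "c i * cnj (c j)"] p(1)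
      unfolding * by (cases "i = j") (simp_all only: complex_norm_square of_real_mult if_True if_False refl mult_zero_left)
  qed
  have "has_bochner_integral lborel (\<lambda>s. \<Sum>i\<in>G. \<Sum>j\<in>G. indicator {0..<P} s *\<^sub>R (c i * cis (\<omega> i * s) * cnj (c j * cis (\<omega> j * s))))
    (\<Sum>i\<in>G. \<Sum>j\<in>G. if i = j then of_real (P * (cmod (c i))\<^sup>2) else 0)"
    by (intro has_bochner_integral_sum h)
  also have "(\<lambda>s. \<Sum>i\<in>G. \<Sum>j\<in>G. indicator {0..<P} s *\<^sub>R (c i * cis (\<omega> i * s) * cnj (c j * cis (\<omega> j * s)))) =
    (\<lambda>s. of_real ((cmod (\<Sum>i\<in>G. c i * cis (\<omega> i * s)))\<^sup>2 * indicator {0..<P} s))"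
    unfolding of_real_mult norm_square_sum by (auto simp: indicator_def)
  also have "(\<Sum>i\<in>G. \<Sum>j\<in>G. if i = j then of_real (P * (cmod (c i))\<^sup>2) else 0) = complex_of_real (P * (\<Sum>i\<in>G. (cmod (c i))\<^sup>2))"
    using G by (simp add: sum.delta' sum_distrib_left)
  finally have "has_bochner_integral lborel (\<lambda>s. (cmod (\<Sum>i\<in>G. c i * cis (\<omega> i * s)))\<^sup>2 * indicator {0..<P} s) (P * (\<Sum>i\<in>G. (cmod (c i))\<^sup>2))"
    using has_bochner_integral_Re by fastforce
  then have "(\<integral>\<^sup>+s. ennreal ((cmod (\<Sum>i\<in>G. c i * cis (\<omega> i * s)))\<^sup>2 * indicator {0..<P} s) \<partial>lborel) = ennreal (P * (\<Sum>i\<in>G. (cmod (c i))\<^sup>2))"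
    unfolding has_bochner_integral_iff by (subst nn_integral_eq_integral) auto
  then show ?thesis by (simp add: ennreal_mult' ennreal_indicator)
qed

lemma ennreal_suminf_le:
  fixes f :: "nat \<Rightarrow> ennreal"
  assumes "\<And>n. sum f {..<n} \<le> C" shows "(\<Sum>n. f n) \<le> C"
  unfolding suminf_eq_SUP by (intro SUP_least assms)

lemma suminf_int_decode_le:
  assumes "\<And>F :: int set. finite F \<Longrightarrow> (\<Sum>n\<in>F. u n) \<le> C" "\<And>n. u n \<ge> 0"
  shows "(\<Sum>n. ennreal (u (int_decode n))) \<le> ennreal C"
proof (rule ennreal_suminf_le)
  fix n
  have "(\<Sum>i<n. u (int_decode i)) = (\<Sum>j\<in>int_decode ` {..<n}. u j)"
    by (rule sum.reindex[symmetric, unfolded o_def]) (auto intro: inj_on_subset[OF inj_int_decode])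
  also have "\<dots> \<le> C" by (intro assms) auto
  finally show "(\<Sum>i<n. ennreal (u (int_decode i))) \<le> ennreal C"
    using assms(2) by (subst sum_ennreal) (auto intro: ennreal_leI)
qed

lemma AE_periodization_le:
  fixes u :: "real \<Rightarrow> real"
  assumes u0: "\<And>s. u s \<ge> 0"
    and C: "AE s in lborel. \<forall>F::int set. finite F \<longrightarrow> (\<Sum>n\<in>F. u (s + P * of_int n)) \<le> C"
  shows "AE s in lborel. (\<Sum>n. ennreal (u (s + P * of_int (int_decode n)))) \<le> ennreal C"
  using C
proof (rule AE_mp, intro AE_I2 impI)
  fix s assume "\<forall>F::int set. finite F \<longrightarrow> (\<Sum>n\<in>F. u (s + P * of_int n)) \<le> C"
  then show "(\<Sum>n. ennreal (u (s + P * of_int (int_decode n)))) \<le> ennreal C"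
    by (intro suminf_int_decode_le) (auto simp: u0)
qed

text \<open>The integral over the line equals the integral of the periodization over one period,
  hence is at most C * P.\<close>

lemma integrable_of_periodization_bounded:
  fixes u :: "real \<Rightarrow> real"
  assumes [measurable]: "u \<in> borel_measurable borel" and P: "P > 0" and u0: "\<And>s. u s \<ge> 0"
    and C: "AE s in lborel. \<forall>F::int set. finite F \<longrightarrow> (\<Sum>n\<in>F. u (s + P * of_int n)) \<le> C"
  shows "integrable lborel u"
proof (rule integrableI_nonneg)
  have "(\<integral>\<^sup>+s. ennreal (u s) \<partial>lborel) = (\<integral>\<^sup>+s. (\<Sum>n. ennreal (u (s + P * of_int (int_decode n)))) * indicator {0..<P} s \<partial>lborel)"
    by (rule nn_integral_periodization) (auto simp: P)
  also have "\<dots> \<le> (\<integral>\<^sup>+s. ennreal C * indicator {0..<P} s \<partial>lborel)"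
    by (rule nn_integral_mono_AE, rule AE_mp[OF AE_periodization_le[OF u0 C]], intro AE_I2 impI mult_right_mono) simp_all
  also have "\<dots> < \<infinity>" using P by (subst nn_integral_cmult) (auto simp: ennreal_mult_less_top)
  finally show "(\<integral>\<^sup>+s. ennreal (u s) \<partial>lborel) < \<infinity>" .
qed (auto simp: u0)

text \<open>P-periodic exponentials see only the periodization of the weight \<open>u\<close>. A
  bound C on it turns Parseval over one period into a norm bound for trigonometric polynomials in
  the weighted L^2 space, and duality yields Bessel's inequality with constant P * C, although the
  exponentials need not be orthogonal there.\<close>

lemma bessel_periodized:
  fixes u :: "real \<Rightarrow> real" and D :: "real \<Rightarrow> complex"
  assumes [measurable]: "u \<in> borel_measurable borel" "D \<in> borel_measurable borel"
    and P: "P > 0" and F: "finite F" and u0: "\<And>s. u s \<ge> 0" and C0: "C > 0"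
    and C: "AE s in lborel. \<forall>F::int set. finite F \<longrightarrow> (\<Sum>n\<in>F. u (s + P * of_int n)) \<le> C"
    and D: "integrable lborel (\<lambda>s. u s * (cmod (D s))\<^sup>2)"
  shows "(\<Sum>l\<in>F. (cmod (LINT s|lborel. of_real (u s) * D s * cis (2 * pi / P * of_int l * s)))\<^sup>2)
    \<le> P * C * (LINT s|lborel. u s * (cmod (D s))\<^sup>2)"
proof -
  have period: "cis (2 * pi / P * of_int l * (s + P * of_int n)) = cis (2 * pi / P * of_int l * s)" for l n :: int and s
  proof -
    have "2 * pi / P * of_int l * (s + P * of_int n) = 2 * pi / P * of_int l * s + 2 * pi * of_int (l * n)"
      using P by (simp add: field_simps)
    then show ?thesis by (metis cis_mult cis_multiple_2pi Ints_of_int mult.right_neutral)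
  qed
  have Csum: "AE s in lborel. (\<Sum>n. ennreal (u (s + P * of_int (int_decode n)))) \<le> ennreal C"
    by (rule AE_periodization_le[OF u0 C])
  have T: "(\<integral>\<^sup>+s. ennreal (u s * (cmod (\<Sum>l\<in>F. d l * cis (2 * pi / P * of_int l * s)))\<^sup>2) \<partial>lborel)
      \<le> ennreal (C * (P * (\<Sum>l\<in>F. (cmod (d l))\<^sup>2)))" for d
  proof -
    define T where "T s = (cmod (\<Sum>l\<in>F. d l * cis (2 * pi / P * of_int l * s)))\<^sup>2" for s
    have T[measurable]: "T \<in> borel_measurable borel"
      unfolding T_def[abs_def] cis_conv_exp by measurable
    have Tp: "T (s + P * of_int n) = T s" for s n unfolding T_def by (simp only: period)
    have T0: "T s \<ge> 0" for s by (simp add: T_def)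
    have "(\<integral>\<^sup>+s. ennreal (u s * T s) \<partial>lborel) = (\<integral>\<^sup>+s. (\<Sum>n. ennreal (u (s + P * of_int (int_decode n)) * T (s + P * of_int (int_decode n)))) * indicator {0..<P} s \<partial>lborel)"
      by (rule nn_integral_periodization) (auto simp: P)
    also have "\<dots> = (\<integral>\<^sup>+s. (\<Sum>n. ennreal (u (s + P * of_int (int_decode n)))) * (ennreal (T s) * indicator {0..<P} s) \<partial>lborel)"
      by (simp only: Tp ennreal_mult[OF u0 T0] ennreal_suminf_multc mult.assoc)
    also have "\<dots> \<le> (\<integral>\<^sup>+s. ennreal C * (ennreal (T s) * indicator {0..<P} s) \<partial>lborel)"
      by (rule nn_integral_mono_AE, rule AE_mp[OF Csum], intro AE_I2 impI mult_right_mono) simp_all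
    also have "\<dots> = ennreal C * ennreal (P * (\<Sum>l\<in>F. (cmod (d l))\<^sup>2))"
    proof -
      have "(\<integral>\<^sup>+s. ennreal (T s) * indicator {0..<P} s \<partial>lborel) = ennreal (P * (\<Sum>l\<in>F. (cmod (d l))\<^sup>2))"
        unfolding T_def
      proof (rule trig_poly_norm_period[OF P F])
        fix i j :: int assume "i \<noteq> j"
        then show "\<exists>p::int. p \<noteq> 0 \<and> 2 * pi / P * of_int i - 2 * pi / P * of_int j = 2 * pi / P * of_int p"
          by (intro exI[of _ "i - j"]) (simp add: right_diff_distrib)
      qed
      then show ?thesis by (subst nn_integral_cmult) auto
    qed
    finally show ?thesis using C0 by (simp add: T_def ennreal_mult')
  qed
  define z where "z l = (LINT s|lborel. of_real (u s) * D s * cis (2 * pi / P * of_int l * s))" for l :: int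
  define S where "S = (\<Sum>l\<in>F. (cmod (z l))\<^sup>2)"
  \<comment> \<open>The conjugate exponentials carry the coefficients \<open>z\<close> themselves,
    so that the weighted pairing of \<open>D\<close> with \<open>T\<close> is exactly
    \<open>S\<close>.\<close>
  define T where "T s = (\<Sum>l\<in>F. z l * cis (- (2 * pi / P * of_int l * s)))" for s
  have [measurable]: "T \<in> borel_measurable borel" unfolding T_def[abs_def] cis_conv_exp by measurable
  have cT: "cmod (T s) = cmod (\<Sum>l\<in>F. cnj (z l) * cis (2 * pi / P * of_int l * s))" for s
    unfolding T_def by (subst complex_mod_cnj[symmetric]) (simp add: cis_cnj)
  have nT: "(\<integral>\<^sup>+s. ennreal (u s * (cmod (T s))\<^sup>2) \<partial>lborel) \<le> ennreal (C * (P * S))"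
    using T[of "\<lambda>l. cnj (z l)"] by (simp add: S_def cT)
  have iT: "integrable lborel (\<lambda>s. u s * (cmod (T s))\<^sup>2)"
    by (rule integrableI_nonneg) (use nT u0 in \<open>auto intro: le_less_trans\<close>)
  have IT: "(LINT s|lborel. u s * (cmod (T s))\<^sup>2) \<le> C * (P * S)"
  proof -
    have "ennreal (LINT s|lborel. u s * (cmod (T s))\<^sup>2) \<le> ennreal (C * (P * S))"
      using nT u0 by (subst (asm) nn_integral_eq_integral[OF iT]) auto
    moreover have "0 \<le> C * (P * S)" using P C0 by (auto simp: S_def intro!: mult_nonneg_nonneg sum_nonneg)
    ultimately show ?thesis by (simp only: ennreal_le_iff)
  qed
  have "integrable lborel u" by (rule integrable_of_periodization_bounded[OF _ P u0 C]) simp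
  then have iu: "integrable lborel (\<lambda>s. u s + u s * (cmod (D s))\<^sup>2)" using D by (rule Bochner_Integration.integrable_add)
  have iuD: "integrable lborel (\<lambda>s. of_real (u s) * D s)"
  proof (rule Bochner_Integration.integrable_bound[OF iu])
    \<comment> \<open>This dominates \<open>u s * cmod (D s)\<close> by the sum of the integrable
      weight and the integrable energy.\<close>
    have "x \<le> 1 + x\<^sup>2" if "x \<ge> 0" for x :: real
      using zero_le_power2[of "x - 1/2"] that by (simp add: power2_eq_square algebra_simps)
    then have "u s * cmod (D s) \<le> u s * (1 + (cmod (D s))\<^sup>2)" for s by (intro mult_left_mono u0) auto
    then show "AE s in lborel. norm (of_real (u s) * D s) \<le> norm (u s + u s * (cmod (D s))\<^sup>2)"
      using u0 by (simp add: norm_mult abs_of_nonneg algebra_simps)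
  qed simp
  have iDl: "integrable lborel (\<lambda>s. of_real (u s) * D s * cis (2 * pi / P * of_int l * s))" for l
    by (rule Bochner_Integration.integrable_bound[OF iuD]) (auto simp: norm_mult cis_conv_exp)
  have uDT: "(\<lambda>s. of_real (u s) * D s * cnj (T s)) = (\<lambda>s. \<Sum>l\<in>F. cnj (z l) * (of_real (u s) * D s * cis (2 * pi / P * of_int l * s)))"
    by (simp add: T_def sum_distrib_left cis_cnj mult_ac)
  have iDT: "integrable lborel (\<lambda>s. of_real (u s) * D s * cnj (T s))"
    unfolding uDT by (intro Bochner_Integration.integrable_sum integrable_mult_right iDl)
  have "(LINT s|lborel. of_real (u s) * D s * cnj (T s)) = of_real S"
  proof -
    have "cnj (z l) * z l = of_real ((cmod (z l))\<^sup>2)" for l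
      by (simp only: complex_norm_square mult.commute)
    then show ?thesis unfolding uDT using iDl
      by (subst Bochner_Integration.integral_sum)
         (auto simp only: integral_mult_right_zero z_def[symmetric] S_def of_real_sum intro!: integrable_mult_right)
  qed
  then have IDT: "(LINT s|lborel. Re (of_real (u s) * D s * cnj (T s))) = S" using integral_Re[OF iDT] by simp
  \<comment> \<open>The minimizer of the upper bound for \<open>\<integral> u * (cmod (D - \<kappa> * T))\<^sup>2 \<ge> 0\<close> that \<open>IT\<close> yields.\<close>
  define \<kappa> where "\<kappa> = 1 / (C * P)"
  have sq: "u s * (cmod (D s - of_real \<kappa> * T s))\<^sup>2 = u s * (cmod (D s))\<^sup>2 - 2 * \<kappa> * Re (of_real (u s) * D s * cnj (T s)) + \<kappa>\<^sup>2 * (u s * (cmod (T s))\<^sup>2)" for s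
    unfolding cmod_power2 by (simp add: power2_eq_square algebra_simps)
  have "0 \<le> (LINT s|lborel. u s * (cmod (D s - of_real \<kappa> * T s))\<^sup>2)" using u0 by (intro Bochner_Integration.integral_nonneg) auto
  also have "\<dots> = (LINT s|lborel. u s * (cmod (D s))\<^sup>2) - 2 * \<kappa> * S + \<kappa>\<^sup>2 * (LINT s|lborel. u s * (cmod (T s))\<^sup>2)"
    unfolding sq using D iT integrable_Re[OF iDT] IDT by simp
  also have "\<dots> \<le> (LINT s|lborel. u s * (cmod (D s))\<^sup>2) - 2 * \<kappa> * S + \<kappa>\<^sup>2 * (C * (P * S))"
    by (intro add_left_mono mult_left_mono IT) auto
  also have "\<kappa>\<^sup>2 * (C * (P * S)) = \<kappa> * S" using C0 P by (simp add: \<kappa>_def power2_eq_square)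
  finally have "\<kappa> * S \<le> (LINT s|lborel. u s * (cmod (D s))\<^sup>2)" by linarith
  then show ?thesis using C0 P by (simp add: \<kappa>_def S_def z_def field_simps)
qed

section \<open>Windowed trigonometric polynomials\<close>

text \<open>The truncation at 1 permits dominated convergence against any integrable function; the
  linear part supplies the decay for small x.\<close>

lemma norm_cis_minus_1_le: "cmod (cis x - 1) \<le> 2 * min 1 \<bar>x\<bar>"
proof -
  have "cmod (cis x - 1) \<le> \<bar>x\<bar>" using iexp_approx1[of x 0] by (simp add: cis_conv_exp)
  moreover have "cmod (cis x - 1) \<le> 2" using iexp_approx2[of x 0] by (simp add: cis_conv_exp)
  ultimately show ?thesis by (auto simp: min_def)
qed

text \<open>One factor of the square is discarded, so that the same first-order quantity controls
  norms and squared norms.\<close>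

lemma norm_cis_minus_1_sq_le: "(cmod (cis x - 1))\<^sup>2 \<le> 4 * min 1 \<bar>x\<bar>"
proof -
  have "(cmod (cis x - 1))\<^sup>2 \<le> (2 * min 1 \<bar>x\<bar>)\<^sup>2" by (intro power_mono norm_cis_minus_1_le) simp
  also have "\<dots> = 4 * (min 1 \<bar>x\<bar> * min 1 \<bar>x\<bar>)" by (simp add: power2_eq_square)
  also have "\<dots> \<le> 4 * (min 1 \<bar>x\<bar> * 1)" by (intro mult_left_mono) auto
  finally show ?thesis by simp
qed

lemma integrable_unit_bounded:
  fixes D :: "real \<Rightarrow> complex"
  assumes [measurable]: "D \<in> borel_measurable borel" and K: "\<And>y. y \<in> {0..1} \<Longrightarrow> cmod (D y) \<le> K"
  shows "integrable lborel (\<lambda>y. of_real (indicat_real {0..1} y) * D y)"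
proof (rule Bochner_Integration.integrable_bound)
  show "integrable lborel (\<lambda>y::real. indicat_real {0..1} y * K)"
    by (intro integrable_mult_left integrable_real_indicator) auto
  show "AE y in lborel. norm (of_real (indicat_real {0..1} y) * D y) \<le> norm (indicat_real {0..1} y * K)"
    using order_trans[OF K abs_ge_self] by (auto simp: indicator_def norm_mult)
qed simp

lemma integrable_unit_bounded_sq:
  fixes D :: "real \<Rightarrow> complex"
  assumes [measurable]: "D \<in> borel_measurable borel" and K: "\<And>y. y \<in> {0..1} \<Longrightarrow> (cmod (D y))\<^sup>2 \<le> K"
  shows "integrable lborel (\<lambda>y. indicat_real {0..1} y * (cmod (D y))\<^sup>2)"
    and "(LINT y|lborel. indicat_real {0..1} y * (cmod (D y))\<^sup>2) \<le> K"
proof -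
  have iK: "integrable lborel (\<lambda>y::real. indicat_real {0..1} y * K)"
    by (intro integrable_mult_left integrable_real_indicator) auto
  show 1: "integrable lborel (\<lambda>y. indicat_real {0..1} y * (cmod (D y))\<^sup>2)"
  proof (rule Bochner_Integration.integrable_bound[OF iK])
    show "AE y in lborel. norm (indicat_real {0..1} y * (cmod (D y))\<^sup>2) \<le> norm (indicat_real {0..1} y * K)"
      using order_trans[OF K abs_ge_self] by (auto simp: indicator_def)
  qed simp
  have "(LINT y|lborel. indicat_real {0..1} y * (cmod (D y))\<^sup>2) \<le> (LINT y::real|lborel. indicat_real {0..1} y * K)"
    using K by (intro integral_mono 1 iK) (auto simp: indicator_def)
  then show "(LINT y|lborel. indicat_real {0..1} y * (cmod (D y))\<^sup>2) \<le> K" by simp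
qed

text \<open>Up to a phase this is a dilated sinc function. The integral form displays its samples
  along a lattice as Fourier coefficients of a function on [0,1].\<close>

definition window :: "real \<Rightarrow> real \<Rightarrow> complex" where
  "window \<epsilon> t = (LINT y|lborel. of_real (indicat_real {0..1} y) * cis (\<epsilon> * t * y))"

lemma borel_measurable_cis[measurable]: "cis \<in> borel_measurable borel"
  unfolding cis_conv_exp by measurable

lemma borel_measurable_window[measurable]: "window \<epsilon> \<in> borel_measurable borel"
  unfolding window_def[abs_def] by measurable

lemma window_diff:
  "window \<epsilon> (s + t) - window \<epsilon> t =
    (LINT y|lborel. of_real (indicat_real {0..1} y) * (cis (\<epsilon> * s * y) - 1) * cis (\<epsilon> * t * y))"
proof -
  have i: "integrable lborel (\<lambda>y. of_real (indicat_real {0..1} y) * cis (\<epsilon> * r * y))" for r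
    by (rule integrable_unit_bounded[of _ 1]) auto
  have "cis (\<epsilon> * (s + t) * y) = cis (\<epsilon> * s * y) * cis (\<epsilon> * t * y)" for y
    by (simp add: cis_mult algebra_simps)
  then show ?thesis unfolding window_def
    by (subst Bochner_Integration.integral_diff[OF i i, symmetric]) (simp add: algebra_simps)
qed

text \<open>The condition \<epsilon> * \<alpha> < 2 * pi makes the period 2 * pi / (\<epsilon> *
  \<alpha>) of the sampling exponentials longer than 1. The translates of [0,1] by multiples of that
  period are then disjoint, and the periodized indicator is at most 1.\<close>

lemma window_bessel:
  fixes D :: "real \<Rightarrow> complex"
  assumes D[measurable]: "D \<in> borel_measurable borel" and K: "\<And>y. y \<in> {0..1} \<Longrightarrow> (cmod (D y))\<^sup>2 \<le> K"
    and e: "\<epsilon> > 0" "\<alpha> > 0" "\<epsilon> * \<alpha> < 2 * pi" and F: "finite F"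
  shows "(\<Sum>k\<in>F. (cmod (LINT y|lborel. of_real (indicat_real {0..1} y) * D y * cis (\<epsilon> * (\<alpha> * of_int k) * y)))\<^sup>2)
    \<le> 2 * pi / (\<epsilon> * \<alpha>) * K"
proof -
  define P where "P = 2 * pi / (\<epsilon> * \<alpha>)"
  have P: "P > 1" using e by (simp add: P_def)
  have PC: "2 * pi / P * of_int k * y = \<epsilon> * (\<alpha> * of_int k) * y" for k y
    using e by (simp add: P_def)
  have one: "(\<Sum>n\<in>F. indicat_real {0..1} (s + P * of_int n)) \<le> 1" if F: "finite F" for s and F :: "int set"
  proof -
    have "m = n" if "s + P * of_int m \<in> {0..1}" "s + P * of_int n \<in> {0..1}" for m n :: int
    proof (rule ccontr)
      assume "m \<noteq> n"
      then have "1 \<le> \<bar>of_int (m - n) :: real\<bar>" by (metis Ints_nonzero_abs_ge1 Ints_of_int eq_iff_diff_eq_0 of_int_eq_0_iff)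
      then have "P * 1 \<le> P * \<bar>of_int (m - n)\<bar>" using P by (intro mult_left_mono) auto
      also have "\<dots> = \<bar>(s + P * of_int m) - (s + P * of_int n)\<bar>" using P by (simp add: abs_mult right_diff_distrib[symmetric])
      also have "\<dots> \<le> 1" using that by auto
      finally show False using P by simp
    qed
    then have "card {n\<in>F. s + P * of_int n \<in> {0..1}} \<le> Suc 0"
      using F by (subst card_le_Suc0_iff_eq) auto
    then show ?thesis using F by (simp add: indicator_def sum.If_cases Collect_conj_eq[symmetric] Int_def)
  qed
  have "(\<Sum>k\<in>F. (cmod (LINT y|lborel. of_real (indicat_real {0..1} y) * D y * cis (2 * pi / P * of_int k * y)))\<^sup>2)
    \<le> P * 1 * (LINT y|lborel. indicat_real {0..1} y * (cmod (D y))\<^sup>2)"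
    using P one by (intro bessel_periodized integrable_unit_bounded_sq(1)[OF D K] F) auto
  also have "\<dots> \<le> P * K" using P integrable_unit_bounded_sq(2)[OF D K] by simp
  finally show ?thesis unfolding PC by (simp add: P_def)
qed

text \<open>The phase s contributes only the unimodular factor
  \<open>cis (\<epsilon> * s * y)\<close> to the Fourier coefficients; hence the bound is uniform in
  s.\<close>

lemma sum_window_sq_le:
  assumes "\<epsilon> > 0" "\<alpha> > 0" "\<epsilon> * \<alpha> < 2 * pi" "finite F"
  shows "(\<Sum>k\<in>F. (cmod (window \<epsilon> (s + \<alpha> * of_int k)))\<^sup>2) \<le> 2 * pi / (\<epsilon> * \<alpha>)"
proof -
  have "cis (\<epsilon> * (s + \<alpha> * of_int k) * y) = cis (\<epsilon> * s * y) * cis (\<epsilon> * (\<alpha> * of_int k) * y)" for y k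
    by (simp add: cis_mult algebra_simps)
  then show ?thesis
    using window_bessel[of "\<lambda>y. cis (\<epsilon> * s * y)" 1 \<epsilon> \<alpha> F] assms by (simp add: window_def mult.assoc)
qed

lemma sum_window_diff_sq_le:
  assumes "\<epsilon> > 0" "\<alpha> > 0" "\<epsilon> * \<alpha> < 2 * pi" "finite F"
  shows "(\<Sum>k\<in>F. (cmod (window \<epsilon> (s + \<alpha> * of_int k) - window \<epsilon> (\<alpha> * of_int k)))\<^sup>2)
    \<le> 2 * pi / (\<epsilon> * \<alpha>) * (4 * min 1 (\<epsilon> * \<bar>s\<bar>))"
  unfolding window_diff
proof (rule window_bessel)
  fix y :: real assume y: "y \<in> {0..1}"
  have "(cmod (cis (\<epsilon> * s * y) - 1))\<^sup>2 \<le> 4 * min 1 \<bar>\<epsilon> * s * y\<bar>" by (rule norm_cis_minus_1_sq_le)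
  also have "\<bar>\<epsilon> * s * y\<bar> \<le> \<epsilon> * \<bar>s\<bar>"
    using y assms mult_left_le[of y "\<epsilon> * \<bar>s\<bar>"] by (simp add: abs_mult)
  finally show "(cmod (cis (\<epsilon> * s * y) - 1))\<^sup>2 \<le> 4 * min 1 (\<epsilon> * \<bar>s\<bar>)" by (simp add: min.coboundedI2 min_def split: if_splits)
qed (use assms in auto)

lemma norm_window_ge:
  assumes "\<bar>\<epsilon> * t\<bar> \<le> 1/2" shows "1/2 \<le> cmod (window \<epsilon> t)"
proof -
  have i: "integrable lborel (\<lambda>y. of_real (indicat_real {0..1} y) * cis (\<epsilon> * t * y))"
    by (rule integrable_unit_bounded[of _ 1]) auto
  have j: "integrable lborel (\<lambda>y::real. of_real (indicat_real {0..1} y) * (1::complex))"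
    using integrable_unit_bounded[of "\<lambda>_. 1" 1] by simp
  have "window \<epsilon> t - 1 = (LINT y|lborel. of_real (indicat_real {0..1} y) * cis (\<epsilon> * t * y)) - (LINT y::real|lborel. of_real (indicat_real {0..1} y) * (1::complex))"
    by (simp add: window_def)
  also have "\<dots> = (LINT y|lborel. of_real (indicat_real {0..1} y) * (cis (\<epsilon> * t * y) - 1))"
    by (subst Bochner_Integration.integral_diff[OF i j, symmetric]) (simp add: algebra_simps)
  also have "cmod \<dots> \<le> (LINT y::real|lborel. indicat_real {0..1} y * (1/2))"
  proof (rule order_trans[OF integral_norm_bound integral_mono])
    have "cmod (cis (\<epsilon> * t * y) - 1) \<le> 2" for y using norm_cis_minus_1_le[of "\<epsilon> * t * y"] by linarith
    then show "integrable lborel (\<lambda>y. norm (of_real (indicat_real {0..1} y) * (cis (\<epsilon> * t * y) - 1)))"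
      by (intro integrable_norm integrable_unit_bounded[of _ 2]) auto
    show "integrable lborel (\<lambda>y::real. indicat_real {0..1} y * (1/2))"
      by (intro integrable_mult_left integrable_real_indicator) auto
    fix y :: real
    show "cmod (of_real (indicat_real {0..1} y) * (cis (\<epsilon> * t * y) - 1)) \<le> indicat_real {0..1} y * (1/2)"
    proof (cases "y \<in> {0..1}")
      case True
      have "cmod (cis (\<epsilon> * t * y) - 1) \<le> \<bar>\<epsilon> * t * y\<bar>" using iexp_approx1[of "\<epsilon> * t * y" 0] by (simp add: cis_conv_exp)
      also have "\<dots> \<le> 1/2" using True assms mult_left_le[of y "\<bar>\<epsilon> * t\<bar>"] by (simp add: abs_mult)
      finally show ?thesis using True by simp
    qed simp
  qed
  finally have "cmod (window \<epsilon> t - 1) \<le> 1/2" by simp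
  then show ?thesis using norm_triangle_ineq2[of 1 "1 - window \<epsilon> t"] by (simp add: norm_minus_commute)
qed

text \<open>The window has modulus at least 1/2 up to 1 / (2 * \<epsilon>). With x = 1 / (2 *
  (\<epsilon> * \<alpha>)) this covers floor x samples, which is at least x / 2 because x is at
  least 1; each contributes 1/4, in total x / 8 = 1 / (16 * (\<epsilon> * \<alpha>)).\<close>

lemma sum_window_sq_ge:
  assumes "\<epsilon> > 0" "\<alpha> > 0" "2 * (\<epsilon> * \<alpha>) \<le> 1" "0 \<le> s" "s < \<alpha>"
  shows "1 / (16 * (\<epsilon> * \<alpha>)) \<le> (\<Sum>k = 0..<\<lfloor>1 / (2 * (\<epsilon> * \<alpha>))\<rfloor>. (cmod (window \<epsilon> (s + \<alpha> * of_int k)))\<^sup>2)"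
proof -
  define x where "x = 1 / (2 * (\<epsilon> * \<alpha>))"
  have x: "x \<ge> 1" using assms by (simp add: x_def)
  have "1 \<le> \<lfloor>x\<rfloor>" using x by simp
  then have "1/4 * (x / 2) \<le> 1/4 * of_int \<lfloor>x\<rfloor>" by linarith
  also have "\<dots> = (\<Sum>k = 0..<\<lfloor>x\<rfloor>. (1/2)\<^sup>2)" using x by (simp add: power2_eq_square)
  also have "\<dots> \<le> (\<Sum>k = 0..<\<lfloor>x\<rfloor>. (cmod (window \<epsilon> (s + \<alpha> * of_int k)))\<^sup>2)"
  proof (intro sum_mono power_mono norm_window_ge)
    fix k assume k: "k \<in> {0..<\<lfloor>x\<rfloor>}"
    \<comment> \<open>The index stops one below the floor, which leaves room for the offset s <
      \<alpha>.\<close>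
    then have kx: "of_int k + 1 \<le> x" by (simp add: less_floor_iff)
    have "s + \<alpha> * of_int k \<le> \<alpha> * (of_int k + 1)" using assms by (simp add: algebra_simps)
    also have "\<dots> \<le> \<alpha> * x" using kx assms by simp
    finally have "\<epsilon> * (s + \<alpha> * of_int k) \<le> \<epsilon> * (\<alpha> * x)" using assms by simp
    also have "\<dots> = 1/2" using assms by (simp add: x_def)
    finally show "\<bar>\<epsilon> * (s + \<alpha> * of_int k)\<bar> \<le> 1/2" using assms k by simp
  qed auto
  finally show ?thesis by (simp add: x_def)
qed

text \<open>
  The deviation of a Gabor coefficient of the windowed trigonometric polynomial from its limiting product
  form. The squared norm of the test function has order \<open>2 * pi / (\<epsilon> * \<alpha>)\<close>, so the errors have to
  vanish relative to this number.
\<close>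

definition window_error :: "(real \<Rightarrow> complex) \<Rightarrow> real \<Rightarrow> real \<Rightarrow> real \<Rightarrow> int \<Rightarrow> int \<Rightarrow> complex" where
  "window_error g \<alpha> \<beta> \<epsilon> k l = (LINT s|lborel. g s * cis (- (\<beta> * of_int l * s)) *
     (window \<epsilon> (s + \<alpha> * of_int k) - window \<epsilon> (\<alpha> * of_int k)))"

definition window_errors_vanish :: "(real \<Rightarrow> complex) \<Rightarrow> real \<Rightarrow> real \<Rightarrow> bool" where
  "window_errors_vanish g \<alpha> \<beta> \<longleftrightarrow> (\<forall>\<delta>>0. \<exists>\<epsilon>0>0. \<forall>\<epsilon>. 0 < \<epsilon> \<and> \<epsilon> < \<epsilon>0 \<longrightarrow> (\<forall>K L :: int set. finite K \<longrightarrow> finite L \<longrightarrow>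
     (\<Sum>k\<in>K. \<Sum>l\<in>L. (cmod (window_error g \<alpha> \<beta> \<epsilon> k l))\<^sup>2) \<le> 2 * pi / (\<epsilon> * \<alpha>) * \<delta>))"

section \<open>Criteria for vanishing window errors, in time and in frequency\<close>

lemma LIMSEQ_inverse_Suc: "(\<lambda>n. 1 / real (Suc n)) \<longlonglongrightarrow> 0"
  using LIMSEQ_inverse_real_of_nat by (simp add: divide_inverse)

text \<open>Dominated convergence along 1 / Suc n; monotonicity in \<epsilon> extends the bound to
  all smaller values.\<close>

lemma integral_min_small:
  fixes g :: "real \<Rightarrow> complex"
  assumes g: "integrable lborel g" and \<eta>: "\<eta> > 0"
  obtains \<epsilon>0 where "\<epsilon>0 > 0" "\<And>\<epsilon>. 0 \<le> \<epsilon> \<Longrightarrow> \<epsilon> < \<epsilon>0 \<Longrightarrow> (LINT s|lborel. cmod (g s) * min 1 (\<epsilon> * \<bar>s\<bar>)) \<le> \<eta>"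
proof -
  have [measurable]: "g \<in> borel_measurable borel" using g by auto
  have i: "integrable lborel (\<lambda>s. cmod (g s) * min 1 (\<epsilon> * \<bar>s\<bar>))" if "\<epsilon> \<ge> 0" for \<epsilon>
    using that by (intro Bochner_Integration.integrable_bound[OF integrable_norm[OF g]])
      (auto simp: abs_mult intro!: mult_left_le)
  have "(\<lambda>n. LINT s|lborel. cmod (g s) * min 1 (1 / real (Suc n) * \<bar>s\<bar>)) \<longlonglongrightarrow> (LINT s::real|lborel. 0)"
  proof (rule integral_dominated_convergence[where w="\<lambda>s. cmod (g s)"])
    show "AE s in lborel. (\<lambda>n. cmod (g s) * min 1 (1 / real (Suc n) * \<bar>s\<bar>)) \<longlonglongrightarrow> 0"
    proof (rule AE_I2)
      fix s :: real
      have "(\<lambda>n. cmod (g s) * min 1 (1 / real (Suc n) * \<bar>s\<bar>)) \<longlonglongrightarrow> cmod (g s) * min 1 (0 * \<bar>s\<bar>)"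
        using LIMSEQ_inverse_real_of_nat by (intro tendsto_intros) (simp add: divide_inverse)
      then show "(\<lambda>n. cmod (g s) * min 1 (1 / real (Suc n) * \<bar>s\<bar>)) \<longlonglongrightarrow> 0" by simp
    qed
    show "AE s in lborel. norm (cmod (g s) * min 1 (1 / real (Suc n) * \<bar>s\<bar>)) \<le> cmod (g s)" for n
      by (rule AE_I2) (auto simp: abs_mult intro!: mult_left_le)
  qed (use g in auto)
  then have "\<forall>\<^sub>F n in sequentially. (LINT s|lborel. cmod (g s) * min 1 (1 / real (Suc n) * \<bar>s\<bar>)) < \<eta>"
    using \<eta> by (intro order_tendstoD) auto
  then obtain n where n: "(LINT s|lborel. cmod (g s) * min 1 (1 / real (Suc n) * \<bar>s\<bar>)) < \<eta>"
    using eventually_happens' sequentially_bot by blast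
  show ?thesis
  proof (rule that[of "1 / real (Suc n)"])
    fix \<epsilon> :: real assume e: "0 \<le> \<epsilon>" "\<epsilon> < 1 / real (Suc n)"
    have "(LINT s|lborel. cmod (g s) * min 1 (\<epsilon> * \<bar>s\<bar>)) \<le> (LINT s|lborel. cmod (g s) * min 1 (1 / real (Suc n) * \<bar>s\<bar>))"
      using e by (intro integral_mono i mult_left_mono min.mono mult_right_mono) auto
    with n show "(LINT s|lborel. cmod (g s) * min 1 (\<epsilon> * \<bar>s\<bar>)) \<le> \<eta>" by linarith
  qed simp
qed

text \<open>This modulus of continuity of the Fourier transform depends only on the difference of
  the frequencies. The uniformity in the base point serves all \<beta> * l at once.\<close>

lemma norm_integral_cis_diff_le:
  fixes g :: "real \<Rightarrow> complex"
  assumes g: "integrable lborel g"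
  shows "cmod ((LINT s|lborel. g s * cis (x * s)) - (LINT s|lborel. g s * cis (y * s))) \<le>
    2 * (LINT s|lborel. cmod (g s) * min 1 (\<bar>x - y\<bar> * \<bar>s\<bar>))"
proof -
  have [measurable]: "g \<in> borel_measurable borel" using g by auto
  have gi: "integrable lborel (\<lambda>s. g s * cis (z * s))" for z
    by (rule Bochner_Integration.integrable_bound[OF g]) (auto simp: norm_mult)
  have "(LINT s|lborel. g s * cis (x * s)) - (LINT s|lborel. g s * cis (y * s)) = (LINT s|lborel. g s * cis (x * s) - g s * cis (y * s))"
    by (rule Bochner_Integration.integral_diff[OF gi gi, symmetric])
  also have "cmod \<dots> \<le> (LINT s|lborel. 2 * (cmod (g s) * min 1 (\<bar>x - y\<bar> * \<bar>s\<bar>)))"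
  proof (rule order_trans[OF integral_norm_bound integral_mono])
    show "integrable lborel (\<lambda>s. cmod (g s * cis (x * s) - g s * cis (y * s)))"
      by (intro integrable_norm Bochner_Integration.integrable_diff gi)
    show "integrable lborel (\<lambda>s. 2 * (cmod (g s) * min 1 (\<bar>x - y\<bar> * \<bar>s\<bar>)))"
      by (intro integrable_mult_right Bochner_Integration.integrable_bound[OF integrable_norm[OF g]])
        (auto simp: abs_mult intro!: mult_left_le)
    fix s
    have "cis (x * s) = cis (y * s) * cis ((x - y) * s)" by (simp add: cis_mult algebra_simps)
    then have "cmod (g s * cis (x * s) - g s * cis (y * s)) = cmod (g s * cis (y * s) * (cis ((x - y) * s) - 1))"
      by (simp add: algebra_simps)
    also have "\<dots> \<le> cmod (g s) * (2 * min 1 \<bar>(x - y) * s\<bar>)"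
      using mult_left_mono[OF norm_cis_minus_1_le norm_ge_zero[of "g s"]] by (simp add: norm_mult)
    finally show "cmod (g s * cis (x * s) - g s * cis (y * s)) \<le> 2 * (cmod (g s) * min 1 (\<bar>x - y\<bar> * \<bar>s\<bar>))"
      by (simp add: abs_mult)
  qed
  finally show ?thesis by simp
qed

text \<open>For fixed k the errors are Fourier coefficients with respect to the weight
  \<open>cmod (g s)\<close>, whose periodization is bounded, so Bessel's inequality sums over l.
  Summing over k under the integral leaves the squared window differences, which are of order Q *
  min 1 (\<epsilon> * |s|) and small in the mean against g.\<close>

lemma window_errors_vanish_time:
  fixes g :: "real \<Rightarrow> complex"
  assumes g: "integrable lborel g" and ab: "\<alpha> > 0" "\<beta> > 0" and C0: "C > 0"
    and C: "AE s in lborel. \<forall>F::int set. finite F \<longrightarrow> (\<Sum>n\<in>F. cmod (g (s + 2 * pi / \<beta> * of_int n))) \<le> C"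
  shows "window_errors_vanish g \<alpha> \<beta>"
  unfolding window_errors_vanish_def
proof (intro allI impI)
  fix \<delta> :: real assume \<delta>: "\<delta> > 0"
  have [measurable]: "g \<in> borel_measurable borel" using g by auto
  define R where "R = 2 * pi / \<beta> * C"
  have R: "R > 0" using ab C0 by (simp add: R_def)
  \<comment> \<open>R is the constant of Bessel's inequality in l; the 4 comes from the squared
    window difference.\<close>
  have "\<delta> / (4 * R) > 0" using \<delta> R by simp
  then obtain \<epsilon>0 where e0: "\<epsilon>0 > 0" "\<And>\<epsilon>. 0 \<le> \<epsilon> \<Longrightarrow> \<epsilon> < \<epsilon>0 \<Longrightarrow> (LINT s|lborel. cmod (g s) * min 1 (\<epsilon> * \<bar>s\<bar>)) \<le> \<delta> / (4 * R)"
    using integral_min_small[OF g] by metis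
  show "\<exists>\<epsilon>0>0. \<forall>\<epsilon>. 0 < \<epsilon> \<and> \<epsilon> < \<epsilon>0 \<longrightarrow> (\<forall>K L :: int set. finite K \<longrightarrow> finite L \<longrightarrow>
     (\<Sum>k\<in>K. \<Sum>l\<in>L. (cmod (window_error g \<alpha> \<beta> \<epsilon> k l))\<^sup>2) \<le> 2 * pi / (\<epsilon> * \<alpha>) * \<delta>)"
  proof (intro exI[of _ "min \<epsilon>0 (1 / \<alpha>)"] conjI allI impI)
    show "min \<epsilon>0 (1 / \<alpha>) > 0" using e0 ab by simp
    fix \<epsilon> and K L :: "int set" assume e: "0 < \<epsilon> \<and> \<epsilon> < min \<epsilon>0 (1 / \<alpha>)" and KL: "finite K" "finite L"
    have "\<epsilon> * \<alpha> < 1" using e ab by (simp add: field_simps)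
    then have ea: "\<epsilon> * \<alpha> < 2 * pi" using pi_gt3 by linarith
    define \<Delta> where "\<Delta> k s = window \<epsilon> (s + \<alpha> * of_int k) - window \<epsilon> (\<alpha> * of_int k)" for k :: int and s
    have [measurable]: "\<Delta> k \<in> borel_measurable borel" for k unfolding \<Delta>_def[abs_def] by measurable
    define Q where "Q = 2 * pi / (\<epsilon> * \<alpha>)"
    have Q: "Q > 0" using e ab by (simp add: Q_def)
    have S: "(\<Sum>k\<in>F. (cmod (\<Delta> k s))\<^sup>2) \<le> Q * (4 * min 1 (\<epsilon> * \<bar>s\<bar>))" if "finite F" for F s
      unfolding \<Delta>_def Q_def using e ab ea that by (intro sum_window_diff_sq_le) auto
    have ig: "integrable lborel (\<lambda>s. cmod (g s) * (cmod (\<Delta> k s))\<^sup>2)" for k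
    proof (rule Bochner_Integration.integrable_bound[OF integrable_mult_right[OF integrable_norm[OF g]], of _ "Q * 4"])
      have "(cmod (\<Delta> k s))\<^sup>2 \<le> Q * 4" for s
      proof -
        have "Q * (4 * min 1 (\<epsilon> * \<bar>s\<bar>)) \<le> Q * (4 * 1)" using Q by (intro mult_left_mono) auto
        then show ?thesis using S[of "{k}" s] by simp
      qed
      then show "AE s in lborel. norm (cmod (g s) * (cmod (\<Delta> k s))\<^sup>2) \<le> norm (Q * 4 * cmod (g s))"
        using Q mult_left_mono[OF _ norm_ge_zero[of "g _"], of "(cmod (\<Delta> k _))\<^sup>2" "Q * 4"]
        by (intro AE_I2) (simp add: abs_mult mult_ac)
    qed simp
    have k: "(\<Sum>l\<in>L. (cmod (LINT s|lborel. g s * cis (- (\<beta> * of_int l * s)) * \<Delta> k s))\<^sup>2) \<le> R * (LINT s|lborel. cmod (g s) * (cmod (\<Delta> k s))\<^sup>2)" for k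
    proof -
      \<comment> \<open>Bessel's inequality is available for nonnegative weights, so g is split into
        its modulus, which is the weight, and its phase, which joins the window difference. The
        exponentials carry -l, hence the reflected index set below.\<close>
      have sg: "of_real (cmod z) * (sgn z * w) = z * w" for z w :: complex
        by (cases "z = 0") (simp_all add: sgn_eq)
      have sg2: "cmod z * (cmod (sgn z * w))\<^sup>2 = cmod z * (cmod w)\<^sup>2" for z w :: complex
        by (cases "z = 0") (simp_all add: norm_mult norm_sgn)
      have "(\<Sum>l\<in>uminus ` L. (cmod (LINT s|lborel. of_real (cmod (g s)) * (sgn (g s) * \<Delta> k s) * cis (2 * pi / (2 * pi / \<beta>) * of_int l * s)))\<^sup>2)
        \<le> 2 * pi / \<beta> * C * (LINT s|lborel. cmod (g s) * (cmod (sgn (g s) * \<Delta> k s))\<^sup>2)"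
        using ab KL C0 C ig by (intro bessel_periodized) (auto simp: sg2)
      note * = this[unfolded sg sg2]
      have **: "g s * \<Delta> k s * cis (2 * pi / (2 * pi / \<beta>) * of_int (- l) * s) = g s * cis (- (\<beta> * of_int l * s)) * \<Delta> k s" for l s
        using ab by (simp add: mult_ac)
      show ?thesis using * by (subst (asm) sum.reindex) (auto simp only: o_def ** R_def inj_on_def neg_equal_iff_equal)
    qed
    have "(\<Sum>k\<in>K. \<Sum>l\<in>L. (cmod (LINT s|lborel. g s * cis (- (\<beta> * of_int l * s)) * \<Delta> k s))\<^sup>2) \<le> (\<Sum>k\<in>K. R * (LINT s|lborel. cmod (g s) * (cmod (\<Delta> k s))\<^sup>2))"
      by (intro sum_mono k)
    also have "\<dots> = R * (LINT s|lborel. (\<Sum>k\<in>K. cmod (g s) * (cmod (\<Delta> k s))\<^sup>2))"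
      using ig by (simp add: sum_distrib_left)
    also have "\<dots> \<le> R * (LINT s|lborel. Q * 4 * (cmod (g s) * min 1 (\<epsilon> * \<bar>s\<bar>)))"
    proof (intro mult_left_mono integral_mono)
      show "integrable lborel (\<lambda>s. Q * 4 * (cmod (g s) * min 1 (\<epsilon> * \<bar>s\<bar>)))"
        using e by (intro integrable_mult_right Bochner_Integration.integrable_bound[OF integrable_norm[OF g]])
          (auto simp: abs_mult intro!: mult_left_le)
      show "(\<Sum>k\<in>K. cmod (g s) * (cmod (\<Delta> k s))\<^sup>2) \<le> Q * 4 * (cmod (g s) * min 1 (\<epsilon> * \<bar>s\<bar>))" for s
        using mult_left_mono[OF S[OF KL(1), of s] norm_ge_zero[of "g s"]] by (simp add: sum_distrib_left mult_ac)
    qed (use ig R in auto)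
    also have "\<dots> = R * (Q * 4 * (LINT s|lborel. cmod (g s) * min 1 (\<epsilon> * \<bar>s\<bar>)))" by simp
    also have "\<dots> \<le> R * (Q * 4 * (\<delta> / (4 * R)))" using e R Q by (intro mult_left_mono e0) auto
    also have "\<dots> = Q * \<delta>" using R by simp
    finally show "(\<Sum>k\<in>K. \<Sum>l\<in>L. (cmod (window_error g \<alpha> \<beta> \<epsilon> k l))\<^sup>2) \<le> 2 * pi / (\<epsilon> * \<alpha>) * \<delta>"
      by (simp add: \<Delta>_def Q_def window_error_def)
  qed
qed

lemma borel_measurable_cnj[measurable]: "cnj \<in> borel_measurable borel"
  by (intro borel_measurable_continuous_onI continuous_intros)

lemma summable_on_finite_tail:
  fixes f :: "'a \<Rightarrow> real"
  assumes f: "f summable_on UNIV" "\<And>x. f x \<ge> 0" and d: "\<delta> > 0"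
  obtains L0 where "finite L0" "\<And>L. finite L \<Longrightarrow> L \<inter> L0 = {} \<Longrightarrow> (\<Sum>x\<in>L. f x) \<le> \<delta>"
proof -
  obtain L0 where L0: "finite L0" "dist (sum f L0) (infsum f UNIV) \<le> \<delta>"
    using infsum_finite_approximation[OF f(1) d] by auto
  show ?thesis
  proof (rule that[OF L0(1)])
    fix L assume L: "finite L" "L \<inter> L0 = {}"
    have "sum f L + sum f L0 = sum f (L \<union> L0)" using L L0(1) by (simp add: sum.union_disjoint)
    also have "\<dots> \<le> infsum f UNIV" using f L L0(1) by (intro finite_sum_le_infsum) auto
    finally show "sum f L \<le> \<delta>" using L0(2) by (simp add: dist_real_def)
  qed
qed

text \<open>After the exchange of integrals the error is, as a function of t, a Fourier integral
  over y in [0,1] of increments of the transform of g near -b. For t = \<alpha> * k the sum over k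
  is thus accessible to \<open>window_bessel\<close>.\<close>

lemma window_error_fubini:
  fixes g :: "real \<Rightarrow> complex"
  assumes g: "integrable lborel g"
  shows "(LINT s|lborel. g s * cis (- (b * s)) * (window \<epsilon> (s + t) - window \<epsilon> t)) =
    (LINT y|lborel. of_real (indicat_real {0..1} y) *
       ((LINT s|lborel. g s * cis ((\<epsilon> * y - b) * s)) - (LINT s|lborel. g s * cis (- (b * s)))) * cis (\<epsilon> * t * y))"
proof -
  have [measurable]: "g \<in> borel_measurable borel" using g by auto
  define f where "f s y = g s * cis (- (b * s)) * (of_real (indicat_real {0..1} y) * (cis (\<epsilon> * s * y) - 1) * cis (\<epsilon> * t * y))" for s y
  have i1: "integrable (lborel \<Otimes>\<^sub>M lborel) (\<lambda>(s, y::real). g s * of_real (indicat_real {0..1} y))"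
  proof (rule lborel_pair.Fubini_integrable)
    have "(\<lambda>s. LINT y::real|lborel. norm (case (s, y) of (s, y) \<Rightarrow> g s * of_real (indicat_real {0..1} y))) = (\<lambda>s. norm (g s))"
      by (simp add: norm_mult)
    then show "integrable lborel (\<lambda>s. LINT y::real|lborel. norm (case (s, y) of (s, y) \<Rightarrow> g s * of_real (indicat_real {0..1} y)))"
      using g by simp
    show "AE s in lborel. integrable lborel (\<lambda>y::real. case (s, y) of (s, y) \<Rightarrow> g s * of_real (indicat_real {0..1} y))"
      by (rule AE_I2) (auto intro!: integrable_mult_right integrable_of_real integrable_real_indicator)
  qed measurable
  have i: "integrable (lborel \<Otimes>\<^sub>M lborel) (\<lambda>(s, y). f s y)"
  proof (rule Bochner_Integration.integrable_bound[OF integrable_mult_right[OF i1, of 2]])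
    show "AE p in lborel \<Otimes>\<^sub>M lborel. norm (case p of (s, y) \<Rightarrow> f s y) \<le> norm (2 * (case p of (s, y) \<Rightarrow> g s * of_real (indicat_real {0..1} y)))"
    proof (rule AE_I2, clarify)
      fix s y
      have "cmod (cis (\<epsilon> * s * y) - 1) \<le> 2" using norm_cis_minus_1_le[of "\<epsilon> * s * y"] by linarith
      from mult_left_mono[OF this, of "cmod (g s) * indicat_real {0..1} y"]
      show "norm (f s y) \<le> norm (2 * (g s * of_real (indicat_real {0..1} y)))"
        by (simp add: f_def norm_mult mult_ac)
    qed
  qed (unfold f_def, measurable)
  have gi: "integrable lborel (\<lambda>s. g s * cis (x * s))" for x
    by (rule Bochner_Integration.integrable_bound[OF g]) (auto simp: norm_mult)
  have "(LINT s|lborel. g s * cis (- (b * s)) * (window \<epsilon> (s + t) - window \<epsilon> t)) = (LINT s|lborel. LINT y|lborel. f s y)"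
    unfolding window_diff f_def by simp
  also have "\<dots> = (LINT y|lborel. LINT s|lborel. f s y)"
    by (rule lborel_pair.Fubini_integral[OF i, symmetric])
  also have "(\<lambda>y. LINT s|lborel. f s y) = (\<lambda>y. of_real (indicat_real {0..1} y) *
       ((LINT s|lborel. g s * cis ((\<epsilon> * y - b) * s)) - (LINT s|lborel. g s * cis (- (b * s)))) * cis (\<epsilon> * t * y))"
  proof
    fix y
    have "f s y = of_real (indicat_real {0..1} y) * cis (\<epsilon> * t * y) * (g s * cis ((\<epsilon> * y - b) * s) - g s * cis (- b * s))" for s
    proof -
      have "cis ((\<epsilon> * y - b) * s) = cis (- (b * s)) * cis (\<epsilon> * s * y)" by (simp add: cis_mult algebra_simps)
      then show ?thesis by (simp add: f_def algebra_simps)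
    qed
    then show "(LINT s|lborel. f s y) = of_real (indicat_real {0..1} y) *
       ((LINT s|lborel. g s * cis ((\<epsilon> * y - b) * s)) - (LINT s|lborel. g s * cis (- (b * s)))) * cis (\<epsilon> * t * y)"
      using gi[of "\<epsilon> * y - b"] gi[of "-b"] by simp
  qed
  finally show ?thesis .
qed

text \<open>The increments of the transform are small uniformly in l, which does not make them
  summable over l. The square summable majorant \<open>m\<close> controls all but finitely many l,
  and uniform continuity controls the rest.\<close>

lemma window_errors_vanish_frequency:
  fixes g :: "real \<Rightarrow> complex"
  assumes g: "integrable lborel g" and ab: "\<alpha> > 0" "\<beta> > 0"
    and m: "\<And>x l. 0 \<le> x \<Longrightarrow> x \<le> 1 \<Longrightarrow> cmod (LINT s|lborel. g s * cis ((x - \<beta> * of_int l) * s)) \<le> m l"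
    and sm: "(\<lambda>l::int. (m l)\<^sup>2) summable_on UNIV"
  shows "window_errors_vanish g \<alpha> \<beta>"
  unfolding window_errors_vanish_def
proof (intro allI impI)
  fix \<delta> :: real assume \<delta>: "\<delta> > 0"
  have [measurable]: "g \<in> borel_measurable borel" using g by auto
  define q where "q l x = (LINT s|lborel. g s * cis ((x - \<beta> * of_int l) * s))" for l :: int and x
  have qm[measurable]: "q l \<in> borel_measurable borel" for l unfolding q_def[abs_def] by measurable
  \<comment> \<open>The tail enters through (2 * m l)^2, so \<delta> / 8 becomes \<delta> / 2. The
    number \<open>\<eta>\<close> is chosen so that the indices in \<open>L0\<close> account for the
    other half; its summand 1 covers the empty set.\<close>
  obtain L0 where L0: "finite L0" "\<And>L. finite L \<Longrightarrow> L \<inter> L0 = {} \<Longrightarrow> (\<Sum>l\<in>L. (m l)\<^sup>2) \<le> \<delta> / 8"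
    using summable_on_finite_tail[OF sm, of "\<delta> / 8"] \<delta> by (auto simp del: sum_power2_eq_zero_iff)
  define \<eta> where "\<eta> = sqrt (\<delta> / (8 * (real (card L0) + 1)))"
  have \<eta>: "\<eta> > 0" using \<delta> by (simp add: \<eta>_def add_nonneg_pos)
  have \<eta>2: "real (card L0) * (4 * \<eta>\<^sup>2) \<le> \<delta> / 2"
  proof -
    have "real (card L0) * (4 * \<eta>\<^sup>2) \<le> (real (card L0) + 1) * (4 * \<eta>\<^sup>2)" by (intro mult_right_mono) auto
    also have "\<dots> = \<delta> / 2" using \<delta> by (simp add: \<eta>_def add_nonneg_pos field_simps)
    finally show ?thesis .
  qed
  obtain \<epsilon>0 where e0: "\<epsilon>0 > 0" "\<And>\<epsilon>. 0 \<le> \<epsilon> \<Longrightarrow> \<epsilon> < \<epsilon>0 \<Longrightarrow> (LINT s|lborel. cmod (g s) * min 1 (\<epsilon> * \<bar>s\<bar>)) \<le> \<eta>"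
    using integral_min_small[OF g \<eta>] by metis
  have qd: "cmod (q l x - q l 0) \<le> 2 * \<eta>" if x: "0 \<le> x" "x < \<epsilon>0" for l x
    using norm_integral_cis_diff_le[OF g, of "x - \<beta> * of_int l" "0 - \<beta> * of_int l"] e0(2)[OF x] x
    unfolding q_def by simp
  show "\<exists>\<epsilon>0>0. \<forall>\<epsilon>. 0 < \<epsilon> \<and> \<epsilon> < \<epsilon>0 \<longrightarrow> (\<forall>K L :: int set. finite K \<longrightarrow> finite L \<longrightarrow>
     (\<Sum>k\<in>K. \<Sum>l\<in>L. (cmod (window_error g \<alpha> \<beta> \<epsilon> k l))\<^sup>2) \<le> 2 * pi / (\<epsilon> * \<alpha>) * \<delta>)"
  \<comment> \<open>The entry 1 keeps \<epsilon> * y in the range where \<open>m\<close> is a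
    majorant, and 1 / \<alpha> secures \<epsilon> * \<alpha> < 2 * pi.\<close>
  proof (intro exI[of _ "min (min \<epsilon>0 1) (1 / \<alpha>)"] conjI allI impI)
    show "min (min \<epsilon>0 1) (1 / \<alpha>) > 0" using e0 ab by simp
    fix \<epsilon> and K L :: "int set" assume e: "0 < \<epsilon> \<and> \<epsilon> < min (min \<epsilon>0 1) (1 / \<alpha>)" and KL: "finite K" "finite L"
    have "\<epsilon> * \<alpha> < 1" using e ab by (simp add: field_simps)
    then have ea: "\<epsilon> * \<alpha> < 2 * pi" using pi_gt3 by linarith
    define Q where "Q = 2 * pi / (\<epsilon> * \<alpha>)"
    have Q: "Q > 0" using e ab by (simp add: Q_def)
    define v where "v l = (if l \<in> L0 then 4 * \<eta>\<^sup>2 else 4 * (m l)\<^sup>2)" for l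
    have v: "(cmod (q l (\<epsilon> * y) - q l 0))\<^sup>2 \<le> v l" if y: "y \<in> {0..1}" for l y
    proof -
      have "\<epsilon> * y \<le> \<epsilon>" "\<epsilon> < 1" "\<epsilon> < \<epsilon>0" using y e by (auto intro: mult_left_le)
      then have ey: "\<epsilon> * y \<le> 1" "\<epsilon> * y < \<epsilon>0" by linarith+
      have ey0: "0 \<le> \<epsilon> * y" using y e by simp
      have "cmod (q l (\<epsilon> * y) - q l 0) \<le> cmod (q l (\<epsilon> * y)) + cmod (q l 0)" by (rule norm_triangle_ineq4)
      also have "\<dots> \<le> m l + m l" unfolding q_def using ey ey0 by (intro add_mono m) auto
      finally have "cmod (q l (\<epsilon> * y) - q l 0) \<le> 2 * m l" by simp
      moreover have "cmod (q l (\<epsilon> * y) - q l 0) \<le> 2 * \<eta>" using ey ey0 by (intro qd) auto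
      ultimately have "cmod (q l (\<epsilon> * y) - q l 0) \<le> (if l \<in> L0 then 2 * \<eta> else 2 * m l)" by simp
      from power_mono[OF this, of 2] show ?thesis by (simp add: v_def power_mult_distrib split: if_splits)
    qed
    have "(\<Sum>k\<in>K. \<Sum>l\<in>L. (cmod (window_error g \<alpha> \<beta> \<epsilon> k l))\<^sup>2) =
       (\<Sum>l\<in>L. \<Sum>k\<in>K. (cmod (LINT y|lborel. of_real (indicat_real {0..1} y) * (q l (\<epsilon> * y) - q l 0) * cis (\<epsilon> * (\<alpha> * of_int k) * y)))\<^sup>2)"
      by (subst sum.swap) (simp add: window_error_def window_error_fubini[OF g] q_def)
    also have "\<dots> \<le> (\<Sum>l\<in>L. Q * v l)"
      unfolding Q_def using e ab ea KL by (intro sum_mono window_bessel v) auto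
    also have "\<dots> = Q * ((\<Sum>l\<in>L \<inter> L0. v l) + (\<Sum>l\<in>L - L0. v l))"
      using KL by (simp add: sum_distrib_left[symmetric] sum.Int_Diff[of L v L0])
    also have "\<dots> \<le> Q * (\<delta> / 2 + \<delta> / 2)"
    proof (intro mult_left_mono add_mono)
      have "(\<Sum>l\<in>L \<inter> L0. v l) = real (card (L \<inter> L0)) * (4 * \<eta>\<^sup>2)" by (simp add: v_def)
      also have "\<dots> \<le> real (card L0) * (4 * \<eta>\<^sup>2)" using L0 by (intro mult_right_mono) (auto intro: card_mono)
      finally show "(\<Sum>l\<in>L \<inter> L0. v l) \<le> \<delta> / 2" using \<eta>2 by linarith
      have "(\<Sum>l\<in>L - L0. v l) = 4 * (\<Sum>l\<in>L - L0. (m l)\<^sup>2)" by (simp add: v_def sum_distrib_left)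
      also have "\<dots> \<le> 4 * (\<delta> / 8)" using KL by (intro mult_left_mono L0) auto
      finally show "(\<Sum>l\<in>L - L0. v l) \<le> \<delta> / 2" by simp
    qed (use Q in auto)
    finally show "(\<Sum>k\<in>K. \<Sum>l\<in>L. (cmod (window_error g \<alpha> \<beta> \<epsilon> k l))\<^sup>2) \<le> 2 * pi / (\<epsilon> * \<alpha>) * \<delta>"
      by (simp add: Q_def)
  qed
qed

lemma sqrt_sum_norm_triangle:
  fixes x y :: "'i \<Rightarrow> 'a::real_normed_vector"
  shows "sqrt (\<Sum>i\<in>A. (norm (x i + y i))\<^sup>2) \<le> sqrt (\<Sum>i\<in>A. (norm (x i))\<^sup>2) + sqrt (\<Sum>i\<in>A. (norm (y i))\<^sup>2)"
proof -
  have "L2_set (\<lambda>i. norm (x i + y i)) A \<le> L2_set (\<lambda>i. norm (x i) + norm (y i)) A"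
    by (intro L2_set_mono norm_triangle_ineq) auto
  also have "\<dots> \<le> L2_set (\<lambda>i. norm (x i)) A + L2_set (\<lambda>i. norm (y i)) A" by (rule L2_set_triangle_ineq)
  finally show ?thesis by (simp add: L2_set_def)
qed

text \<open>Errors enter through the triangle inequality for l^2 norms, hence as square roots of the
  squared error \<delta>.\<close>

lemma le_of_le_add_sqrt:
  assumes "\<And>\<delta>. \<delta> > 0 \<Longrightarrow> x \<le> y + sqrt \<delta>" shows "x \<le> (y :: real)"
proof (rule field_le_epsilon)
  fix e :: real assume "e > 0"
  then show "x \<le> y + e" using assms[of "e\<^sup>2"] by simp
qed

lemma sum_le_suminf_int_decode:
  fixes F :: "int set" and u :: "int \<Rightarrow> real"
  assumes "finite F" "\<And>n. u n \<ge> 0"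
  shows "ennreal (\<Sum>n\<in>F. u n) \<le> (\<Sum>n. ennreal (u (int_decode n)))"
proof -
  have "ennreal (\<Sum>n\<in>F. u n) = (\<Sum>n\<in>F. ennreal (u n))" using assms by (simp add: sum_ennreal)
  also have "\<dots> = (\<Sum>n\<in>int_encode ` F. ennreal (u (int_decode n)))"
    by (subst sum.reindex) (auto intro: inj_on_subset[OF inj_int_encode])
  also have "\<dots> \<le> (\<Sum>n. ennreal (u (int_decode n)))" using assms by (intro sum_le_suminf) auto
  finally show ?thesis .
qed

section \<open>From the Gabor frame to its fibers\<close>

abbreviation gabor_coef :: "(real \<Rightarrow> complex) \<Rightarrow> real \<Rightarrow> real \<Rightarrow> (real \<Rightarrow> complex) \<Rightarrow> int \<Rightarrow> int \<Rightarrow> complex" where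
  "gabor_coef \<psi> \<alpha> \<beta> f k l \<equiv>
    (LINT t|lborel. f t * cnj (cis (\<beta> * of_int l * (t - \<alpha> * of_int k)) * \<psi> (t - \<alpha> * of_int k)))"

text \<open>The frame property is restated for Borel functions and \<open>lborel\<close>, where
  Fubini and affine substitution apply directly; \<open>gabor_fiber_inequality\<close> instantiates
  it with a Borel representative of the generator.\<close>

locale gabor_bounds =
  fixes \<psi> :: "real \<Rightarrow> complex" and \<alpha> \<beta> A B :: real
  assumes pos: "\<alpha> > 0" "\<beta> > 0" "A > 0" "B > 0"
    and integrable_psi: "integrable lborel \<psi>"
    and frame: "\<And>f. f \<in> borel_measurable borel \<Longrightarrow> integrable lborel (\<lambda>t. (cmod (f t))\<^sup>2) \<Longrightarrow>
      (\<lambda>(k, l). (cmod (gabor_coef \<psi> \<alpha> \<beta> f k l))\<^sup>2)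
         summable_on (UNIV :: (int \<times> int) set) \<and>
      A * (LINT t|lborel. (cmod (f t))\<^sup>2) \<le>
        (\<Sum>\<^sub>\<infinity>(k, l)\<in>(UNIV :: (int \<times> int) set). (cmod (gabor_coef \<psi> \<alpha> \<beta> f k l))\<^sup>2) \<and>
      (\<Sum>\<^sub>\<infinity>(k, l)\<in>(UNIV :: (int \<times> int) set). (cmod (gabor_coef \<psi> \<alpha> \<beta> f k l))\<^sup>2)
        \<le> B * (LINT t|lborel. (cmod (f t))\<^sup>2)"
begin

context
  fixes G :: "real set" and c :: "real \<Rightarrow> complex" and w :: real
  assumes G: "finite G" "\<And>\<mu>. \<mu> \<in> G \<Longrightarrow> \<exists>p::int. \<mu> = w + 2 * pi / \<alpha> * of_int p"
begin

definition trig :: "real \<Rightarrow> complex" where "trig t = (\<Sum>\<mu>\<in>G. c \<mu> * cis (\<mu> * t))"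

text \<open>By \<open>coef_eq\<close> this is the sum of \<open>c \<mu>\<close> times the conjugate
  of the transform of \<psi> at \<mu> - \<beta> * l, that is, the fiber coefficient.\<close>

definition coef :: "int \<Rightarrow> complex" where
  "coef l = (LINT s|lborel. trig s * cnj (\<psi> s) * cis (- (\<beta> * of_int l * s)))"

lemma trig_measurable[measurable]: "trig \<in> borel_measurable borel"
  unfolding trig_def[abs_def] by measurable

lemma norm_trig_le: "cmod (trig t) \<le> (\<Sum>\<mu>\<in>G. cmod (c \<mu>))"
  unfolding trig_def by (rule sum_norm_le) (simp add: norm_mult)

text \<open>All frequencies in \<open>G\<close> agree modulo 2 * pi / \<alpha>, so a shift by
  \<alpha> * k multiplies every term by the same phase.\<close>

lemma trig_shift: "trig (t + \<alpha> * of_int k) = cis (w * (\<alpha> * of_int k)) * trig t"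
proof -
  have "cis (\<mu> * (t + \<alpha> * of_int k)) = cis (w * (\<alpha> * of_int k)) * cis (\<mu> * t)" if mu: "\<mu> \<in> G" for \<mu>
  proof -
    obtain p :: int where p: "\<mu> = w + 2 * pi / \<alpha> * of_int p" using G(2)[OF mu] by blast
    have "\<mu> * (\<alpha> * of_int k) = w * (\<alpha> * of_int k) + 2 * pi * of_int (p * k)"
      using pos unfolding p by (simp add: distrib_right)
    then have "\<mu> * (t + \<alpha> * of_int k) = w * (\<alpha> * of_int k) + \<mu> * t + 2 * pi * of_int (p * k)"
      by (simp add: distrib_left)
    then show ?thesis by (metis cis_mult cis_multiple_2pi Ints_of_int mult.right_neutral)
  qed
  then show ?thesis by (simp add: trig_def sum_distrib_left mult_ac)
qed

lemma integrable_trig_psi: "integrable lborel (\<lambda>s. trig s * cnj (\<psi> s))"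
proof (rule Bochner_Integration.integrable_bound)
  have [measurable]: "\<psi> \<in> borel_measurable borel" using integrable_psi by auto
  show "(\<lambda>s. trig s * cnj (\<psi> s)) \<in> borel_measurable lborel" by simp
  show "integrable lborel (\<lambda>s. (\<Sum>\<mu>\<in>G. cmod (c \<mu>)) * cmod (\<psi> s))" using integrable_psi by simp
  show "AE s in lborel. norm (trig s * cnj (\<psi> s)) \<le> norm ((\<Sum>\<mu>\<in>G. cmod (c \<mu>)) * cmod (\<psi> s))"
    by (auto simp: norm_mult sum_nonneg abs_of_nonneg intro!: mult_right_mono norm_trig_le)
qed

text \<open>The modulus of \<open>trig\<close> is \<alpha>-periodic. Folding the integral to one
  period separates its energy, known from Parseval, from sums of window samples, which are bounded
  above and below uniformly in the phase.\<close>

lemma trig_window_norm: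
  assumes e: "\<epsilon> > 0" "2 * (\<epsilon> * \<alpha>) \<le> 1"
  shows "integrable lborel (\<lambda>t. (cmod (trig t * window \<epsilon> t))\<^sup>2)"
    and "1 / (16 * (\<epsilon> * \<alpha>)) * (\<alpha> * (\<Sum>\<mu>\<in>G. (cmod (c \<mu>))\<^sup>2)) \<le> (LINT t|lborel. (cmod (trig t * window \<epsilon> t))\<^sup>2)"
    and "(LINT t|lborel. (cmod (trig t * window \<epsilon> t))\<^sup>2) \<le> 2 * pi / (\<epsilon> * \<alpha>) * (\<alpha> * (\<Sum>\<mu>\<in>G. (cmod (c \<mu>))\<^sup>2))"
proof -
  define N where "N = \<alpha> * (\<Sum>\<mu>\<in>G. (cmod (c \<mu>))\<^sup>2)"
  define q where "q = \<epsilon> * \<alpha>"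
  have q: "q > 0" using e pos by (simp add: q_def)
  have N0: "N \<ge> 0" using pos by (auto simp: N_def intro!: mult_nonneg_nonneg sum_nonneg)
  have ea: "\<epsilon> * \<alpha> < 2 * pi" using e pi_gt3 by linarith
  define W where "W s = (\<Sum>n. ennreal ((cmod (window \<epsilon> (s + \<alpha> * of_int (int_decode n))))\<^sup>2))" for s
  have [measurable]: "W \<in> borel_measurable borel" unfolding W_def[abs_def] by measurable
  have eq: "(\<integral>\<^sup>+t. ennreal ((cmod (trig t * window \<epsilon> t))\<^sup>2) \<partial>lborel) = (\<integral>\<^sup>+s. W s * (ennreal ((cmod (trig s))\<^sup>2) * indicator {0..<\<alpha>} s) \<partial>lborel)"
  proof (subst nn_integral_periodization[of _ \<alpha>])
    have "ennreal ((cmod (trig (s + \<alpha> * of_int n) * window \<epsilon> (s + \<alpha> * of_int n)))\<^sup>2) =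
        ennreal ((cmod (window \<epsilon> (s + \<alpha> * of_int n)))\<^sup>2) * ennreal ((cmod (trig s))\<^sup>2)" for s n
      by (simp add: trig_shift norm_mult power_mult_distrib ennreal_mult mult.commute)
    then show "(\<integral>\<^sup>+s. (\<Sum>n. ennreal ((cmod (trig (s + \<alpha> * of_int (int_decode n)) * window \<epsilon> (s + \<alpha> * of_int (int_decode n))))\<^sup>2)) * indicator {0..<\<alpha>} s \<partial>lborel) =
        (\<integral>\<^sup>+s. W s * (ennreal ((cmod (trig s))\<^sup>2) * indicator {0..<\<alpha>} s) \<partial>lborel)"
      by (simp only: W_def ennreal_suminf_multc mult.assoc)
  qed (use pos in auto)
  have per: "(\<integral>\<^sup>+s. ennreal ((cmod (trig s))\<^sup>2) * indicator {0..<\<alpha>} s \<partial>lborel) = ennreal N"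
    unfolding trig_def N_def
  proof (rule trig_poly_norm_period[OF pos(1) G(1)])
    fix \<mu> \<nu> assume "\<mu> \<in> G" "\<nu> \<in> G" "\<mu> \<noteq> \<nu>"
    moreover from this obtain p q :: int where "\<mu> = w + 2 * pi / \<alpha> * of_int p" "\<nu> = w + 2 * pi / \<alpha> * of_int q"
      using G(2) by meson
    ultimately show "\<exists>p::int. p \<noteq> 0 \<and> \<mu> - \<nu> = 2 * pi / \<alpha> * of_int p"
      by (intro exI[of _ "p - q"]) (auto simp: right_diff_distrib)
  qed
  have "(\<integral>\<^sup>+t. ennreal ((cmod (trig t * window \<epsilon> t))\<^sup>2) \<partial>lborel) \<le> (\<integral>\<^sup>+s. ennreal (2 * pi / q) * (ennreal ((cmod (trig s))\<^sup>2) * indicator {0..<\<alpha>} s) \<partial>lborel)"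
    unfolding eq W_def q_def
    using e pos ea by (intro nn_integral_mono mult_right_mono suminf_int_decode_le sum_window_sq_le) auto
  also have "\<dots> = ennreal (2 * pi / q * N)"
    using q by (subst nn_integral_cmult) (auto simp: per ennreal_mult'[symmetric])
  finally have up: "(\<integral>\<^sup>+t. ennreal ((cmod (trig t * window \<epsilon> t))\<^sup>2) \<partial>lborel) \<le> ennreal (2 * pi / q * N)" .
  show i: "integrable lborel (\<lambda>t. (cmod (trig t * window \<epsilon> t))\<^sup>2)"
    by (rule integrableI_nonneg) (use up in \<open>auto intro: le_less_trans\<close>)
  have I: "(\<integral>\<^sup>+t. ennreal ((cmod (trig t * window \<epsilon> t))\<^sup>2) \<partial>lborel) = ennreal (LINT t|lborel. (cmod (trig t * window \<epsilon> t))\<^sup>2)"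
    by (rule nn_integral_eq_integral[OF i]) auto
  show "(LINT t|lborel. (cmod (trig t * window \<epsilon> t))\<^sup>2) \<le> 2 * pi / (\<epsilon> * \<alpha>) * (\<alpha> * (\<Sum>\<mu>\<in>G. (cmod (c \<mu>))\<^sup>2))"
    using up q N0 unfolding I N_def[symmetric] q_def[symmetric] by (subst (asm) ennreal_le_iff) auto
  have "ennreal (1 / (16 * q) * N) = (\<integral>\<^sup>+s. ennreal (1 / (16 * q)) * (ennreal ((cmod (trig s))\<^sup>2) * indicator {0..<\<alpha>} s) \<partial>lborel)"
    using q by (subst nn_integral_cmult) (auto simp: per ennreal_mult'[symmetric])
  also have "\<dots> \<le> ennreal (LINT t|lborel. (cmod (trig t * window \<epsilon> t))\<^sup>2)"
    unfolding I[symmetric] eq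
  proof (intro nn_integral_mono)
    fix s
    have "ennreal (1 / (16 * q)) \<le> W s" if "0 \<le> s" "s < \<alpha>"
      unfolding W_def q_def using e pos that
      by (intro order_trans[OF ennreal_leI[OF sum_window_sq_ge] sum_le_suminf_int_decode]) auto
    then show "ennreal (1 / (16 * q)) * (ennreal ((cmod (trig s))\<^sup>2) * indicator {0..<\<alpha>} s) \<le> W s * (ennreal ((cmod (trig s))\<^sup>2) * indicator {0..<\<alpha>} s)"
      by (auto simp: indicator_def intro!: mult_right_mono)
  qed
  finally show "1 / (16 * (\<epsilon> * \<alpha>)) * (\<alpha> * (\<Sum>\<mu>\<in>G. (cmod (c \<mu>))\<^sup>2)) \<le> (LINT t|lborel. (cmod (trig t * window \<epsilon> t))\<^sup>2)"
    unfolding N_def[symmetric] q_def[symmetric] by (subst (asm) ennreal_le_iff) auto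
qed

text \<open>The substitution t = s + \<alpha> * k extracts a common phase and leaves the window
  evaluated at s + \<alpha> * k; freezing it at \<alpha> * k gives the product form, and the
  difference is the error.\<close>

lemma gabor_coef_trig_window:
  "gabor_coef \<psi> \<alpha> \<beta> (\<lambda>t. trig t * window \<epsilon> t) k l =
   cis (w * (\<alpha> * of_int k)) * (window \<epsilon> (\<alpha> * of_int k) * coef l +
     window_error (\<lambda>s. trig s * cnj (\<psi> s)) \<alpha> \<beta> \<epsilon> k l)"
proof -
  define g where "g s = trig s * cnj (\<psi> s) * cis (- (\<beta> * of_int l * s))" for s
  have ig: "integrable lborel g"
    unfolding g_def by (rule Bochner_Integration.integrable_bound[OF integrable_trig_psi])
      (use integrable_trig_psi in \<open>auto simp: norm_mult\<close>)
  then have [measurable]: "g \<in> borel_measurable borel" by auto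
  have w1: "cmod (window \<epsilon> t) \<le> 1" for t
  proof -
    have "cmod (window \<epsilon> t) \<le> (LINT y::real|lborel. indicat_real {0..1} y)"
      unfolding window_def
      by (rule order_trans[OF integral_norm_bound]) (simp add: norm_mult)
    then show ?thesis by simp
  qed
  have igw: "integrable lborel (\<lambda>s. g s * window \<epsilon> (s + r))" for r
    by (rule Bochner_Integration.integrable_bound[OF ig]) (auto simp: norm_mult w1 intro!: mult_left_le)
  have "gabor_coef \<psi> \<alpha> \<beta> (\<lambda>t. trig t * window \<epsilon> t) k l =
     (LINT s|lborel. cis (w * (\<alpha> * of_int k)) * (g s * window \<epsilon> (s + \<alpha> * of_int k)))"
    by (subst lborel_integral_real_affine[of 1 _ "\<alpha> * of_int k"])
       (simp_all add: add.commute[of "\<alpha> * _"] trig_shift g_def cis_cnj mult_ac)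
  also have "\<dots> = cis (w * (\<alpha> * of_int k)) * (LINT s|lborel. g s * window \<epsilon> (s + \<alpha> * of_int k))" by simp
  also have "(LINT s|lborel. g s * window \<epsilon> (s + \<alpha> * of_int k)) =
      window \<epsilon> (\<alpha> * of_int k) * coef l + (LINT s|lborel. g s * (window \<epsilon> (s + \<alpha> * of_int k) - window \<epsilon> (\<alpha> * of_int k)))"
  proof -
    have "coef l = integral\<^sup>L lborel g" by (simp add: coef_def g_def[abs_def])
    then show ?thesis using igw[of "\<alpha> * of_int k"] ig by (simp add: right_diff_distrib)
  qed
  finally show ?thesis by (simp add: g_def window_error_def)
qed

text \<open>Both inequalities compare l^2 norms over finite rectangles, where the main term factors
  into window samples and fiber coefficients. Main term and error scale with sqrt Q, so after
  division by sqrt Q the window parameter disappears and \<delta> can tend to 0.\<close>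

lemma fiber_bounds:
  assumes E: "window_errors_vanish (\<lambda>s. trig s * cnj (\<psi> s)) \<alpha> \<beta>"
  shows "(\<lambda>l. (cmod (coef l))\<^sup>2) summable_on UNIV"
    and "A * \<alpha> / (32 * pi) * (\<Sum>\<mu>\<in>G. (cmod (c \<mu>))\<^sup>2) \<le> (\<Sum>\<^sub>\<infinity>l. (cmod (coef l))\<^sup>2)"
    and "(\<Sum>\<^sub>\<infinity>l. (cmod (coef l))\<^sup>2) \<le> 32 * pi * B * \<alpha> * (\<Sum>\<mu>\<in>G. (cmod (c \<mu>))\<^sup>2)"
proof -
  define N where "N = (\<Sum>\<mu>\<in>G. (cmod (c \<mu>))\<^sup>2)"
  have N0: "N \<ge> 0" by (auto simp: N_def intro!: sum_nonneg)
  define err where "err = window_error (\<lambda>s. trig s * cnj (\<psi> s)) \<alpha> \<beta>"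
  define a where "a \<epsilon> k l = window \<epsilon> (\<alpha> * of_int k) * coef l + err \<epsilon> k l" for \<epsilon> k l
  define I where "I \<epsilon> = (LINT t|lborel. (cmod (trig t * window \<epsilon> t))\<^sup>2)" for \<epsilon>
  have small: "\<exists>\<epsilon>>0. 2 * (\<epsilon> * \<alpha>) \<le> 1 \<and> (\<forall>K L. finite K \<longrightarrow> finite L \<longrightarrow>
      (\<Sum>(k, l)\<in>K \<times> L. (cmod (err \<epsilon> k l))\<^sup>2) \<le> 2 * pi / (\<epsilon> * \<alpha>) * \<delta>)" if d: "\<delta> > 0" for \<delta>
  proof -
    obtain \<epsilon>0 where e0: "\<epsilon>0 > 0" "\<And>\<epsilon> K L. 0 < \<epsilon> \<Longrightarrow> \<epsilon> < \<epsilon>0 \<Longrightarrow> finite K \<Longrightarrow> finite L \<Longrightarrow>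
       (\<Sum>k\<in>K. \<Sum>l\<in>L. (cmod (err \<epsilon> k l))\<^sup>2) \<le> 2 * pi / (\<epsilon> * \<alpha>) * \<delta>"
    proof -
      obtain \<epsilon>0 where "\<epsilon>0 > 0" and H: "\<forall>\<epsilon>. 0 < \<epsilon> \<and> \<epsilon> < \<epsilon>0 \<longrightarrow> (\<forall>K L. finite K \<longrightarrow> finite L \<longrightarrow>
         (\<Sum>k\<in>K. \<Sum>l\<in>L. (cmod (err \<epsilon> k l))\<^sup>2) \<le> 2 * pi / (\<epsilon> * \<alpha>) * \<delta>)"
        using E[unfolded window_errors_vanish_def] d unfolding err_def by blast
      show ?thesis by (rule that[OF \<open>\<epsilon>0 > 0\<close>]) (use H in blast)
    qed
    show ?thesis
    \<comment> \<open>Halving \<open>\<epsilon>0\<close> stays strictly below it; the second entry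
      secures the condition of \<open>trig_window_norm\<close>.\<close>
    proof (intro exI[of _ "min (\<epsilon>0 / 2) (1 / (2 * \<alpha>))"] conjI allI impI)
      show "min (\<epsilon>0 / 2) (1 / (2 * \<alpha>)) > 0" using e0 pos by simp
      have "min (\<epsilon>0 / 2) (1 / (2 * \<alpha>)) * \<alpha> \<le> 1 / (2 * \<alpha>) * \<alpha>" using pos by (intro mult_right_mono) auto
      then show "2 * (min (\<epsilon>0 / 2) (1 / (2 * \<alpha>)) * \<alpha>) \<le> 1" using pos by simp
      fix K L :: "int set" assume "finite K" "finite L"
      then show "(\<Sum>(k, l)\<in>K \<times> L. (cmod (err (min (\<epsilon>0 / 2) (1 / (2 * \<alpha>))) k l))\<^sup>2) \<le> 2 * pi / (min (\<epsilon>0 / 2) (1 / (2 * \<alpha>)) * \<alpha>) * \<delta>"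
        unfolding sum.cartesian_product[symmetric] using e0 pos by (intro e0) auto
    qed
  qed
  have fr: "(\<lambda>(k, l). (cmod (a \<epsilon> k l))\<^sup>2) summable_on UNIV \<and> A * I \<epsilon> \<le> (\<Sum>\<^sub>\<infinity>(k, l). (cmod (a \<epsilon> k l))\<^sup>2) \<and>
      (\<Sum>\<^sub>\<infinity>(k, l). (cmod (a \<epsilon> k l))\<^sup>2) \<le> B * I \<epsilon>" if "\<epsilon> > 0" "2 * (\<epsilon> * \<alpha>) \<le> 1" for \<epsilon>
    using frame[OF _ trig_window_norm(1)[OF that]]
    unfolding gabor_coef_trig_window err_def[symmetric] a_def[symmetric] I_def by (simp add: norm_mult)
  have ws: "(\<Sum>(k, l)\<in>K \<times> L. (cmod (window \<epsilon> (\<alpha> * of_int k) * coef l))\<^sup>2) =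
      (\<Sum>k\<in>K. (cmod (window \<epsilon> (\<alpha> * of_int k)))\<^sup>2) * (\<Sum>l\<in>L. (cmod (coef l))\<^sup>2)" for K L \<epsilon>
    by (simp add: norm_mult power_mult_distrib sum_product sum.cartesian_product)
  have up: "(\<Sum>l\<in>L. (cmod (coef l))\<^sup>2) \<le> 32 * pi * B * \<alpha> * N" if L: "finite L" for L
  proof -
    define S where "S = (\<Sum>l\<in>L. (cmod (coef l))\<^sup>2)"
    have S0: "S \<ge> 0" by (auto simp: S_def intro!: sum_nonneg)
    have "sqrt (S / (32 * pi)) \<le> sqrt (B * (\<alpha> * N))"
    proof (rule le_of_le_add_sqrt)
      fix \<delta> :: real assume "\<delta> > 0"
      then obtain \<epsilon> where e: "\<epsilon> > 0" "2 * (\<epsilon> * \<alpha>) \<le> 1" "\<And>K L. finite K \<Longrightarrow> finite L \<Longrightarrow>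
         (\<Sum>(k, l)\<in>K \<times> L. (cmod (err \<epsilon> k l))\<^sup>2) \<le> 2 * pi / (\<epsilon> * \<alpha>) * \<delta>"
        using small[OF \<open>\<delta> > 0\<close>] by blast
      define Q where "Q = 2 * pi / (\<epsilon> * \<alpha>)"
      have Q: "Q > 0" using e pos by (simp add: Q_def)
      \<comment> \<open>\<open>K\<close> consists of the samples at which the window is known to be
        large, so the main term on \<open>K\<close> times \<open>L\<close> has energy at least Q *
        (S / (32 * pi)).\<close>
      define K where "K = {0..<\<lfloor>1 / (2 * (\<epsilon> * \<alpha>))\<rfloor>}"
      have K: "finite K" by (simp add: K_def)
      have "Q * (S / (32 * pi)) = 1 / (16 * (\<epsilon> * \<alpha>)) * S" using e pos by (simp add: Q_def)
      also have "\<dots> \<le> (\<Sum>k\<in>K. (cmod (window \<epsilon> (\<alpha> * of_int k)))\<^sup>2) * S"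
        using sum_window_sq_ge[OF e(1) pos(1) e(2), of 0] pos S0 unfolding K_def by (intro mult_right_mono) auto
      also have "\<dots> = (\<Sum>i\<in>K \<times> L. (cmod (a \<epsilon> (fst i) (snd i) + - err \<epsilon> (fst i) (snd i)))\<^sup>2)"
        unfolding S_def ws[symmetric] by (simp add: a_def case_prod_unfold)
      finally have "sqrt (Q * (S / (32 * pi))) \<le> sqrt (\<Sum>i\<in>K \<times> L. (cmod (a \<epsilon> (fst i) (snd i) + - err \<epsilon> (fst i) (snd i)))\<^sup>2)"
        by (rule real_sqrt_le_mono)
      also have "\<dots> \<le> sqrt (\<Sum>i\<in>K \<times> L. (cmod (a \<epsilon> (fst i) (snd i)))\<^sup>2) + sqrt (\<Sum>i\<in>K \<times> L. (cmod (- err \<epsilon> (fst i) (snd i)))\<^sup>2)"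
        by (rule sqrt_sum_norm_triangle)
      also have "\<dots> \<le> sqrt (Q * (B * (\<alpha> * N))) + sqrt (Q * \<delta>)"
      proof (intro add_mono real_sqrt_le_mono)
        have "(\<Sum>i\<in>K \<times> L. (cmod (a \<epsilon> (fst i) (snd i)))\<^sup>2) \<le> (\<Sum>\<^sub>\<infinity>(k, l). (cmod (a \<epsilon> k l))\<^sup>2)"
          using fr[OF e(1,2)] K L unfolding case_prod_unfold by (intro finite_sum_le_infsum) auto
        also have "\<dots> \<le> B * I \<epsilon>" using fr[OF e(1,2)] by blast
        also have "\<dots> \<le> B * (Q * (\<alpha> * N))"
          using trig_window_norm(3)[OF e(1,2)] pos unfolding I_def Q_def N_def by (intro mult_left_mono) auto
        finally show "(\<Sum>i\<in>K \<times> L. (cmod (a \<epsilon> (fst i) (snd i)))\<^sup>2) \<le> Q * (B * (\<alpha> * N))" by (simp add: mult_ac)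
        show "(\<Sum>i\<in>K \<times> L. (cmod (- err \<epsilon> (fst i) (snd i)))\<^sup>2) \<le> Q * \<delta>"
          using e(3)[OF K L] by (simp add: Q_def case_prod_unfold)
      qed
      finally have "sqrt Q * sqrt (S / (32 * pi)) \<le> sqrt Q * (sqrt (B * (\<alpha> * N)) + sqrt \<delta>)"
        by (simp only: real_sqrt_mult distrib_left)
      then show "sqrt (S / (32 * pi)) \<le> sqrt (B * (\<alpha> * N)) + sqrt \<delta>"
        using Q by (simp only: mult_le_cancel_left_pos real_sqrt_gt_0_iff)
    qed
    then show ?thesis by (simp add: S_def field_simps)
  qed
  show sb: "(\<lambda>l. (cmod (coef l))\<^sup>2) summable_on UNIV"
    using up by (intro nonneg_bdd_above_summable_on bdd_aboveI2) auto
  show "(\<Sum>\<^sub>\<infinity>l. (cmod (coef l))\<^sup>2) \<le> 32 * pi * B * \<alpha> * (\<Sum>\<mu>\<in>G. (cmod (c \<mu>))\<^sup>2)"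
    unfolding N_def[symmetric] by (rule infsum_le_finite_sums[OF sb]) (rule up)
  define S where "S = (\<Sum>\<^sub>\<infinity>l. (cmod (coef l))\<^sup>2)"
  have S0: "S \<ge> 0" by (auto simp: S_def intro!: infsum_nonneg)
  have "sqrt (A * \<alpha> / (32 * pi) * N) \<le> sqrt S"
  proof (rule le_of_le_add_sqrt)
    fix \<delta> :: real assume d: "\<delta> > 0"
    then obtain \<epsilon> where e: "\<epsilon> > 0" "2 * (\<epsilon> * \<alpha>) \<le> 1" "\<And>K L. finite K \<Longrightarrow> finite L \<Longrightarrow>
       (\<Sum>(k, l)\<in>K \<times> L. (cmod (err \<epsilon> k l))\<^sup>2) \<le> 2 * pi / (\<epsilon> * \<alpha>) * \<delta>"
      using small[OF \<open>\<delta> > 0\<close>] by blast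
    have ea: "\<epsilon> * \<alpha> < 2 * pi" using e pi_gt3 by linarith
    define Q where "Q = 2 * pi / (\<epsilon> * \<alpha>)"
    have Q: "Q > 0" using e pos by (simp add: Q_def)
    have fin: "(\<Sum>(k, l)\<in>F. (cmod (a \<epsilon> k l))\<^sup>2) \<le> (sqrt Q * (sqrt S + sqrt \<delta>))\<^sup>2" if F: "finite F" for F
    proof -
      \<comment> \<open>An arbitrary finite index set is enlarged to a rectangle, because only there
        the main term factors and the error bound is available.\<close>
      define K L where "K = fst ` F" and "L = snd ` F"
      have KL: "finite K" "finite L" using F by (auto simp: K_def L_def)
      have FKL: "F \<subseteq> K \<times> L" by (force simp: K_def L_def)
      have "sqrt (\<Sum>i\<in>K \<times> L. (cmod (window \<epsilon> (\<alpha> * of_int (fst i)) * coef (snd i) + err \<epsilon> (fst i) (snd i)))\<^sup>2)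
        \<le> sqrt (\<Sum>i\<in>K \<times> L. (cmod (window \<epsilon> (\<alpha> * of_int (fst i)) * coef (snd i)))\<^sup>2) + sqrt (\<Sum>i\<in>K \<times> L. (cmod (err \<epsilon> (fst i) (snd i)))\<^sup>2)"
        by (rule sqrt_sum_norm_triangle)
      also have "\<dots> \<le> sqrt (Q * S) + sqrt (Q * \<delta>)"
      proof (intro add_mono real_sqrt_le_mono)
        have "(\<Sum>i\<in>K \<times> L. (cmod (window \<epsilon> (\<alpha> * of_int (fst i)) * coef (snd i)))\<^sup>2) = (\<Sum>k\<in>K. (cmod (window \<epsilon> (\<alpha> * of_int k)))\<^sup>2) * (\<Sum>l\<in>L. (cmod (coef l))\<^sup>2)"
          using ws[where K=K and L=L] by (simp add: case_prod_unfold)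
        also have "\<dots> \<le> Q * S"
          unfolding Q_def S_def using sum_window_sq_le[OF e(1) pos(1) ea KL(1), of 0] e pos KL sb
          by (intro mult_mono finite_sum_le_infsum sum_nonneg) auto
        finally show "(\<Sum>i\<in>K \<times> L. (cmod (window \<epsilon> (\<alpha> * of_int (fst i)) * coef (snd i)))\<^sup>2) \<le> Q * S" .
        show "(\<Sum>i\<in>K \<times> L. (cmod (err \<epsilon> (fst i) (snd i)))\<^sup>2) \<le> Q * \<delta>"
          using e(3)[OF KL] by (simp add: Q_def case_prod_unfold)
      qed
      also have "\<dots> = sqrt Q * (sqrt S + sqrt \<delta>)" by (simp only: real_sqrt_mult distrib_left)
      finally have "(\<Sum>(k, l)\<in>K \<times> L. (cmod (a \<epsilon> k l))\<^sup>2) \<le> (sqrt Q * (sqrt S + sqrt \<delta>))\<^sup>2"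
        by (intro sqrt_le_D) (simp add: a_def case_prod_unfold)
      moreover have "(\<Sum>(k, l)\<in>F. (cmod (a \<epsilon> k l))\<^sup>2) \<le> (\<Sum>(k, l)\<in>K \<times> L. (cmod (a \<epsilon> k l))\<^sup>2)"
        using FKL KL by (intro sum_mono2) auto
      ultimately show ?thesis by linarith
    qed
    have "Q * (A * \<alpha> / (32 * pi) * N) = A * (1 / (16 * (\<epsilon> * \<alpha>)) * (\<alpha> * N))" using e pos by (simp add: Q_def)
    also have "\<dots> \<le> A * I \<epsilon>"
      using trig_window_norm(2)[OF e(1,2)] pos unfolding I_def N_def by (intro mult_left_mono) auto
    also have "\<dots> \<le> (\<Sum>\<^sub>\<infinity>(k, l). (cmod (a \<epsilon> k l))\<^sup>2)" using fr[OF e(1,2)] by blast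
    also have "\<dots> \<le> (sqrt Q * (sqrt S + sqrt \<delta>))\<^sup>2"
      using fr[OF e(1,2)] by (intro infsum_le_finite_sums fin) auto
    finally have "sqrt (Q * (A * \<alpha> / (32 * pi) * N)) \<le> sqrt Q * (sqrt S + sqrt \<delta>)"
      using Q S0 d by (intro real_le_lsqrt) auto
    then have "sqrt Q * sqrt (A * \<alpha> / (32 * pi) * N) \<le> sqrt Q * (sqrt S + sqrt \<delta>)"
      by (simp only: real_sqrt_mult)
    then show "sqrt (A * \<alpha> / (32 * pi) * N) \<le> sqrt S + sqrt \<delta>"
      using Q by (simp only: mult_le_cancel_left_pos real_sqrt_gt_0_iff)
  qed
  then show "A * \<alpha> / (32 * pi) * (\<Sum>\<mu>\<in>G. (cmod (c \<mu>))\<^sup>2) \<le> (\<Sum>\<^sub>\<infinity>l. (cmod (coef l))\<^sup>2)"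
    by (simp add: N_def S_def)
qed

end
end

section \<open>Wiener space majorants\<close>

lemma AE_lborel_shift:
  assumes "AE x in lborel. P x" shows "AE x :: real in lborel. P (t + x)"
proof -
  obtain N where N: "{x \<in> space lborel. \<not> P x} \<subseteq> N" "emeasure lborel N = 0" "N \<in> sets lborel"
    using AE_E[OF assms] by auto
  then have "AE x in lborel. x \<notin> N" by (intro AE_not_in) auto
  then have "AE x in lborel. t + 1 * x \<notin> N" using N(3) by (intro AE_borel_affine[where P="\<lambda>x. x \<notin> N"]) auto
  then show ?thesis by (rule AE_mp) (intro AE_I2, use N(1) in auto)
qed

text \<open>The Wiener norm becomes a summable envelope that is constant on unit cells; this is the
  only form in which the Wiener condition is applied.\<close>

lemma wiener_majorant:
  assumes "f \<in> wiener_space"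
  obtains m :: "int \<Rightarrow> real" where "\<And>j. m j \<ge> 0" "m summable_on UNIV" "AE t in lborel. cmod (f t) \<le> m \<lfloor>t\<rfloor>"
proof -
  define v where "v k = esssup (restrict_space lebesgue {0..1}) (\<lambda>x. ereal (cmod (f (x - of_int k))))" for k :: int
  have fin: "(\<Sum>\<^sub>\<infinity>k. e2ennreal (v k)) < \<infinity>" using assms by (simp add: wiener_space_def wiener_norm_def v_def)
  have sumv: "(\<Sum>k\<in>F. e2ennreal (v k)) \<le> (\<Sum>\<^sub>\<infinity>k. e2ennreal (v k))" if "finite F" for F
    using that by (subst nonneg_infsum_complete) (auto intro: SUP_upper)
  have vfin: "e2ennreal (v k) < \<infinity>" for k using sumv[of "{k}"] fin by (auto intro: le_less_trans)
  \<comment> \<open>The term with index k of the norm describes f on the cell that starts at -k,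
    hence the change of sign.\<close>
  define m where "m j = enn2real (e2ennreal (v (- j)))" for j :: int
  have em: "ennreal (m j) = e2ennreal (v (- j))" for j using vfin by (simp add: m_def)
  have "m summable_on UNIV"
  proof (rule nonneg_bdd_above_summable_on)
    have "sum m F \<le> enn2real (\<Sum>\<^sub>\<infinity>k. e2ennreal (v k))" if "finite F" for F
    proof -
      have "ennreal (sum m F) = (\<Sum>j\<in>F. e2ennreal (v (- j)))" by (subst sum_ennreal[symmetric]) (auto simp: em, auto simp: m_def)
      also have "\<dots> = (\<Sum>k\<in>uminus ` F. e2ennreal (v k))" by (subst sum.reindex) (auto simp: inj_on_def)
      also have "\<dots> \<le> (\<Sum>\<^sub>\<infinity>k. e2ennreal (v k))" using that by (intro sumv) auto
      finally have "enn2real (ennreal (sum m F)) \<le> enn2real (\<Sum>\<^sub>\<infinity>k. e2ennreal (v k))" using fin by (intro enn2real_mono) auto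
      then show ?thesis by (simp add: m_def sum_nonneg)
    qed
    then show "bdd_above (sum m ` {F. F \<subseteq> UNIV \<and> finite F})" by (intro bdd_aboveI2) auto
  qed (simp add: m_def)
  moreover have "AE t in lborel. \<lfloor>t\<rfloor> = j \<longrightarrow> cmod (f t) \<le> m j" for j
  proof -
    have "AE x in restrict_space lebesgue {0..1}. ereal (cmod (f (x + of_int j))) \<le> v (- j)"
      using esssup_AE[of "\<lambda>x. ereal (cmod (f (x - of_int (- j))))" "restrict_space lebesgue {0..1}"] by (simp add: v_def)
    then have "AE x in lborel. x \<in> {0..1} \<longrightarrow> ereal (cmod (f (x + of_int j))) \<le> v (- j)"
      by (subst (asm) AE_restrict_space_iff) (auto simp: AE_completion_iff)
    from AE_lborel_shift[OF this, of "- of_int j"]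
    have "AE x in lborel. - of_int j + x \<in> {0..1} \<longrightarrow> ereal (cmod (f x)) \<le> v (- j)" by simp
    then show ?thesis
    proof (rule AE_mp, intro AE_I2 impI)
      fix t assume h: "- of_int j + t \<in> {0..1} \<longrightarrow> ereal (cmod (f t)) \<le> v (- j)" and j: "\<lfloor>t\<rfloor> = j"
      have "- of_int j + t \<in> {0..1}" using j by (auto simp: floor_eq_iff)
      with h have "ereal (cmod (f t)) \<le> v (- j)" by blast
      then have "e2ennreal (ereal (cmod (f t))) \<le> e2ennreal (v (- j))" by (rule e2ennreal_mono)
      then show "cmod (f t) \<le> m j" unfolding em[symmetric] by (simp add: m_def flip: ennreal_def)
    qed
  qed
  then have "AE t in lborel. \<forall>j. \<lfloor>t\<rfloor> = j \<longrightarrow> cmod (f t) \<le> m j" by (subst AE_all_countable) blast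
  then have "AE t in lborel. cmod (f t) \<le> m \<lfloor>t\<rfloor>" by (rule AE_mp) (intro AE_I2, auto)
  ultimately show ?thesis using that[of m] by (simp add: m_def)
qed

text \<open>A half-open unit cell contains fewer than 1 / P + 1 terms of a progression with step P,
  so each value of \<open>m\<close> is counted at most that often.\<close>

lemma sum_floor_progression_le:
  fixes m :: "int \<Rightarrow> real"
  assumes m: "\<And>j. m j \<ge> 0" "m summable_on UNIV" and P: "P > 0" and F: "finite F"
  shows "(\<Sum>n\<in>F. m \<lfloor>x + P * of_int n\<rfloor>) \<le> (1 / P + 1) * infsum m UNIV"
proof -
  define h where "h n = \<lfloor>x + P * of_int n\<rfloor>" for n :: int
  have card: "real (card {n\<in>F. h n = j}) \<le> 1 / P + 1" for j
  proof -
    define a where "a = (of_int j - x) / P"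
    have "{n\<in>F. h n = j} \<subseteq> {\<lceil>a\<rceil>..<\<lceil>a + 1 / P\<rceil>}"
    proof safe
      fix n assume "n \<in> F" "j = h n"
      then have "of_int j \<le> x + P * of_int n" "x + P * of_int n < of_int j + 1" by (auto simp: h_def)
      then have "a \<le> of_int n" "of_int n < a + 1 / P" using P by (auto simp: a_def field_simps)
      then show "n \<in> {\<lceil>a\<rceil>..<\<lceil>a + 1 / P\<rceil>}" by (auto simp: ceiling_le_iff less_ceiling_iff)
    qed
    then have "card {n\<in>F. h n = j} \<le> nat (\<lceil>a + 1 / P\<rceil> - \<lceil>a\<rceil>)" using card_mono[of "{\<lceil>a\<rceil>..<\<lceil>a + 1 / P\<rceil>}"] by simp
    moreover have "\<lceil>a\<rceil> \<le> \<lceil>a + 1 / P\<rceil>" using P by (intro ceiling_mono) simp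
    ultimately have "real (card {n\<in>F. h n = j}) \<le> of_int (\<lceil>a + 1 / P\<rceil> - \<lceil>a\<rceil>)" by linarith
    then show ?thesis by linarith
  qed
  have "(\<Sum>n\<in>F. m (h n)) = (\<Sum>j\<in>h ` F. \<Sum>n\<in>{n\<in>F. h n = j}. m (h n))" by (rule sum.image_gen[OF F])
  also have "\<dots> = (\<Sum>j\<in>h ` F. real (card {n\<in>F. h n = j}) * m j)" by (intro sum.cong) auto
  also have "\<dots> \<le> (\<Sum>j\<in>h ` F. (1 / P + 1) * m j)" by (intro sum_mono mult_right_mono card m)
  also have "\<dots> = (1 / P + 1) * (\<Sum>j\<in>h ` F. m j)" by (simp add: sum_distrib_left)
  also have "\<dots> \<le> (1 / P + 1) * infsum m UNIV" using F P m by (intro mult_left_mono finite_sum_le_infsum) auto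
  finally show ?thesis by (simp add: h_def)
qed

lemma AE_wiener_periodization_le:
  fixes f :: "real \<Rightarrow> complex"
  assumes m: "\<And>j. m j \<ge> 0" "m summable_on UNIV" and f: "AE t in lborel. cmod (f t) \<le> m \<lfloor>t\<rfloor>" and P: "P > 0"
  shows "AE s in lborel. \<forall>F::int set. finite F \<longrightarrow> (\<Sum>n\<in>F. cmod (f (s + P * of_int n))) \<le> (1 / P + 1) * infsum m UNIV"
proof -
  have "AE s in lborel. \<forall>n::int. cmod (f (P * of_int n + s)) \<le> m \<lfloor>P * of_int n + s\<rfloor>"
    by (subst AE_all_countable) (intro allI AE_lborel_shift f)
  then show ?thesis
  proof (rule AE_mp, intro AE_I2 impI allI)
    fix s and F :: "int set" assume *: "\<forall>n::int. cmod (f (P * of_int n + s)) \<le> m \<lfloor>P * of_int n + s\<rfloor>" and F: "finite F"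
    have "(\<Sum>n\<in>F. cmod (f (s + P * of_int n))) \<le> (\<Sum>n\<in>F. m \<lfloor>s + P * of_int n\<rfloor>)"
      using * by (intro sum_mono) (simp add: add.commute)
    also have "\<dots> \<le> (1 / P + 1) * infsum m UNIV" by (rule sum_floor_progression_le[OF m P F])
    finally show "(\<Sum>n\<in>F. cmod (f (s + P * of_int n))) \<le> (1 / P + 1) * infsum m UNIV" .
  qed
qed

lemma AE_lborel_ex_interval:
  assumes "AE x in lborel. P x" "a < (b :: real)"
  obtains x where "a < x" "x < b" "P x"
proof -
  have "\<exists>x. a < x \<and> x < b \<and> P x"
  proof (rule ccontr)
    assume n: "\<not> (\<exists>x. a < x \<and> x < b \<and> P x)"
    have "AE x in lborel. x \<notin> {a<..<b}" using assms(1) by (rule AE_mp) (intro AE_I2, use n in auto)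
    then have "emeasure lborel {a<..<b} = 0" by (subst (asm) AE_iff_measurable[OF _ refl]) (auto simp: Collect_conj_eq[symmetric] greaterThanLessThan_def greaterThan_def lessThan_def Int_def)
    then show False using assms(2) by simp
  qed
  then show ?thesis using that by blast
qed

text \<open>The Wiener condition holds only almost everywhere, whereas a fiber samples the transform
  at prescribed points. Continuity of the transform carries the bound from nearby points of the same
  cell to x.\<close>

lemma fourier_majorant_everywhere:
  fixes \<psi> :: "real \<Rightarrow> complex"
  assumes psi: "integrable lborel \<psi>"
    and m: "AE x in lborel. cmod (LINT t|lborel. \<psi> t * cis (- (x * t))) \<le> m \<lfloor>x\<rfloor>"
  shows "cmod (LINT t|lborel. \<psi> t * cis (- (x * t))) \<le> m \<lfloor>x\<rfloor>"
proof (rule field_le_epsilon)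
  fix e :: real assume "e > 0"
  then have e: "e / 2 > 0" by simp
  have [measurable]: "\<psi> \<in> borel_measurable borel" using psi by auto
  obtain \<epsilon>0 where e0: "\<epsilon>0 > 0" "\<And>\<epsilon>. 0 \<le> \<epsilon> \<Longrightarrow> \<epsilon> < \<epsilon>0 \<Longrightarrow> (LINT s|lborel. cmod (\<psi> s) * min 1 (\<epsilon> * \<bar>s\<bar>)) \<le> e / 2"
    using integral_min_small[OF psi e] by metis
  \<comment> \<open>Cells are half-open to the right, so points slightly to the right of x have the
    same floor.\<close>
  obtain y where y: "x < y" "y < min (x + \<epsilon>0) (of_int \<lfloor>x\<rfloor> + 1)" "cmod (LINT t|lborel. \<psi> t * cis (- (y * t))) \<le> m \<lfloor>y\<rfloor>"
    by (rule AE_lborel_ex_interval[OF m, of x "min (x + \<epsilon>0) (of_int \<lfloor>x\<rfloor> + 1)"]) (use e0 in auto)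
  have fy: "\<lfloor>y\<rfloor> = \<lfloor>x\<rfloor>" using y(1,2) by (intro floor_unique) linarith+
  have "cmod ((LINT t|lborel. \<psi> t * cis (- (x * t))) - (LINT t|lborel. \<psi> t * cis (- (y * t)))) \<le> e"
    using norm_integral_cis_diff_le[OF psi, of "-x" "-y"] e0(2)[of "y - x"] y by simp
  then show "cmod (LINT t|lborel. \<psi> t * cis (- (x * t))) \<le> m \<lfloor>x\<rfloor> + e"
    using y(3) norm_triangle_ineq2[of "LINT t|lborel. \<psi> t * cis (- (x * t))" "LINT t|lborel. \<psi> t * cis (- (y * t))"] unfolding fy by linarith
qed

section \<open>Vanishing window errors under the two hypotheses on the generator\<close>

context gabor_bounds
begin

lemma coef_eq:
  assumes G: "finite G" "\<And>\<mu>. \<mu> \<in> G \<Longrightarrow> \<exists>p::int. \<mu> = w + 2 * pi / \<alpha> * of_int p"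
  shows "(LINT s|lborel. trig G c s * cnj (\<psi> s) * cis (x * s)) = (\<Sum>\<mu>\<in>G. c \<mu> * cnj (LINT t|lborel. \<psi> t * cis (- ((\<mu> + x) * t))))"
proof -
  have [measurable]: "\<psi> \<in> borel_measurable borel" using integrable_psi by auto
  have i: "integrable lborel (\<lambda>s. \<psi> s * cis (- (y * s)))" for y
    by (rule Bochner_Integration.integrable_bound[OF integrable_psi]) (auto simp: norm_mult)
  have "trig G c s * cnj (\<psi> s) * cis (x * s) = (\<Sum>\<mu>\<in>G. c \<mu> * cnj (\<psi> s * cis (- ((\<mu> + x) * s))))" for s
  proof -
    have "cis ((\<mu> + x) * s) = cis (\<mu> * s) * cis (x * s)" for \<mu> by (simp add: cis_mult distrib_right)
    then show ?thesis by (simp add: trig_def[OF assms] sum_distrib_right cis_cnj) (simp add: mult_ac)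
  qed
  then show ?thesis using i by (simp add: integral_cnj flip: complex_cnj_mult)
qed

end

lemma summable_on_sum:
  fixes f :: "'i \<Rightarrow> 'a \<Rightarrow> real"
  assumes "finite G" "\<And>i. i \<in> G \<Longrightarrow> f i summable_on S"
  shows "(\<lambda>x. \<Sum>i\<in>G. f i x) summable_on S"
  using assms by (induction G rule: finite_induct) (auto intro: summable_on_add)

context gabor_bounds
begin

lemma window_errors_vanish_wiener:
  assumes G: "finite G" "\<And>\<mu>. \<mu> \<in> G \<Longrightarrow> \<exists>p::int. \<mu> = w + 2 * pi / \<alpha> * of_int p"
    and m: "\<And>j. m j \<ge> 0" "m summable_on UNIV" "AE t in lborel. cmod (\<psi> t) \<le> m \<lfloor>t\<rfloor>"
  shows "window_errors_vanish (\<lambda>s. trig G c s * cnj (\<psi> s)) \<alpha> \<beta>"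
proof (rule window_errors_vanish_time[OF integrable_trig_psi[OF G] pos(1,2)])
  define K where "K = (\<Sum>\<mu>\<in>G. cmod (c \<mu>))"
  define S where "S = (1 / (2 * pi / \<beta>) + 1) * infsum m UNIV"
  have K: "K \<ge> 0" by (auto simp: K_def intro!: sum_nonneg)
  have S: "S \<ge> 0" using pos m by (auto simp: S_def intro!: mult_nonneg_nonneg infsum_nonneg)
  \<comment> \<open>The summand 1 makes the bound strictly positive, as Bessel's inequality requires
    of its constant.\<close>
  show "K * S + 1 > 0" using K S by (simp add: add_nonneg_pos)
  have "AE s in lborel. \<forall>F::int set. finite F \<longrightarrow> (\<Sum>n\<in>F. cmod (\<psi> (s + 2 * pi / \<beta> * of_int n))) \<le> S"
    unfolding S_def using pos by (intro AE_wiener_periodization_le m) auto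
  then show "AE s in lborel. \<forall>F::int set. finite F \<longrightarrow> (\<Sum>n\<in>F. cmod (trig G c (s + 2 * pi / \<beta> * of_int n) * cnj (\<psi> (s + 2 * pi / \<beta> * of_int n)))) \<le> K * S + 1"
  proof (rule AE_mp, intro AE_I2 impI allI)
    fix s and F :: "int set"
    assume *: "\<forall>F::int set. finite F \<longrightarrow> (\<Sum>n\<in>F. cmod (\<psi> (s + 2 * pi / \<beta> * of_int n))) \<le> S" and F: "finite F"
    have "(\<Sum>n\<in>F. cmod (trig G c (s + 2 * pi / \<beta> * of_int n) * cnj (\<psi> (s + 2 * pi / \<beta> * of_int n)))) \<le> (\<Sum>n\<in>F. K * cmod (\<psi> (s + 2 * pi / \<beta> * of_int n)))"
      unfolding norm_mult complex_mod_cnj K_def by (intro sum_mono mult_right_mono norm_trig_le[OF G]) auto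
    also have "\<dots> = K * (\<Sum>n\<in>F. cmod (\<psi> (s + 2 * pi / \<beta> * of_int n)))" by (simp add: sum_distrib_left)
    also have "\<dots> \<le> K * S" using * F K by (intro mult_left_mono) auto
    finally show "(\<Sum>n\<in>F. cmod (trig G c (s + 2 * pi / \<beta> * of_int n) * cnj (\<psi> (s + 2 * pi / \<beta> * of_int n)))) \<le> K * S + 1" by simp
  qed
qed

lemma window_errors_vanish_fourier_wiener:
  assumes G: "finite G" "\<And>\<mu>. \<mu> \<in> G \<Longrightarrow> \<exists>p::int. \<mu> = w + 2 * pi / \<alpha> * of_int p"
    and m: "\<And>j. m j \<ge> 0" "m summable_on UNIV" "AE x in lborel. cmod (LINT t|lborel. \<psi> t * cis (- (x * t))) \<le> m \<lfloor>x\<rfloor>"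
  shows "window_errors_vanish (\<lambda>s. trig G c s * cnj (\<psi> s)) \<alpha> \<beta>"
proof (rule window_errors_vanish_frequency[OF integrable_trig_psi[OF G] pos(1,2)])
  \<comment> \<open>While x runs through [0,1], the argument stays in the cell belonging to x = 0 or
    in the one belonging to x = 1; two values of \<open>m\<close> cover both cases.\<close>
  define M where "M l = (\<Sum>\<mu>\<in>G. cmod (c \<mu>) * (m \<lfloor>\<mu> - \<beta> * of_int l\<rfloor> + m \<lfloor>\<mu> + 1 - \<beta> * of_int l\<rfloor>))" for l :: int
  have sm: "(\<lambda>l::int. m \<lfloor>y - \<beta> * of_int l\<rfloor>) summable_on UNIV" for y
  proof (rule nonneg_bdd_above_summable_on)
    have "(\<Sum>l\<in>F. m \<lfloor>y - \<beta> * of_int l\<rfloor>) \<le> (1 / \<beta> + 1) * infsum m UNIV" if "finite F" for F :: "int set"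
    proof -
      have "(\<Sum>l\<in>F. m \<lfloor>y - \<beta> * of_int l\<rfloor>) = (\<Sum>l\<in>uminus ` F. m \<lfloor>y + \<beta> * of_int l\<rfloor>)"
        by (subst sum.reindex) (auto simp: inj_on_def)
      also have "\<dots> \<le> (1 / \<beta> + 1) * infsum m UNIV" using that pos by (intro sum_floor_progression_le m) auto
      finally show ?thesis .
    qed
    then show "bdd_above (sum (\<lambda>l. m \<lfloor>y - \<beta> * of_int l\<rfloor>) ` {F. F \<subseteq> UNIV \<and> finite F})" by (intro bdd_aboveI2) auto
  qed (rule m)
  have Ms: "M summable_on UNIV"
    unfolding M_def by (intro summable_on_sum summable_on_cmult_right summable_on_add sm G(1))
  have M0: "M l \<ge> 0" for l unfolding M_def by (intro sum_nonneg mult_nonneg_nonneg add_nonneg_nonneg m) auto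
  have Mle: "M l \<le> infsum M UNIV" for l using finite_sum_le_infsum[OF Ms, of "{l}"] M0 by simp
  show "(\<lambda>l. (M l)\<^sup>2) summable_on UNIV"
  proof (rule summable_on_comparison_test)
    show "(\<lambda>l. infsum M UNIV * M l) summable_on UNIV" by (intro summable_on_cmult_right Ms)
    show "(M l)\<^sup>2 \<le> infsum M UNIV * M l" for l using Mle M0 by (simp add: power2_eq_square mult_right_mono)
  qed auto
  fix x :: real and l :: int assume x: "0 \<le> x" "x \<le> 1"
  have "cmod (LINT s|lborel. trig G c s * cnj (\<psi> s) * cis ((x - \<beta> * of_int l) * s)) \<le>
      (\<Sum>\<mu>\<in>G. cmod (c \<mu> * cnj (LINT t|lborel. \<psi> t * cis (- ((\<mu> + (x - \<beta> * of_int l)) * t)))))"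
    by (subst coef_eq[OF G]) (assumption, rule norm_sum)
  also have "\<dots> \<le> M l"
    unfolding M_def norm_mult complex_mod_cnj
  proof (intro sum_mono mult_left_mono)
    fix \<mu>
    have "cmod (LINT t|lborel. \<psi> t * cis (- ((\<mu> + (x - \<beta> * of_int l)) * t))) \<le> m \<lfloor>\<mu> + (x - \<beta> * of_int l)\<rfloor>"
      by (rule fourier_majorant_everywhere[OF integrable_psi m(3)])
    moreover have "\<lfloor>\<mu> + (x - \<beta> * of_int l)\<rfloor> = \<lfloor>\<mu> - \<beta> * of_int l\<rfloor> \<or> \<lfloor>\<mu> + (x - \<beta> * of_int l)\<rfloor> = \<lfloor>\<mu> + 1 - \<beta> * of_int l\<rfloor>"
      using x by linarith
    ultimately show "cmod (LINT t|lborel. \<psi> t * cis (- ((\<mu> + (x - \<beta> * of_int l)) * t))) \<le> m \<lfloor>\<mu> - \<beta> * of_int l\<rfloor> + m \<lfloor>\<mu> + 1 - \<beta> * of_int l\<rfloor>"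
      using m(1)[of "\<lfloor>\<mu> - \<beta> * of_int l\<rfloor>"] m(1)[of "\<lfloor>\<mu> + 1 - \<beta> * of_int l\<rfloor>"] by auto
  qed auto
  finally show "cmod (LINT s|lborel. trig G c s * cnj (\<psi> s) * cis ((x - \<beta> * of_int l) * s)) \<le> M l" .
qed

end

section \<open>From Lebesgue measurable functions to Borel representatives\<close>

lemma lebesgue_borel_representative:
  fixes f :: "real \<Rightarrow> complex"
  assumes f: "f \<in> borel_measurable lebesgue"
  obtains g where "g \<in> borel_measurable borel" "AE t in lborel. f t = g t"
proof -
  have "(\<lambda>t. Re (f t)) \<in> borel_measurable lebesgue" "(\<lambda>t. Im (f t)) \<in> borel_measurable lebesgue"
    using f by measurable
  from this[THEN completion_ex_borel_measurable_real] obtain u v where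
    [measurable]: "u \<in> borel_measurable borel" "v \<in> borel_measurable borel" and
    uv: "AE t in lborel. Re (f t) = u t" "AE t in lborel. Im (f t) = v t" by auto
  show ?thesis
  proof (rule that[of "\<lambda>t. of_real (u t) + \<i> * of_real (v t)"])
    show "AE t in lborel. f t = of_real (u t) + \<i> * of_real (v t)"
      using uv by eventually_elim (simp add: complex_eq_iff)
  qed measurable
qed

lemma integral_lebesgue_eq_lborel:
  fixes f g :: "real \<Rightarrow> complex"
  assumes "f \<in> borel_measurable lebesgue" "g \<in> borel_measurable borel" "AE t in lborel. f t = g t"
  shows "(LINT t|lebesgue. f t) = (LINT t|lborel. g t)"
proof -
  have "(LINT t|lebesgue. f t) = (LINT t|lebesgue. g t)"
    using assms by (intro integral_cong_AE) (auto intro: AE_completion measurable_completion)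
  also have "\<dots> = (LINT t|lborel. g t)" using assms by (intro integral_completion) auto
  finally show ?thesis .
qed

text \<open>This is the form in which the L^2 hypothesis reaches \<open>ap2\<close>: the constants
  are chosen before \<open>G\<close>, \<open>c\<close> and \<open>w\<close>, so one pair of bounds
  serves all fibers.\<close>

lemma gabor_fiber_inequality:
  assumes ab: "\<alpha> > 0" "\<beta> > 0"
    and psi: "\<psi> \<in> wiener_space \<or> (integrable lebesgue \<psi> \<and> fourier_transform \<psi> \<in> wiener_space)"
    and fr: "gabor_frame \<psi> \<alpha> \<beta>"
  obtains A B where "A > 0" "B > 0"
    "\<And>G c w. finite G \<Longrightarrow> (\<And>\<mu>. \<mu> \<in> G \<Longrightarrow> \<exists>p::int. \<mu> = w + 2 * pi / \<alpha> * of_int p) \<Longrightarrow>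
      (\<lambda>l::int. (cmod (\<Sum>\<mu>\<in>G. c \<mu> * cnj (fourier_transform \<psi> (\<mu> - \<beta> * of_int l))))\<^sup>2) summable_on UNIV \<and>
      A * (\<Sum>\<mu>\<in>G. (cmod (c \<mu>))\<^sup>2) \<le> (\<Sum>\<^sub>\<infinity>l::int. (cmod (\<Sum>\<mu>\<in>G. c \<mu> * cnj (fourier_transform \<psi> (\<mu> - \<beta> * of_int l))))\<^sup>2) \<and>
      (\<Sum>\<^sub>\<infinity>l::int. (cmod (\<Sum>\<mu>\<in>G. c \<mu> * cnj (fourier_transform \<psi> (\<mu> - \<beta> * of_int l))))\<^sup>2) \<le> B * (\<Sum>\<mu>\<in>G. (cmod (c \<mu>))\<^sup>2)"
proof -
  have "\<psi> \<in> borel_measurable lebesgue" using psi by (auto simp: wiener_space_def Linf_space_def)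
  note psim[measurable] = this
  obtain \<phi> where phim[measurable]: "\<phi> \<in> borel_measurable borel" and eq: "AE t in lborel. \<psi> t = \<phi> t"
    by (rule lebesgue_borel_representative[OF psim])
  have expm: "(\<lambda>t. exp (\<i> * of_real (x * t))) \<in> borel_measurable lebesgue" for x :: real
    by (intro measurable_completion) measurable
  have ft: "fourier_transform \<psi> x = (LINT t|lborel. \<phi> t * cis (- (x * t)))" for x
    unfolding fourier_transform_def
  proof (rule integral_lebesgue_eq_lborel)
    show "(\<lambda>t. \<psi> t * exp (- (\<i> * of_real (x * t)))) \<in> borel_measurable lebesgue"
      using borel_measurable_times[OF psim expm[of "-x"]] by simp
    show "AE t in lborel. \<psi> t * exp (- (\<i> * of_real (x * t))) = \<phi> t * cis (- (x * t))"
      using eq by eventually_elim (simp add: cis_conv_exp)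
  qed measurable
  obtain A B where AB: "A > 0" "B > 0" and
    mem: "\<And>k l :: int. translation (\<alpha> * of_int k) (modulation (\<beta> * of_int l) \<psi>) \<in> L2_space" and
    H: "\<And>f. f \<in> L2_space \<Longrightarrow>
        (\<lambda>(k, l). (cmod (L2_inner f (translation (\<alpha> * of_int k) (modulation (\<beta> * of_int l) \<psi>))))\<^sup>2) summable_on (UNIV :: (int \<times> int) set) \<and>
        A * Re (L2_inner f f) \<le> (\<Sum>\<^sub>\<infinity>(k, l)\<in>(UNIV :: (int \<times> int) set). (cmod (L2_inner f (translation (\<alpha> * of_int k) (modulation (\<beta> * of_int l) \<psi>))))\<^sup>2) \<and>
        (\<Sum>\<^sub>\<infinity>(k, l)\<in>(UNIV :: (int \<times> int) set). (cmod (L2_inner f (translation (\<alpha> * of_int k) (modulation (\<beta> * of_int l) \<psi>))))\<^sup>2) \<le> B * Re (L2_inner f f)"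
    using fr unfolding gabor_frame_def hilbert_frame_def case_prod_unfold by fastforce
  have L2i: "L2_inner f (translation (\<alpha> * of_int k) (modulation (\<beta> * of_int l) \<psi>)) =
      gabor_coef \<phi> \<alpha> \<beta> f k l"
    if [measurable]: "f \<in> borel_measurable borel" for f and k l :: int
    unfolding L2_inner_def
  proof (rule integral_lebesgue_eq_lborel)
    have "translation (\<alpha> * of_int k) (modulation (\<beta> * of_int l) \<psi>) \<in> borel_measurable lebesgue"
      using mem by (simp add: L2_space_def)
    from borel_measurable_times[OF measurable_completion[of f lborel borel] measurable_compose[OF this borel_measurable_cnj]]
    show "(\<lambda>t. f t * cnj (translation (\<alpha> * of_int k) (modulation (\<beta> * of_int l) \<psi>) t)) \<in> borel_measurable lebesgue" by simp
    show "AE t in lborel. f t * cnj (translation (\<alpha> * of_int k) (modulation (\<beta> * of_int l) \<psi>) t) =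
        f t * cnj (cis (\<beta> * of_int l * (t - \<alpha> * of_int k)) * \<phi> (t - \<alpha> * of_int k))"
      using AE_lborel_shift[OF eq, of "- (\<alpha> * of_int k)"]
      by eventually_elim (simp add: translation_def modulation_def cis_conv_exp)
  qed measurable
  have L2n: "f \<in> L2_space" "Re (L2_inner f f) = (LINT t|lborel. (cmod (f t))\<^sup>2)"
    if [measurable]: "f \<in> borel_measurable borel" and i: "integrable lborel (\<lambda>t. (cmod (f t))\<^sup>2)" for f
  proof -
    have "integrable lebesgue (\<lambda>t. (cmod (f t))\<^sup>2)" using i by (subst integrable_completion) measurable
    then show "f \<in> L2_space" by (auto simp: L2_space_def intro: measurable_completion)
    have "L2_inner f f = (LINT t|lborel. of_real ((cmod (f t))\<^sup>2))"
      unfolding L2_inner_def complex_norm_square by (rule integral_lebesgue_eq_lborel) (auto intro!: measurable_completion)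
    then show "Re (L2_inner f f) = (LINT t|lborel. (cmod (f t))\<^sup>2)" by (simp flip: of_real_power)
  qed
  have wm: "\<exists>m :: int \<Rightarrow> real. (\<forall>j. m j \<ge> 0) \<and> m summable_on UNIV \<and> (AE t in lborel. cmod (\<phi> t) \<le> m \<lfloor>t\<rfloor>)" if w: "\<psi> \<in> wiener_space"
  proof -
    obtain m :: "int \<Rightarrow> real" where m: "\<And>j. m j \<ge> 0" "m summable_on UNIV" "AE t in lborel. cmod (\<psi> t) \<le> m \<lfloor>t\<rfloor>"
      using wiener_majorant[OF w] by metis
    have "AE t in lborel. cmod (\<phi> t) \<le> m \<lfloor>t\<rfloor>" using m(3) eq by eventually_elim simp
    then show ?thesis using m by blast
  qed
  have phi: "integrable lborel \<phi>"
    using psi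
  proof
    assume "\<psi> \<in> wiener_space"
    then obtain m :: "int \<Rightarrow> real" where m: "\<And>j. m j \<ge> 0" "m summable_on UNIV" "AE t in lborel. cmod (\<phi> t) \<le> m \<lfloor>t\<rfloor>"
      using wm by blast
    \<comment> \<open>W is contained in L^1, because the periodization with period 1 is
      bounded.\<close>
    have "integrable lborel (\<lambda>t. cmod (\<phi> t))"
      by (rule integrable_of_periodization_bounded[OF _ zero_less_one norm_ge_zero AE_wiener_periodization_le[OF m zero_less_one]]) measurable
    then show ?thesis by (subst (asm) integrable_norm_iff) auto
  next
    assume "integrable lebesgue \<psi> \<and> fourier_transform \<psi> \<in> wiener_space"
    then have "integrable lebesgue \<phi>"
      by (subst integrable_cong_AE[where g=\<psi>]) (use eq in \<open>auto intro: measurable_completion AE_completion elim: eventually_mono\<close>)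
    then show ?thesis by (subst (asm) integrable_completion) auto
  qed
  interpret gabor_bounds \<phi> \<alpha> \<beta> A B
  proof unfold_locales
    fix f :: "real \<Rightarrow> complex" assume f: "f \<in> borel_measurable borel" "integrable lborel (\<lambda>t. (cmod (f t))\<^sup>2)"
    show "(\<lambda>(k, l). (cmod (gabor_coef \<phi> \<alpha> \<beta> f k l))\<^sup>2)
         summable_on (UNIV :: (int \<times> int) set) \<and>
      A * (LINT t|lborel. (cmod (f t))\<^sup>2) \<le>
        (\<Sum>\<^sub>\<infinity>(k, l)\<in>(UNIV :: (int \<times> int) set). (cmod (gabor_coef \<phi> \<alpha> \<beta> f k l))\<^sup>2) \<and>
      (\<Sum>\<^sub>\<infinity>(k, l)\<in>(UNIV :: (int \<times> int) set). (cmod (gabor_coef \<phi> \<alpha> \<beta> f k l))\<^sup>2)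
        \<le> B * (LINT t|lborel. (cmod (f t))\<^sup>2)"
      using H[OF L2n(1)[OF f]] by (simp only: L2i[OF f(1)] L2n(2)[OF f])
  qed (use ab AB phi in auto)
  have errs: "window_errors_vanish (\<lambda>s. trig G c s * cnj (\<phi> s)) \<alpha> \<beta>"
    if G: "finite G" "\<And>\<mu>. \<mu> \<in> G \<Longrightarrow> \<exists>p::int. \<mu> = w + 2 * pi / \<alpha> * of_int p" for G c w
    using psi
  proof
    assume "\<psi> \<in> wiener_space"
    then obtain m :: "int \<Rightarrow> real" where m: "\<And>j. m j \<ge> 0" "m summable_on UNIV" "AE t in lborel. cmod (\<phi> t) \<le> m \<lfloor>t\<rfloor>"
      using wm by blast
    show ?thesis by (rule window_errors_vanish_wiener[OF G m])
  next
    assume "integrable lebesgue \<psi> \<and> fourier_transform \<psi> \<in> wiener_space"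
    then obtain m :: "int \<Rightarrow> real" where m: "\<And>j. m j \<ge> 0" "m summable_on UNIV" "AE t in lborel. cmod (fourier_transform \<psi> t) \<le> m \<lfloor>t\<rfloor>"
      using wiener_majorant by metis
    show ?thesis by (rule window_errors_vanish_fourier_wiener[OF G m(1,2) m(3)[unfolded ft]])
  qed
  show ?thesis
  proof (rule that[of "A * \<alpha> / (32 * pi)" "32 * pi * B * \<alpha>"])
    fix G c w assume G: "finite G" "\<And>\<mu>. \<mu> \<in> G \<Longrightarrow> \<exists>p::int. \<mu> = w + 2 * pi / \<alpha> * of_int p"
    have c: "coef G c l = (\<Sum>\<mu>\<in>G. c \<mu> * cnj (fourier_transform \<psi> (\<mu> - \<beta> * of_int l)))" for l
      using coef_eq[OF G, of c "- (\<beta> * of_int l)"] by (simp add: coef_def[OF G] ft)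
    show "(\<lambda>l::int. (cmod (\<Sum>\<mu>\<in>G. c \<mu> * cnj (fourier_transform \<psi> (\<mu> - \<beta> * of_int l))))\<^sup>2) summable_on UNIV \<and>
      A * \<alpha> / (32 * pi) * (\<Sum>\<mu>\<in>G. (cmod (c \<mu>))\<^sup>2) \<le> (\<Sum>\<^sub>\<infinity>l::int. (cmod (\<Sum>\<mu>\<in>G. c \<mu> * cnj (fourier_transform \<psi> (\<mu> - \<beta> * of_int l))))\<^sup>2) \<and>
      (\<Sum>\<^sub>\<infinity>l::int. (cmod (\<Sum>\<mu>\<in>G. c \<mu> * cnj (fourier_transform \<psi> (\<mu> - \<beta> * of_int l))))\<^sup>2) \<le> 32 * pi * B * \<alpha> * (\<Sum>\<mu>\<in>G. (cmod (c \<mu>))\<^sup>2)"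
      using fiber_bounds[OF G errs[OF G, of c]] unfolding c by blast
  qed (use ab AB in auto)
qed

section \<open>Means against exponentials\<close>

lemma bohr_ap_cis: "bohr_ap (\<lambda>t. cis (x * t))"
  using bohr_ap_exp[of x] by (simp add: cis_conv_exp)

text \<open>The integral is not normalized by 2 * T. The exponential depends on the offset s instead
  of r + s, which changes the value only by a unimodular factor.\<close>

definition twisted_mean :: "(real \<Rightarrow> complex) \<Rightarrow> real \<Rightarrow> real \<Rightarrow> real \<Rightarrow> complex" where
  "twisted_mean f x T r = integral {-T..T} (\<lambda>s. f (r + s) * cis (- (x * s)))"

lemma twisted_continuous:
  assumes "continuous_on UNIV f"
  shows "continuous_on A (\<lambda>s. f (r + s) * cis (- (x * s)))"
  unfolding cis_conv_exp by (intro continuous_intros cont_shift assms)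

text \<open>Recentering the two halves of the interval costs only unimodular phases. A bound that is
  uniform in r and proportional to the length therefore survives doubling.\<close>

lemma twisted_mean_double:
  assumes f: "continuous_on UNIV f" and T: "T \<ge> 0"
  shows "twisted_mean f x (2 * T) r = cis (x * T) * twisted_mean f x T (r - T) + cis (- (x * T)) * twisted_mean f x T (r + T)"
proof -
  define g where "g s = f (r + s) * cis (- (x * s))" for s
  have gc: "continuous_on A g" for A unfolding g_def by (rule twisted_continuous[OF f])
  have sh: "integral {a - T..a + T} g = cis (- (x * a)) * twisted_mean f x T (r + a)" for a
  proof -
    have "integral {a - T..a + T} g = integral {-T..T} (\<lambda>s. g (s + a))"
      using integral_shift_Icc_real[of "-T" T g a] by (simp add: o_def add.commute)
    also have "(\<lambda>s. g (s + a)) = (\<lambda>s. cis (- (x * a)) * (f (r + a + s) * cis (- (x * s))))"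
    proof
      fix s
      have "cis (- (x * (s + a))) = cis (- (x * a)) * cis (- (x * s))" by (simp add: cis_mult algebra_simps)
      then show "g (s + a) = cis (- (x * a)) * (f (r + a + s) * cis (- (x * s)))" by (simp add: g_def add_ac)
    qed
    finally show ?thesis by (simp add: twisted_mean_def)
  qed
  have "twisted_mean f x (2 * T) r = integral {- T - T..0} g + integral {0..T + T} g"
    unfolding twisted_mean_def g_def[symmetric]
    using T Henstock_Kurzweil_Integration.integral_combine[of "- T - T" 0 "T + T" g] gc by (simp add: integrable_continuous_real)
  then show ?thesis using sh[of "-T"] sh[of T] by simp
qed

lemma twisted_mean_perturb:
  assumes f: "continuous_on UNIV f" and K: "\<And>t. cmod (f t) \<le> K" and T: "T \<ge> 0"
  shows "cmod (twisted_mean f x T r - twisted_mean f y T r) \<le> K * (2 * (\<bar>x - y\<bar> * T)) * (2 * T)"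
proof -
  have "twisted_mean f x T r - twisted_mean f y T r = integral {-T..T} (\<lambda>s. f (r + s) * cis (- (x * s)) - f (r + s) * cis (- (y * s)))"
    unfolding twisted_mean_def
    by (intro Henstock_Kurzweil_Integration.integral_diff[symmetric] integrable_continuous_real twisted_continuous f)
  also have "cmod \<dots> \<le> K * (2 * (\<bar>x - y\<bar> * T)) * (T - (-T))"
  proof (rule integral_bound)
    fix s assume s: "s \<in> {-T..T}"
    have "cis (- (x * s)) = cis (- (y * s)) * cis ((y - x) * s)" by (simp add: cis_mult algebra_simps)
    then have "f (r + s) * cis (- (x * s)) - f (r + s) * cis (- (y * s)) = f (r + s) * cis (- (y * s)) * (cis ((y - x) * s) - 1)"
      by (simp add: algebra_simps)
    also have "cmod \<dots> = cmod (f (r + s)) * cmod (cis ((y - x) * s) - 1)" by (simp add: norm_mult)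
    also have "\<dots> \<le> K * (2 * (\<bar>x - y\<bar> * T))"
    proof (intro mult_mono K)
      have "cmod (cis ((y - x) * s) - 1) \<le> 2 * \<bar>(y - x) * s\<bar>" using norm_cis_minus_1_le[of "(y - x) * s"] by simp
      also have "\<bar>(y - x) * s\<bar> \<le> \<bar>x - y\<bar> * T" using s by (auto simp: abs_mult abs_minus_commute intro!: mult_left_mono)
      finally show "cmod (cis ((y - x) * s) - 1) \<le> 2 * (\<bar>x - y\<bar> * T)" by simp
    qed (use order_trans[OF norm_ge_zero K] in auto)
    finally show "cmod (f (r + s) * cis (- (x * s)) - f (r + s) * cis (- (y * s))) \<le> K * (2 * (\<bar>x - y\<bar> * T))" .
  qed (use T in \<open>auto intro!: continuous_intros twisted_continuous f\<close>)
  finally show ?thesis by simp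
qed

text \<open>A Riemann-Lebesgue estimate, uniform in r because f is uniformly continuous on the whole
  line. It leaves a compact range of frequencies to be treated.\<close>

lemma twisted_mean_high_frequency:
  assumes f: "bohr_ap f" and \<delta>: "\<delta> > 0"
  obtains R where "R > 0" "\<And>x r. \<bar>x\<bar> \<ge> R \<Longrightarrow> cmod (twisted_mean f x (1/2) r) \<le> \<delta>"
proof -
  have c: "continuous_on A f" for A by (rule bohr_ap_cont[OF f])
  obtain K where K: "K > 0" "\<And>t. cmod (f t) \<le> K" using bohr_ap_bounded[OF f] by blast
  obtain d where d: "d > 0" "\<And>s t. \<bar>s - t\<bar> < d \<Longrightarrow> cmod (f s - f t) < \<delta>" using bohr_ap_uniform[OF f \<delta>] by blast
  \<comment> \<open>The first entry makes half a period at most d / 2, the second bounds the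
    boundary term 2 * K * |h| of the shift by \<delta>.\<close>
  define R where "R = max (2 * pi / d) (2 * K * pi / \<delta>) + 1"
  have "2 * pi / d > 0" using d by simp
  then have R: "R > 0" by (simp add: R_def add_pos_pos)
  show ?thesis
  proof (rule that[OF R])
    fix x r assume x: "\<bar>x\<bar> \<ge> R"
    \<comment> \<open>Shifting by half a period of the exponential changes its sign.\<close>
    define h where "h = pi / x"
    have ah: "\<bar>h\<bar> = pi / \<bar>x\<bar>" by (simp add: h_def abs_divide)
    have x0: "\<bar>x\<bar> > 0" using x R by linarith
    have "2 * pi / d \<le> \<bar>x\<bar>" "2 * K * pi / \<delta> \<le> \<bar>x\<bar>" using x by (auto simp: R_def)
    then have h: "2 * \<bar>h\<bar> \<le> d" "2 * K * \<bar>h\<bar> \<le> \<delta>"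
      using x0 d(1) \<delta> unfolding ah by (auto simp: field_simps)
    have "\<bar>h\<bar> > 0" using x0 by (simp add: ah)
    then have hd: "\<bar>h\<bar> < d" using h(1) by linarith
    define g where "g s = f (r + s) * cis (- (x * s))" for s
    have gc: "continuous_on A g" for A unfolding g_def by (intro twisted_continuous c)
    have 1: "cmod (integral {-(1/2)..1/2} (\<lambda>t. g (h + t)) - integral {-(1/2)..1/2} g) \<le> 2 * K * \<bar>h\<bar>"
      by (rule integral_shift_diff[OF gc]) (auto simp: g_def norm_mult K)
    have "cmod (integral {-(1/2)..1/2} (\<lambda>t. g (h + t) + g t)) \<le> \<delta> * (1/2 - -(1/2))"
    proof (rule integral_bound)
      show "continuous_on {-(1/2)..1/2} (\<lambda>t. g (h + t) + g t)" by (intro continuous_intros cont_shift gc)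
      fix t :: real
      have "x * h = pi" using x0 by (simp add: h_def)
      then have "cis (- (x * (h + t))) = - cis (- (x * t))"
        by (simp add: distrib_left complex_eq_iff cos_diff sin_diff)
      then have "g (h + t) + g t = (f (r + t) - f (r + (h + t))) * cis (- (x * t))" by (simp add: g_def algebra_simps)
      then have "cmod (g (h + t) + g t) = cmod (f (r + t) - f (r + (h + t)))" by (simp add: norm_mult)
      also have "\<dots> < \<delta>" using hd by (intro d) auto
      finally show "cmod (g (h + t) + g t) \<le> \<delta>" by simp
    qed auto
    also have "integral {-(1/2)..1/2} (\<lambda>t. g (h + t) + g t) = integral {-(1/2)..1/2} (\<lambda>t. g (h + t)) + integral {-(1/2)..1/2} g"
      by (intro Henstock_Kurzweil_Integration.integral_add integrable_continuous_real cont_shift gc)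
    finally have 2: "cmod (integral {-(1/2)..1/2} (\<lambda>t. g (h + t)) + integral {-(1/2)..1/2} g) \<le> \<delta>" by simp
    have "2 * integral {-(1/2)..1/2} g = (integral {-(1/2)..1/2} (\<lambda>t. g (h + t)) + integral {-(1/2)..1/2} g) - (integral {-(1/2)..1/2} (\<lambda>t. g (h + t)) - integral {-(1/2)..1/2} g)"
      by simp
    then have "cmod (2 * integral {-(1/2)..1/2} g) \<le> cmod (integral {-(1/2)..1/2} (\<lambda>t. g (h + t)) + integral {-(1/2)..1/2} g) + cmod (integral {-(1/2)..1/2} (\<lambda>t. g (h + t)) - integral {-(1/2)..1/2} g)"
      by (simp only: norm_triangle_ineq4)
    then have "cmod (2 * integral {-(1/2)..1/2} g) \<le> \<delta> + 2 * K * \<bar>h\<bar>" using 1 2 by linarith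
    then show "cmod (twisted_mean f x (1/2) r) \<le> \<delta>"
      using h(2) unfolding twisted_mean_def g_def[symmetric] by (simp add: norm_mult)
  qed
qed

text \<open>At a fixed frequency \<open>ap_mean_aux\<close> makes the estimate uniform in r. The
  errors add up to 1 + 1/8 + 1/8 + 1/4 = 3/2 times \<delta>, which leaves \<delta> / 2 for a later
  perturbation of the frequency.\<close>

lemma twisted_mean_pointwise:
  assumes f: "bohr_ap f" and \<delta>: "\<delta> > 0" and m: "cmod (ap_mean (\<lambda>t. f t * cis (- (x * t)))) \<le> \<delta>"
  obtains n where "\<And>r. cmod (twisted_mean f x (2 ^ n / 2) r) \<le> 3/2 * \<delta> * 2 ^ n"
proof -
  define g where "g t = f t * cis (- (x * t))" for t
  have g: "bohr_ap g" unfolding g_def using bohr_ap_mult[OF f bohr_ap_cis[of "-x"]] by simp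
  have "\<delta> / 8 > 0" using \<delta> by simp
  then obtain C where C: "C \<ge> 0" "\<And>a T. T > 0 \<Longrightarrow> cmod (integral {-T..T} (\<lambda>t. g (a + t)) - integral {-T..T} g) \<le> 2 * T * (\<delta> / 8) + C"
    using ap_mean_aux[OF g] by metis
  have "\<forall>\<^sub>F T in at_top. cmod (integral {-T..T} g / of_real (2 * T) - ap_mean g) < \<delta> / 8"
    using tendstoD[OF ap_mean_tendsto[OF g], of "\<delta> / 8"] \<delta> by (simp add: dist_norm)
  then obtain T0 where T0: "\<And>T. T \<ge> T0 \<Longrightarrow> cmod (integral {-T..T} g / of_real (2 * T) - ap_mean g) < \<delta> / 8"
    unfolding eventually_at_top_linorder by blast
  obtain n where n: "2 ^ n > max (2 * T0) (4 * C / \<delta>)" using real_arch_pow[of 2 "max (2 * T0) (4 * C / \<delta>)"] by auto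
  define T :: real where "T = 2 ^ n / 2"
  have T: "T > 0" "T \<ge> T0" "C \<le> \<delta> / 4 * (2 * T)" using n \<delta> by (auto simp: T_def field_simps)
  have "cmod (twisted_mean f x T r) \<le> 3/2 * \<delta> * (2 * T)" for r
  proof -
    have "cmod (integral {-T..T} g / of_real (2 * T)) \<le> \<delta> + \<delta> / 8"
    proof -
      have "cmod (ap_mean g) \<le> \<delta>" using m by (simp add: g_def[abs_def])
      then show ?thesis using T0[OF T(2)] norm_triangle_ineq2[of "integral {-T..T} g / of_real (2 * T)" "ap_mean g"] by linarith
    qed
    then have "cmod (integral {-T..T} g) \<le> (\<delta> + \<delta> / 8) * (2 * T)"
      using T(1) by (simp add: norm_divide norm_mult pos_divide_le_eq mult_ac)
    then have "cmod (integral {-T..T} (\<lambda>t. g (r + t))) \<le> (\<delta> + \<delta> / 8) * (2 * T) + 2 * T * (\<delta> / 8) + C"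
      using C(2)[OF T(1), of r] norm_triangle_ineq2[of "integral {-T..T} (\<lambda>t. g (r + t))" "integral {-T..T} g"] by linarith
    also have "\<dots> \<le> 3/2 * \<delta> * (2 * T)" using T(3) by (simp add: algebra_simps)
    also have "(\<lambda>t. g (r + t)) = (\<lambda>t. cis (- (x * r)) * (f (r + t) * cis (- (x * t))))"
      unfolding g_def by (intro ext) (simp add: distrib_left cis_mult)
    finally show ?thesis by (simp add: twisted_mean_def norm_mult)
  qed
  then show ?thesis using that[of n] by (simp add: T_def)
qed

text \<open>A compactness argument in the frequency. Near each frequency the bound holds at some
  dyadic level, high frequencies satisfy it at level 0, and doubling preserves it; so the finitely
  many levels of a cover can be raised to a common one.\<close>

lemma twisted_mean_uniform:
  assumes f: "bohr_ap f" and \<delta>: "\<delta> > 0" and m: "\<And>x. cmod (ap_mean (\<lambda>t. f t * cis (- (x * t)))) \<le> \<delta>"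
  obtains N where "\<And>n x r. n \<ge> N \<Longrightarrow> cmod (twisted_mean f x (2 ^ n / 2) r) \<le> 2 * \<delta> * 2 ^ n"
proof -
  have c: "continuous_on A f" for A by (rule bohr_ap_cont[OF f])
  obtain K where K: "K > 0" "\<And>t. cmod (f t) \<le> K" using bohr_ap_bounded[OF f] by blast
  define B where "B x n \<longleftrightarrow> (\<forall>r. cmod (twisted_mean f x (2 ^ n / 2) r) \<le> 2 * \<delta> * 2 ^ n)" for x n
  have step: "B x (Suc n)" if "B x n" for x n
    unfolding B_def
  proof
    fix r
    have "twisted_mean f x (2 ^ Suc n / 2) r = cis (x * (2 ^ n / 2)) * twisted_mean f x (2 ^ n / 2) (r - 2 ^ n / 2) + cis (- (x * (2 ^ n / 2))) * twisted_mean f x (2 ^ n / 2) (r + 2 ^ n / 2)"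
      using twisted_mean_double[OF c, of "2 ^ n / 2"] by simp
    also have "cmod \<dots> \<le> cmod (twisted_mean f x (2 ^ n / 2) (r - 2 ^ n / 2)) + cmod (twisted_mean f x (2 ^ n / 2) (r + 2 ^ n / 2))"
      by (rule order_trans[OF norm_triangle_ineq]) (simp add: norm_mult)
    also have "\<dots> \<le> 2 * \<delta> * 2 ^ n + 2 * \<delta> * 2 ^ n" by (intro add_mono that[unfolded B_def, rule_format])
    finally show "cmod (twisted_mean f x (2 ^ Suc n / 2) r) \<le> 2 * \<delta> * 2 ^ Suc n" by simp
  qed
  have mono: "B x n'" if "B x n" "n \<le> n'" for x n n' using that(2,1) by (induction rule: dec_induct) (auto intro: step)
  have loc: "\<exists>n e. e > 0 \<and> (\<forall>y. \<bar>y - x\<bar> < e \<longrightarrow> B y n)" for x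
  proof -
    obtain n where n: "\<And>r. cmod (twisted_mean f x (2 ^ n / 2) r) \<le> 3/2 * \<delta> * 2 ^ n"
      using twisted_mean_pointwise[OF f \<delta> m] by blast
    \<comment> \<open>With this radius the perturbation of the frequency costs the available
      \<delta> / 2 per unit length.\<close>
    define e where "e = \<delta> / (2 * K * 2 ^ n)"
    have "B y n" if y: "\<bar>y - x\<bar> < e" for y
      unfolding B_def
    proof
      fix r
      have "cmod (twisted_mean f y (2 ^ n / 2) r - twisted_mean f x (2 ^ n / 2) r) \<le> K * (2 * (\<bar>y - x\<bar> * (2 ^ n / 2))) * (2 * (2 ^ n / 2))"
        by (rule twisted_mean_perturb[OF c K(2)]) auto
      also have "\<dots> = K * (\<bar>y - x\<bar> * 2 ^ n) * 2 ^ n" by simp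
      also have "\<dots> \<le> K * (e * 2 ^ n) * 2 ^ n" using y K(1) by (intro mult_right_mono mult_left_mono) auto
      also have "\<dots> = \<delta> / 2 * 2 ^ n" using K(1) by (simp add: e_def)
      finally show "cmod (twisted_mean f y (2 ^ n / 2) r) \<le> 2 * \<delta> * 2 ^ n"
        using n[of r] norm_triangle_ineq2[of "twisted_mean f y (2 ^ n / 2) r" "twisted_mean f x (2 ^ n / 2) r"] by simp
    qed
    moreover have "e > 0" using \<delta> K by (simp add: e_def)
    ultimately show ?thesis by blast
  qed
  then obtain n e where ne: "\<And>x. e x > 0" "\<And>x y. \<bar>y - x\<bar> < e x \<Longrightarrow> B y (n x)" by metis
  obtain R where R: "R > 0" "\<And>x r. \<bar>x\<bar> \<ge> R \<Longrightarrow> cmod (twisted_mean f x (1/2) r) \<le> \<delta>"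
    using twisted_mean_high_frequency[OF f \<delta>] by blast
  have "compact {-R..R}" by simp
  then obtain X where X: "X \<subseteq> {-R..R}" "finite X" "{-R..R} \<subseteq> (\<Union>x\<in>X. ball x (e x))"
    by (rule compactE_image[of _ "{-R..R}" "\<lambda>x. ball x (e x)"]) (use ne(1) in \<open>auto intro!: bexI\<close>)
  show ?thesis
  proof (rule that[of "Max (insert 0 (n ` X))"])
    fix n' x r assume n': "Max (insert 0 (n ` X)) \<le> n'"
    have "B x n'"
    proof (cases "x \<in> {-R..R}")
      case True
      then obtain y where y: "y \<in> X" "\<bar>x - y\<bar> < e y" using X(3) by (force simp: dist_real_def abs_minus_commute)
      have "n y \<le> n'" using n' X(2) y(1) by (intro order_trans[OF Max_ge n']) auto
      then show ?thesis using mono[OF ne(2)[OF y(2)]] by blast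
    next
      case False
      then have "\<bar>x\<bar> \<ge> R" by auto
      then have "B x 0" using R(2)[of x] \<delta> unfolding B_def by (force intro: order_trans)
      then show ?thesis using mono by blast
    qed
    then show "cmod (twisted_mean f x (2 ^ n' / 2) r) \<le> 2 * \<delta> * 2 ^ n'" by (simp add: B_def)
  qed
qed

text \<open>A quantity controlled by translates of f inherits its uniform continuity and its finite
  nets of translates. Both twisted means and autocorrelations are of this kind.\<close>

lemma bohr_ap_translate_bound:
  assumes f: "bohr_ap f" and C: "C \<ge> 0"
    and le: "\<And>y y' \<epsilon>. (\<And>t. cmod (f (t + y) - f (t + y')) \<le> \<epsilon>) \<Longrightarrow> cmod (g y - g y') \<le> \<epsilon> * C"
  shows "bohr_ap g"
proof (rule bohr_apI_net)
  have le': "cmod (g y - g y') \<le> \<epsilon>" if "\<epsilon> > 0" "\<And>t. cmod (f (t + y) - f (t + y')) \<le> \<epsilon> / (C + 1)" for y y' \<epsilon>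
  proof -
    have "cmod (g y - g y') \<le> \<epsilon> / (C + 1) * C" by (rule le) (rule that(2))
    also have "\<dots> \<le> \<epsilon>" using that(1) C by (simp add: field_simps)
    finally show ?thesis .
  qed
  show "continuous_on UNIV g"
    unfolding continuous_on_iff
  proof safe
    fix r \<epsilon> :: real assume \<epsilon>: "\<epsilon> > 0"
    then have "\<epsilon> / 2 / (C + 1) > 0" using C by simp
    then obtain d where d: "d > 0" "\<And>s t. \<bar>s - t\<bar> < d \<Longrightarrow> cmod (f s - f t) < \<epsilon> / 2 / (C + 1)" using bohr_ap_uniform[OF f] by blast
    have "dist (g r') (g r) < \<epsilon>" if "dist r' r < d" for r'
    proof -
      have "cmod (g r' - g r) \<le> \<epsilon> / 2" using \<epsilon> that d(2) by (intro le' less_imp_le) (auto simp: dist_real_def)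
      then show ?thesis using \<epsilon> by (simp add: dist_norm)
    qed
    then show "\<exists>d>0. \<forall>x'\<in>UNIV. dist x' r < d \<longrightarrow> dist (g x') (g r) < \<epsilon>" using d(1) by blast
  qed
  fix \<epsilon> :: real assume \<epsilon>: "\<epsilon> > 0"
  then have "\<epsilon> / (C + 1) > 0" using C by simp
  then obtain S where S: "finite S" "\<And>s. \<exists>s'\<in>S. \<forall>t. cmod (f (t + s) - f (t + s')) \<le> \<epsilon> / (C + 1)" using bohr_ap_net[OF f] by blast
  have "\<exists>s'\<in>S. \<forall>t. cmod (g (t + s) - g (t + s')) \<le> \<epsilon>" for s
  proof -
    obtain s' where s': "s' \<in> S" "\<And>t. cmod (f (t + s) - f (t + s')) \<le> \<epsilon> / (C + 1)" using S(2) by blast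
    have "cmod (g (t + s) - g (t + s')) \<le> \<epsilon>" for t
      using s'(2)[of "_ + t"] by (intro le' \<epsilon>) (simp add: add_ac)
    then show ?thesis using s'(1) by blast
  qed
  then show "\<exists>S. finite S \<and> (\<forall>s. \<exists>s'\<in>S. \<forall>t. cmod (g (t + s) - g (t + s')) \<le> \<epsilon>)" using S(1) by blast
qed

lemma bohr_ap_twisted_mean:
  assumes f: "bohr_ap f" and T: "T \<ge> 0" shows "bohr_ap (twisted_mean f x T)"
proof -
  have c: "continuous_on A f" for A by (rule bohr_ap_cont[OF f])
  have le: "cmod (twisted_mean f x T r - twisted_mean f x T r') \<le> \<epsilon> * (2 * T)"
    if "\<And>t. cmod (f (r + t) - f (r' + t)) \<le> \<epsilon>" for r r' \<epsilon>
  proof -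
    have "twisted_mean f x T r - twisted_mean f x T r' = integral {-T..T} (\<lambda>s. f (r + s) * cis (- (x * s)) - f (r' + s) * cis (- (x * s)))"
      unfolding twisted_mean_def
      by (intro Henstock_Kurzweil_Integration.integral_diff[symmetric] integrable_continuous_real twisted_continuous c)
    also have "cmod \<dots> \<le> \<epsilon> * (T - (-T))"
      using that T by (intro integral_bound continuous_intros twisted_continuous c) (auto simp: norm_mult simp flip: left_diff_distrib)
    finally show ?thesis by simp
  qed
  show ?thesis
  proof (rule bohr_ap_translate_bound[OF f])
    show "cmod (twisted_mean f x T r - twisted_mean f x T r') \<le> \<epsilon> * (2 * T)"
      if "\<And>t. cmod (f (t + r) - f (t + r')) \<le> \<epsilon>" for r r' \<epsilon>
      using that by (intro le) (simp add: add.commute)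
  qed (use T in simp)
qed

text \<open>Before the limit the interchange is Fubini on a rectangle. The finite means converge
  pointwise in s and are bounded by K * K', so dominated convergence on [-T, T] passes to the
  limit.\<close>

lemma ap_mean_twisted_mean:
  assumes f: "bohr_ap f" and g: "bohr_ap g" and T: "T \<ge> 0"
  shows "ap_mean (\<lambda>r. twisted_mean f x T r * g r) = integral {-T..T} (\<lambda>s. ap_mean (\<lambda>r. f (r + s) * g r) * cis (- (x * s)))"
proof -
  have fc: "continuous_on A f" for A by (rule bohr_ap_cont[OF f])
  have gc: "continuous_on A g" for A by (rule bohr_ap_cont[OF g])
  obtain K where K: "K > 0" "\<And>t. cmod (f t) \<le> K" using bohr_ap_bounded[OF f] by blast
  obtain K' where K': "K' > 0" "\<And>t. cmod (g t) \<le> K'" using bohr_ap_bounded[OF g] by blast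
  define h where "h s r = f (r + s) * g r * cis (- (x * s))" for s r
  have hc: "continuous_on A (\<lambda>(s, r). h s r)" for A
    unfolding h_def case_prod_unfold cis_conv_exp
    by (intro continuous_intros continuous_on_compose2[OF fc[of UNIV]] continuous_on_compose2[OF gc[of UNIV]]) auto
  have hm: "bohr_ap (\<lambda>r. h s r)" for s
    unfolding h_def using bohr_ap_mult[OF bohr_ap_mult[OF bohr_ap_shift[OF f, of s] g] bohr_ap_const] by (simp add: add.commute)
  have mean_h: "ap_mean (\<lambda>r. h s r) = ap_mean (\<lambda>r. f (r + s) * g r) * cis (- (x * s))" for s
    using ap_mean_cmult[OF bohr_ap_mult[OF bohr_ap_shift[OF f, of s] g], of "cis (- (x * s))"]
    by (simp add: h_def add.commute mult.commute)
  define V where "V n s = integral {-real (Suc n)..real (Suc n)} (\<lambda>r. h s r) / of_real (2 * real (Suc n))" for n s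
  have Vc: "continuous_on {-T..T} (V n)" for n
    unfolding V_def
    using integral_continuous_on_param[of "{-T..T}" "-real (Suc n)" "real (Suc n)" h] hc[of "{-T..T} \<times> cbox (- real (Suc n)) (real (Suc n))"]
    by (intro continuous_on_divide continuous_on_const) (simp_all add: cbox_interval del: of_nat_Suc)
  have V1: "(\<lambda>n. V n s) \<longlonglongrightarrow> ap_mean (\<lambda>r. h s r)" for s
    unfolding V_def
    by (rule filterlim_compose[OF ap_mean_tendsto[OF hm] filterlim_compose[OF filterlim_real_sequentially filterlim_Suc]])
  have "(\<lambda>n. integral {-T..T} (V n)) \<longlonglongrightarrow> integral {-T..T} (\<lambda>s. ap_mean (\<lambda>r. h s r))"
  proof (rule dominated_convergence(2))
    show "V n integrable_on {-T..T}" for n by (intro integrable_continuous_real Vc)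
    show "(\<lambda>_. K * K') integrable_on {-T..T}" by (rule integrable_const_ivl)
    fix n s
    have "cmod (integral {-real (Suc n)..real (Suc n)} (\<lambda>r. h s r)) \<le> (K * K') * (real (Suc n) - (- real (Suc n)))"
    proof (rule integral_bound)
      show "continuous_on {-real (Suc n)..real (Suc n)} (h s)" by (rule bohr_ap_cont[OF hm])
      show "cmod (h s t) \<le> K * K'" for t
        using mult_mono[OF K(2)[of "t + s"] K'(2)[of t]] K(1) by (simp add: h_def norm_mult)
    qed simp
    then have "cmod (integral {-real (Suc n)..real (Suc n)} (\<lambda>r. h s r)) / (2 * real (Suc n)) \<le> (K * K') * (2 * real (Suc n)) / (2 * real (Suc n))"
      by (intro divide_right_mono) auto
    then show "norm (V n s) \<le> K * K'" by (simp add: V_def norm_divide norm_mult del: of_nat_Suc)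
  qed (use V1 in auto)
  moreover have "integral {-T..T} (V n) = integral {-real (Suc n)..real (Suc n)} (\<lambda>r. twisted_mean f x T r * g r) / of_real (2 * real (Suc n))" for n
  proof -
    have "integral {-T..T} (V n) = integral {-T..T} (\<lambda>s. integral {-real (Suc n)..real (Suc n)} (\<lambda>r. h s r)) / of_real (2 * real (Suc n))"
      by (simp add: V_def[abs_def] del: of_nat_Suc)
    also have "integral {-T..T} (\<lambda>s. integral {-real (Suc n)..real (Suc n)} (\<lambda>r. h s r)) = integral {-real (Suc n)..real (Suc n)} (\<lambda>r. integral {-T..T} (\<lambda>s. h s r))"
      using integral_swap_continuous[of "-T" "-real (Suc n)" T "real (Suc n)" h] hc by (simp add: cbox_interval del: of_nat_Suc)
    also have "(\<lambda>r. integral {-T..T} (\<lambda>s. h s r)) = (\<lambda>r. twisted_mean f x T r * g r)"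
    proof
      fix r
      have "h s r = f (r + s) * cis (- (x * s)) * g r" for s by (simp add: h_def)
      then show "integral {-T..T} (\<lambda>s. h s r) = twisted_mean f x T r * g r" by (simp add: twisted_mean_def)
    qed
    finally show ?thesis .
  qed
  ultimately have "(\<lambda>n. integral {-real (Suc n)..real (Suc n)} (\<lambda>r. twisted_mean f x T r * g r) / of_real (2 * real (Suc n))) \<longlonglongrightarrow> integral {-T..T} (\<lambda>s. ap_mean (\<lambda>r. h s r))"
    by simp
  moreover have "(\<lambda>n. integral {-real (Suc n)..real (Suc n)} (\<lambda>r. twisted_mean f x T r * g r) / of_real (2 * real (Suc n))) \<longlonglongrightarrow> ap_mean (\<lambda>r. twisted_mean f x T r * g r)"
    by (rule filterlim_compose[OF ap_mean_tendsto[OF bohr_ap_mult[OF bohr_ap_twisted_mean[OF f T] g]] filterlim_compose[OF filterlim_real_sequentially filterlim_Suc]])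
  ultimately show ?thesis using LIMSEQ_unique by (simp add: mean_h)
qed

text \<open>A finite form of the Wiener-Khinchin identity: the mean energy of the truncated
  transform depends on f only through its autocorrelation. Since the left side is a mean of squares,
  the right side is nonnegative at every frequency.\<close>

lemma ap_mean_twisted_mean_sq:
  assumes f: "bohr_ap f" and T: "T \<ge> 0"
  defines "F \<equiv> \<lambda>y. ap_mean (\<lambda>r. f (r + y) * cnj (f r))"
  shows "ap_mean (\<lambda>r. of_real ((cmod (twisted_mean f x T r))\<^sup>2)) =
    integral {-T..T} (\<lambda>s. integral {-T..T} (\<lambda>t. F (s - t) * cis (- (x * (s - t)))))"
proof -
  have J: "bohr_ap (twisted_mean f x T)" by (rule bohr_ap_twisted_mean[OF f T])
  have fs: "bohr_ap (\<lambda>r. f (r + s))" for s using bohr_ap_shift[OF f, of s] by (simp add: add.commute)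
  have F1: "ap_mean (\<lambda>r. f (r + t) * cnj (f (r + s))) = F (t - s)" for s t
  proof -
    have "bohr_ap (\<lambda>r. f (r + (t - s)) * cnj (f r))" by (intro bohr_ap_mult bohr_ap_cnj fs f)
    from ap_mean_shift[OF this, of s] show ?thesis by (simp add: F_def algebra_simps)
  qed
  \<comment> \<open>Hermitian symmetry turns the conjugated inner integral back into one over
    \<open>F (s - t)\<close>.\<close>
  have F2: "cnj (F (t - s)) = F (s - t)" for s t
  proof -
    have "cnj (F (t - s)) = ap_mean (\<lambda>r. cnj (f (r + t) * cnj (f (r + s))))"
      unfolding F1[symmetric] by (intro ap_mean_cnj[symmetric] bohr_ap_mult bohr_ap_cnj fs)
    also have "\<dots> = F (s - t)" using F1[of s t] by (simp add: mult.commute)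
    finally show ?thesis .
  qed
  have inner: "ap_mean (\<lambda>r. f (r + s) * cnj (twisted_mean f x T r)) = integral {-T..T} (\<lambda>t. F (s - t) * cis (x * t))" for s
  proof -
    have "ap_mean (\<lambda>r. f (r + s) * cnj (twisted_mean f x T r)) = ap_mean (\<lambda>r. cnj (twisted_mean f x T r * cnj (f (r + s))))"
      by (simp add: mult.commute)
    also have "\<dots> = cnj (ap_mean (\<lambda>r. twisted_mean f x T r * cnj (f (r + s))))"
      by (intro ap_mean_cnj bohr_ap_mult J bohr_ap_cnj fs)
    also have "\<dots> = cnj (integral {-T..T} (\<lambda>t. F (t - s) * cis (- (x * t))))"
      by (subst ap_mean_twisted_mean[OF f bohr_ap_cnj[OF fs] T]) (simp add: F1)
    also have "\<dots> = integral {-T..T} (\<lambda>t. F (s - t) * cis (x * t))"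
      by (simp add: integral_cnj F2 cis_cnj)
    finally show ?thesis .
  qed
  have "ap_mean (\<lambda>r. of_real ((cmod (twisted_mean f x T r))\<^sup>2)) = ap_mean (\<lambda>r. twisted_mean f x T r * cnj (twisted_mean f x T r))"
    by (simp only: complex_norm_square)
  also have "\<dots> = integral {-T..T} (\<lambda>s. integral {-T..T} (\<lambda>t. F (s - t) * cis (x * t)) * cis (- (x * s)))"
    by (subst ap_mean_twisted_mean[OF f bohr_ap_cnj[OF J] T]) (simp add: inner)
  also have "\<dots> = integral {-T..T} (\<lambda>s. integral {-T..T} (\<lambda>t. F (s - t) * cis (- (x * (s - t)))))"
  proof -
    have "F (s - t) * cis (x * t) * cis (- (x * s)) = F (s - t) * cis (- (x * (s - t)))" for s t
      by (simp add: mult.assoc cis_mult algebra_simps)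
    then show ?thesis by (simp only: integral_mult_left[symmetric])
  qed
  finally show ?thesis .
qed

section \<open>Autocorrelations\<close>

lemma integrable_pair_mult:
  fixes f g :: "real \<Rightarrow> complex"
  assumes f: "integrable lborel f" and g: "integrable lborel g"
  shows "integrable (lborel \<Otimes>\<^sub>M lborel) (\<lambda>(x, y). f x * g y)"
proof (rule lborel_pair.Fubini_integrable)
  have [measurable]: "f \<in> borel_measurable borel" "g \<in> borel_measurable borel" using f g by auto
  show "(\<lambda>(x, y). f x * g y) \<in> borel_measurable (lborel \<Otimes>\<^sub>M lborel)" by measurable
  show "integrable lborel (\<lambda>x. LINT y|lborel. norm (case (x, y) of (x, y) \<Rightarrow> f x * g y))"
    using f by (simp add: norm_mult)
  show "AE x in lborel. integrable lborel (\<lambda>y. case (x, y) of (x, y) \<Rightarrow> f x * g y)"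
    using g by simp
qed

lemma integral_std_normal_density_cis:
  assumes d: "\<delta> > 0"
  shows "(LINT x|lborel. of_real (std_normal_density (\<delta> * x)) * cis (x * y)) = of_real (sqrt (2 * pi) / \<delta> * std_normal_density (y / \<delta>))"
proof -
  have "complex_of_real (exp (- ((y / \<delta>)\<^sup>2) / 2)) = char std_normal_distribution (y / \<delta>)"
    by (simp add: char_std_normal_distribution)
  also have "\<dots> = (LINT z|lborel. std_normal_density z *\<^sub>R cis (y / \<delta> * z))"
    unfolding char_def by (subst integral_density) (auto simp: cis_conv_exp normal_density_nonneg)
  also have "\<dots> = \<bar>\<delta>\<bar> *\<^sub>R (LINT x|lborel. std_normal_density (0 + \<delta> * x) *\<^sub>R cis (y / \<delta> * (0 + \<delta> * x)))"
    by (rule lborel_integral_real_affine) (use d in simp)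
  also have "(LINT x|lborel. std_normal_density (0 + \<delta> * x) *\<^sub>R cis (y / \<delta> * (0 + \<delta> * x))) = (LINT x|lborel. of_real (std_normal_density (\<delta> * x)) * cis (x * y))"
    using d by (simp add: scaleR_conv_of_real mult.commute)
  finally have "of_real \<delta> * (LINT x|lborel. of_real (std_normal_density (\<delta> * x)) * cis (x * y)) = complex_of_real (exp (- ((y / \<delta>)\<^sup>2) / 2))"
    using d by (simp add: scaleR_conv_of_real)
  moreover have "exp (- ((y / \<delta>)\<^sup>2) / 2) = \<delta> * (sqrt (2 * pi) / \<delta> * std_normal_density (y / \<delta>))"
    using d by (simp add: std_normal_density_def)
  ultimately have "of_real \<delta> * (LINT x|lborel. of_real (std_normal_density (\<delta> * x)) * cis (x * y)) = of_real \<delta> * of_real (sqrt (2 * pi) / \<delta> * std_normal_density (y / \<delta>))"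
    by (simp only: of_real_mult)
  then show ?thesis using d by (simp only: mult_cancel_left of_real_eq_0_iff) simp
qed

lemma integrable_std_normal_density_scaled: "\<delta> > 0 \<Longrightarrow> integrable lborel (\<lambda>x. std_normal_density (\<delta> * x))"
  using lborel_integrable_real_affine[of std_normal_density \<delta> 0] by simp

text \<open>The transform of \<Phi> is not known to be integrable, so a Gaussian factor regularizes
  the inversion; by Fubini the outcome is a Gaussian average of \<Phi> around y at scale \<delta>.
  The factor is 2 * pi from inversion times the value 1 / sqrt (2 * pi) of the density at 0.\<close>

lemma gaussian_fourier_inversion:
  fixes \<Phi> :: "real \<Rightarrow> complex"
  assumes P: "integrable lborel \<Phi>" and d: "\<delta> > 0"
  shows "(LINT x|lborel. of_real (std_normal_density (\<delta> * x)) * (LINT t|lborel. \<Phi> t * cis (- (x * t))) * cis (x * y)) =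
    of_real (sqrt (2 * pi)) * (LINT z|lborel. \<Phi> (y - \<delta> * z) * of_real (std_normal_density z))"
proof -
  have [measurable]: "\<Phi> \<in> borel_measurable borel" using P by auto
  define f where "f x t = of_real (std_normal_density (\<delta> * x)) * \<Phi> t * cis (x * (y - t))" for x t
  have i: "integrable (lborel \<Otimes>\<^sub>M lborel) (\<lambda>(x, t). f x t)"
  proof (rule Bochner_Integration.integrable_bound)
    show "integrable (lborel \<Otimes>\<^sub>M lborel) (\<lambda>(x, t). of_real (std_normal_density (\<delta> * x)) * \<Phi> t)"
      by (intro integrable_pair_mult integrable_of_real integrable_std_normal_density_scaled d P)
    show "AE p in lborel \<Otimes>\<^sub>M lborel. norm (case p of (x, t) \<Rightarrow> f x t) \<le> norm (case p of (x, t) \<Rightarrow> of_real (std_normal_density (\<delta> * x)) * \<Phi> t)"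
      by (auto simp: f_def norm_mult)
  qed (unfold f_def, measurable)
  have "of_real (std_normal_density (\<delta> * x)) * (LINT t|lborel. \<Phi> t * cis (- (x * t))) * cis (x * y) = (LINT t|lborel. f x t)" for x
  proof -
    have "cis (x * (y - t)) = cis (- (x * t)) * cis (x * y)" for t by (simp add: cis_mult algebra_simps)
    then have "f x t = of_real (std_normal_density (\<delta> * x)) * cis (x * y) * (\<Phi> t * cis (- (x * t)))" for t
      by (simp add: f_def)
    then show ?thesis by simp
  qed
  then have "(LINT x|lborel. of_real (std_normal_density (\<delta> * x)) * (LINT t|lborel. \<Phi> t * cis (- (x * t))) * cis (x * y)) = (LINT x|lborel. LINT t|lborel. f x t)"
    by simp
  also have "\<dots> = (LINT t|lborel. LINT x|lborel. f x t)" by (rule lborel_pair.Fubini_integral[OF i, symmetric])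
  also have "(\<lambda>t. LINT x|lborel. f x t) = (\<lambda>t. \<Phi> t * of_real (sqrt (2 * pi) / \<delta> * std_normal_density ((y - t) / \<delta>)))"
  proof
    fix t
    have "f x t = \<Phi> t * (of_real (std_normal_density (\<delta> * x)) * cis (x * (y - t)))" for x by (simp add: f_def)
    then show "(LINT x|lborel. f x t) = \<Phi> t * of_real (sqrt (2 * pi) / \<delta> * std_normal_density ((y - t) / \<delta>))"
      by (simp only: integral_mult_right_zero integral_std_normal_density_cis[OF d])
  qed
  also have "(LINT t|lborel. \<Phi> t * of_real (sqrt (2 * pi) / \<delta> * std_normal_density ((y - t) / \<delta>))) =
    \<bar>- \<delta>\<bar> *\<^sub>R (LINT z|lborel. \<Phi> (y + (- \<delta>) * z) * of_real (sqrt (2 * pi) / \<delta> * std_normal_density ((y - (y + (- \<delta>) * z)) / \<delta>)))"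
    by (rule lborel_integral_real_affine) (use d in simp)
  also have "\<dots> = of_real (sqrt (2 * pi)) * (LINT z|lborel. \<Phi> (y - \<delta> * z) * of_real (std_normal_density z))"
  proof -
    have "\<Phi> (y + (- \<delta>) * z) * of_real (sqrt (2 * pi) / \<delta> * std_normal_density ((y - (y + (- \<delta>) * z)) / \<delta>)) =
        of_real (sqrt (2 * pi) / \<delta>) * (\<Phi> (y - \<delta> * z) * of_real (std_normal_density z))" for z
      using d by simp
    then show ?thesis using d by (simp only: integral_mult_right_zero) (simp add: scaleR_conv_of_real)
  qed
  finally show ?thesis .
qed

text \<open>
  With Gaussian weights, the squared transform integrates to at most \<open>M\<close> times the integral of the
  nonnegative transform itself, and the latter is a Gaussian average of \<open>\<Phi>\<close> near \<open>0\<close>.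
\<close>

lemma positive_fourier_L2_bound:
  fixes \<Phi> :: "real \<Rightarrow> complex"
  assumes P: "integrable lborel \<Phi>" and c: "continuous_on UNIV \<Phi>" and K: "\<And>t. cmod (\<Phi> t) \<le> K"
    and im: "\<And>x. Im (LINT t|lborel. \<Phi> t * cis (- (x * t))) = 0"
    and re: "\<And>x. 0 \<le> Re (LINT t|lborel. \<Phi> t * cis (- (x * t)))" "\<And>x. Re (LINT t|lborel. \<Phi> t * cis (- (x * t))) \<le> M"
  shows "(LINT t|lborel. (cmod (\<Phi> t))\<^sup>2) \<le> M * K"
proof -
  have [measurable]: "\<Phi> \<in> borel_measurable borel" using P by auto
  have K0: "K \<ge> 0" using K[of 0] norm_ge_zero order_trans by blast
  have M0: "M \<ge> 0" using re[of 0] by linarith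
  define m where "m x = (LINT t|lborel. \<Phi> t * cis (- (x * t)))" for x
  have mm[measurable]: "m \<in> borel_measurable borel" unfolding m_def[abs_def] by measurable
  have mr: "m x = of_real (Re (m x))" for x using im[of x] by (simp add: m_def complex_eq_iff)
  have mM: "cmod (m x) \<le> M" for x
  proof -
    have "cmod (m x) = \<bar>Re (m x)\<bar>" by (subst mr) (simp only: norm_of_real)
    then show ?thesis using re[of x] by (simp add: m_def)
  qed
  define g where "g \<delta> y = (LINT x|lborel. of_real (std_normal_density (\<delta> * x)) * m x * cis (x * y))" for \<delta> y
  have g: "g \<delta> y = of_real (sqrt (2 * pi)) * (LINT z|lborel. \<Phi> (y - \<delta> * z) * of_real (std_normal_density z))" if "\<delta> > 0" for \<delta> y
    unfolding g_def m_def by (rule gaussian_fourier_inversion[OF P that])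
  have iN: "integrable lborel std_normal_density" by simp
  have gb: "cmod (g \<delta> y) \<le> sqrt (2 * pi) * K" if "\<delta> > 0" for \<delta> y
  proof -
    have "cmod (LINT z|lborel. \<Phi> (y - \<delta> * z) * of_real (std_normal_density z)) \<le> (LINT z|lborel. K * std_normal_density z)"
    proof (rule order_trans[OF integral_norm_bound integral_mono])
      show "integrable lborel (\<lambda>z. cmod (\<Phi> (y - \<delta> * z) * of_real (std_normal_density z)))"
        by (rule Bochner_Integration.integrable_bound[OF integrable_mult_right[OF iN, of K]])
           (auto simp: norm_mult abs_mult K0 intro!: mult_right_mono K)
    qed (auto simp: norm_mult intro!: mult_right_mono K)
    then show ?thesis using g[OF that] by (simp add: norm_mult mult_left_mono)
  qed
  have iKm: "integrable lborel (\<lambda>x. of_real (std_normal_density (\<delta> * x)) * m x)" if "\<delta> > 0" for \<delta>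
    by (rule Bochner_Integration.integrable_bound[OF integrable_mult_right[OF integrable_std_normal_density_scaled[OF that], of M]])
       (auto simp: norm_mult abs_mult M0 mult.commute[of M] intro!: mult_left_mono mM)
  \<comment> \<open>A regularized Parseval identity. Since \<open>m\<close> is real,
    \<open>m x * cnj (m x)\<close> is the square of its real part.\<close>
  have energy: "(LINT y|lborel. cnj (\<Phi> y) * g \<delta> y) = (LINT x|lborel. of_real (std_normal_density (\<delta> * x) * (Re (m x))\<^sup>2))" if d: "\<delta> > 0" for \<delta>
  proof -
    define f where "f x y = of_real (std_normal_density (\<delta> * x)) * m x * cnj (\<Phi> y) * cis (x * y)" for x y
    have i: "integrable (lborel \<Otimes>\<^sub>M lborel) (\<lambda>(x, y). f x y)"
    proof (rule Bochner_Integration.integrable_bound)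
      have "integrable lborel (\<lambda>y. cnj (\<Phi> y))" using P by simp
      from integrable_pair_mult[OF iKm[OF d] this]
      show "integrable (lborel \<Otimes>\<^sub>M lborel) (\<lambda>(x, y). of_real (std_normal_density (\<delta> * x)) * m x * cnj (\<Phi> y))" .
      show "AE p in lborel \<Otimes>\<^sub>M lborel. norm (case p of (x, y) \<Rightarrow> f x y) \<le> norm (case p of (x, y) \<Rightarrow> of_real (std_normal_density (\<delta> * x)) * m x * cnj (\<Phi> y))"
        by (auto simp: f_def norm_mult)
    qed (unfold f_def, measurable)
    have "cnj (\<Phi> y) * g \<delta> y = (LINT x|lborel. f x y)" for y
    proof -
      have "f x y = cnj (\<Phi> y) * (of_real (std_normal_density (\<delta> * x)) * m x * cis (x * y))" for x by (simp add: f_def)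
      then show ?thesis by (simp only: g_def integral_mult_right_zero)
    qed
    then have "(LINT y|lborel. cnj (\<Phi> y) * g \<delta> y) = (LINT y|lborel. LINT x|lborel. f x y)" by simp
    also have "\<dots> = (LINT x|lborel. LINT y|lborel. f x y)" by (rule lborel_pair.Fubini_integral[OF i])
    also have "(\<lambda>x. LINT y|lborel. f x y) = (\<lambda>x. of_real (std_normal_density (\<delta> * x) * (Re (m x))\<^sup>2))"
    proof
      fix x
      have "f x y = of_real (std_normal_density (\<delta> * x)) * m x * cnj (\<Phi> y * cis (- (x * y)))" for y by (simp add: f_def cis_cnj)
      then have "(LINT y|lborel. f x y) = of_real (std_normal_density (\<delta> * x)) * m x * cnj (m x)"
        by (simp only: integral_mult_right_zero Bochner_Integration.integral_cnj m_def)
      also have "\<dots> = of_real (std_normal_density (\<delta> * x) * (Re (m x))\<^sup>2)"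
        by (subst (1 2) mr) (simp add: power2_eq_square)
      finally show "(LINT y|lborel. f x y) = of_real (std_normal_density (\<delta> * x) * (Re (m x))\<^sup>2)" .
    qed
    finally show ?thesis .
  qed
  have bound: "Re (LINT y|lborel. cnj (\<Phi> y) * g \<delta> y) \<le> M * (sqrt (2 * pi) * K)" if d: "\<delta> > 0" for \<delta>
  proof -
    have ir: "integrable lborel (\<lambda>x. M * (std_normal_density (\<delta> * x) * Re (m x)))"
      using integrable_mult_right[OF integrable_Re[OF iKm[OF d]], of M] by simp
    have ile: "std_normal_density (\<delta> * x) * (Re (m x))\<^sup>2 \<le> M * (std_normal_density (\<delta> * x) * Re (m x))" for x
    proof -
      have "Re (m x) * Re (m x) \<le> M * Re (m x)" using re[of x] by (intro mult_right_mono) (auto simp: m_def)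
      then have "std_normal_density (\<delta> * x) * (Re (m x) * Re (m x)) \<le> std_normal_density (\<delta> * x) * (M * Re (m x))" by (intro mult_left_mono) auto
      then show ?thesis by (simp add: power2_eq_square mult_ac)
    qed
    have "Re (LINT y|lborel. cnj (\<Phi> y) * g \<delta> y) = (LINT x|lborel. std_normal_density (\<delta> * x) * (Re (m x))\<^sup>2)"
      by (simp only: energy[OF d] integral_complex_of_real Re_complex_of_real)
    also have "\<dots> \<le> (LINT x|lborel. M * (std_normal_density (\<delta> * x) * Re (m x)))"
    proof (rule integral_mono[OF _ ir ile])
      show "integrable lborel (\<lambda>x. std_normal_density (\<delta> * x) * (Re (m x))\<^sup>2)"
        by (rule Bochner_Integration.integrable_bound[OF ir]) (auto intro!: order_trans[OF ile] simp: abs_of_nonneg)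
    qed
    also have "\<dots> = M * Re (g \<delta> 0)"
      unfolding g_def using integral_Re[OF iKm[OF d]] by simp
    also have "\<dots> \<le> M * (sqrt (2 * pi) * K)"
      using gb[OF d, of 0] complex_Re_le_cmod[of "g \<delta> 0"] M0 by (intro mult_left_mono) auto
    finally show ?thesis .
  qed
  \<comment> \<open>These scales remove the regularization: Gaussian averages of the bounded
    continuous \<Phi> converge pointwise, and a multiple of its modulus dominates the outer
    integrals.\<close>
  define d where "d n = 1 / real (Suc n)" for n
  have d: "d n > 0" "d \<longlonglongrightarrow> 0" for n
    unfolding d_def using LIMSEQ_inverse_real_of_nat by (auto simp: divide_inverse)
  have g_lim: "(\<lambda>n. g (d n) y) \<longlonglongrightarrow> of_real (sqrt (2 * pi)) * \<Phi> y" for y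
  proof -
    have "(\<lambda>n. LINT z|lborel. \<Phi> (y - d n * z) * of_real (std_normal_density z)) \<longlonglongrightarrow> (LINT z|lborel. \<Phi> y * of_real (std_normal_density z))"
    proof (rule integral_dominated_convergence[where w="\<lambda>z. K * std_normal_density z"])
      show "AE z in lborel. (\<lambda>n. \<Phi> (y - d n * z) * of_real (std_normal_density z)) \<longlonglongrightarrow> \<Phi> y * of_real (std_normal_density z)"
      proof (rule AE_I2)
        fix z
        have "(\<lambda>n. y - d n * z) \<longlonglongrightarrow> y - 0 * z" by (intro tendsto_intros d)
        then have "(\<lambda>n. y - d n * z) \<longlonglongrightarrow> y" by simp
        from continuous_on_tendsto_compose[OF c this]
        show "(\<lambda>n. \<Phi> (y - d n * z) * of_real (std_normal_density z)) \<longlonglongrightarrow> \<Phi> y * of_real (std_normal_density z)"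
          by (intro tendsto_intros) auto
      qed
      show "AE z in lborel. norm (\<Phi> (y - d n * z) * of_real (std_normal_density z)) \<le> K * std_normal_density z" for n
        by (auto simp: norm_mult intro!: mult_right_mono K)
    qed auto
    then have "(\<lambda>n. LINT z|lborel. \<Phi> (y - d n * z) * of_real (std_normal_density z)) \<longlonglongrightarrow> \<Phi> y" by simp
    then show ?thesis unfolding g[OF d(1)] by (intro tendsto_intros)
  qed
  have [measurable]: "g \<delta> \<in> borel_measurable borel" for \<delta> unfolding g_def[abs_def] by measurable
  have "(\<lambda>n. LINT y|lborel. cnj (\<Phi> y) * g (d n) y) \<longlonglongrightarrow> (LINT y|lborel. cnj (\<Phi> y) * (of_real (sqrt (2 * pi)) * \<Phi> y))"
  proof (rule integral_dominated_convergence[where w="\<lambda>y. cmod (\<Phi> y) * (sqrt (2 * pi) * K)"])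
    show "AE y in lborel. (\<lambda>n. cnj (\<Phi> y) * g (d n) y) \<longlonglongrightarrow> cnj (\<Phi> y) * (of_real (sqrt (2 * pi)) * \<Phi> y)"
      by (intro AE_I2 tendsto_intros g_lim)
    show "AE y in lborel. norm (cnj (\<Phi> y) * g (d n) y) \<le> cmod (\<Phi> y) * (sqrt (2 * pi) * K)" for n
      by (auto simp: norm_mult intro!: mult_left_mono gb d)
    show "integrable lborel (\<lambda>y. cmod (\<Phi> y) * (sqrt (2 * pi) * K))" using P by simp
  qed measurable
  then have "Re (LINT y|lborel. cnj (\<Phi> y) * (of_real (sqrt (2 * pi)) * \<Phi> y)) \<le> M * (sqrt (2 * pi) * K)"
    by (rule LIMSEQ_le_const2[OF tendsto_Re]) (use bound d in blast)
  also have "(\<lambda>y. cnj (\<Phi> y) * (of_real (sqrt (2 * pi)) * \<Phi> y)) = (\<lambda>y. of_real (sqrt (2 * pi) * (cmod (\<Phi> y))\<^sup>2))"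
    unfolding of_real_mult complex_norm_square by (simp add: mult_ac)
  also have "Re (LINT y|lborel. of_real (sqrt (2 * pi) * (cmod (\<Phi> y))\<^sup>2)) = sqrt (2 * pi) * (LINT y|lborel. (cmod (\<Phi> y))\<^sup>2)"
    by (simp only: integral_complex_of_real Re_complex_of_real integral_mult_right_zero)
  finally have "sqrt (2 * pi) * (LINT y|lborel. (cmod (\<Phi> y))\<^sup>2) \<le> sqrt (2 * pi) * (M * K)" by (simp add: mult_ac)
  then show ?thesis by (rule mult_left_le_imp_le) simp
qed

section \<open>The triangular kernel and the mean square of the autocorrelation\<close>

lemma integral_Icc_eq_lborel:
  fixes f :: "real \<Rightarrow> complex"
  assumes "continuous_on {a..b} f"
  shows "integral {a..b} f = (LINT x|lborel. of_real (indicat_real {a..b} x) * f x)"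
    and "integrable lborel (\<lambda>x. of_real (indicat_real {a..b} x) * f x)"
proof -
  have i: "set_integrable lborel {a..b} f" using assms by (rule borel_integrable_atLeastAtMost')
  from set_borel_integral_eq_integral(2)[OF i]
  show "integral {a..b} f = (LINT x|lborel. of_real (indicat_real {a..b} x) * f x)"
    by (simp add: set_lebesgue_integral_def scaleR_conv_of_real)
  show "integrable lborel (\<lambda>x. of_real (indicat_real {a..b} x) * f x)"
    using i by (simp add: set_integrable_def scaleR_conv_of_real)
qed

text \<open>For a fixed difference x the admissible s form the interval from max (-T) (x - T) to min
  T (x + T). It has length 2 * T - |x| or is empty, hence the triangular weight.\<close>

lemma integral_difference_kernel:
  fixes G :: "real \<Rightarrow> complex"
  assumes G: "continuous_on UNIV G" and K: "\<And>x. cmod (G x) \<le> K" and T: "T \<ge> 0"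
  shows "integral {-T..T} (\<lambda>s. integral {-T..T} (\<lambda>t. G (s - t))) = (LINT x|lborel. of_real (max 0 (2 * T - \<bar>x\<bar>)) * G x)"
proof -
  define I where "I x = complex_of_real (indicat_real {-T..T} x)" for x
  have [measurable]: "G \<in> borel_measurable borel" using G by (rule borel_measurable_continuous_onI)
  have [measurable]: "I \<in> borel_measurable borel" unfolding I_def[abs_def] by measurable
  have G2: "continuous_on A (\<lambda>(s, t). G (s - t))" for A
    unfolding case_prod_unfold by (rule continuous_on_compose2[OF G]) (auto intro!: continuous_intros)
  have oc: "continuous_on {-T..T} (\<lambda>s. integral {-T..T} (\<lambda>t. G (s - t)))"
    using integral_continuous_on_param[of "{-T..T}" "-T" T "\<lambda>s t. G (s - t)"] G2 by (simp add: cbox_interval)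
  have ic: "continuous_on {-T..T} (\<lambda>t. G (s - t))" for s
    by (rule continuous_on_compose2[OF G]) (auto intro!: continuous_intros)
  define f where "f s x = I s * (I (s - x) * G x)" for s x
  have i: "integrable (lborel \<Otimes>\<^sub>M lborel) (\<lambda>(s, x). f s x)"
  proof (rule Bochner_Integration.integrable_bound)
    show "integrable (lborel \<Otimes>\<^sub>M lborel) (\<lambda>(s, x). I s * (of_real K * of_real (indicat_real {-(2 * T)..2 * T} x)))"
      unfolding I_def by (intro integrable_pair_mult integrable_mult_right integrable_of_real integrable_real_indicator) (auto simp: emeasure_lborel_Icc_eq)
    show "AE p in lborel \<Otimes>\<^sub>M lborel. norm (case p of (s, x) \<Rightarrow> f s x) \<le> norm (case p of (s, x) \<Rightarrow> I s * (of_real K * of_real (indicat_real {-(2 * T)..2 * T} x)))"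
      using order_trans[OF K abs_ge_self] by (intro AE_I2) (auto simp: f_def I_def norm_mult indicator_def)
  qed (unfold f_def, measurable)
  have "integral {-T..T} (\<lambda>s. integral {-T..T} (\<lambda>t. G (s - t))) = (LINT s|lborel. I s * (LINT t|lborel. I t * G (s - t)))"
    by (subst integral_Icc_eq_lborel(1)[OF oc]) (simp only: integral_Icc_eq_lborel(1)[OF ic] I_def)
  also have "(\<lambda>s. I s * (LINT t|lborel. I t * G (s - t))) = (\<lambda>s. LINT x|lborel. f s x)"
  proof
    fix s
    have "(LINT t|lborel. I t * G (s - t)) = (LINT x|lborel. I (s - x) * G x)"
      using lborel_integral_real_affine[of "-1" "\<lambda>t. I t * G (s - t)" s] by simp
    then show "I s * (LINT t|lborel. I t * G (s - t)) = (LINT x|lborel. f s x)" by (simp add: f_def)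
  qed
  also have "(LINT s|lborel. LINT x|lborel. f s x) = (LINT x|lborel. LINT s|lborel. f s x)"
    by (rule lborel_pair.Fubini_integral[OF i, symmetric])
  also have "(\<lambda>x. LINT s|lborel. f s x) = (\<lambda>x. of_real (max 0 (2 * T - \<bar>x\<bar>)) * G x)"
  proof
    fix x
    have "f s x = of_real (indicat_real {max (-T) (x - T)..min T (x + T)} s) * G x" for s
      by (auto simp: f_def I_def indicator_def)
    then have "(LINT s|lborel. f s x) = of_real (LINT s|lborel. indicat_real {max (-T) (x - T)..min T (x + T)} s) * G x"
      by (simp only: integral_mult_left_zero integral_complex_of_real)
    also have "(LINT s|lborel. indicat_real {max (-T) (x - T)..min T (x + T)} s) = max 0 (2 * T - \<bar>x\<bar>)"
      using T by (auto simp: max_def min_def)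
    finally show "(LINT s|lborel. f s x) = of_real (max 0 (2 * T - \<bar>x\<bar>)) * G x" .
  qed
  finally show ?thesis .
qed

lemma ap_mean_norm_le:
  assumes f: "bohr_ap f" and K: "\<And>t. cmod (f t) \<le> K" shows "cmod (ap_mean f) \<le> K"
proof (rule tendsto_upperbound[OF tendsto_norm[OF ap_mean_tendsto[OF f]]])
  show "\<forall>\<^sub>F T in at_top. norm (integral {-T..T} f / of_real (2 * T)) \<le> K"
    using eventually_gt_at_top[of "0::real"]
  proof eventually_elim
    case (elim T)
    have "cmod (integral {-T..T} f) \<le> K * (T - (-T))"
      using elim by (intro integral_bound bohr_ap_cont f K) auto
    then show ?case using elim by (simp add: norm_divide norm_mult field_simps)
  qed
qed simp

definition autocorr :: "(real \<Rightarrow> complex) \<Rightarrow> real \<Rightarrow> complex" where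
  "autocorr f y = ap_mean (\<lambda>r. f (r + y) * cnj (f r))"

lemma bohr_ap_autocorr:
  assumes f: "bohr_ap f" shows "bohr_ap (autocorr f)"
proof -
  have fs: "bohr_ap (\<lambda>r. f (r + s))" for s using bohr_ap_shift[OF f, of s] by (simp add: add.commute)
  have p: "bohr_ap (\<lambda>r. f (r + y) * cnj (f r))" for y by (intro bohr_ap_mult bohr_ap_cnj fs f)
  obtain K where K: "K > 0" "\<And>t. cmod (f t) \<le> K" using bohr_ap_bounded[OF f] by blast
  have le: "cmod (autocorr f y - autocorr f y') \<le> \<epsilon> * K" if e: "\<And>t. cmod (f (t + y) - f (t + y')) \<le> \<epsilon>" for y y' \<epsilon>
  proof -
    have "autocorr f y - autocorr f y' = ap_mean (\<lambda>r. f (r + y) * cnj (f r) + (-1) * (f (r + y') * cnj (f r)))"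
      unfolding autocorr_def by (subst ap_mean_add[OF p bohr_ap_mult[OF bohr_ap_const p]], subst ap_mean_cmult[OF p]) simp
    also have "cmod \<dots> \<le> \<epsilon> * K"
    proof (rule ap_mean_norm_le)
      show "bohr_ap (\<lambda>r. f (r + y) * cnj (f r) + (-1) * (f (r + y') * cnj (f r)))"
        by (intro bohr_ap_add[OF p] bohr_ap_mult[OF bohr_ap_const p])
      fix r
      have "f (r + y) * cnj (f r) + (-1) * (f (r + y') * cnj (f r)) = (f (r + y) - f (r + y')) * cnj (f r)" by (simp add: algebra_simps)
      then show "cmod (f (r + y) * cnj (f r) + (-1) * (f (r + y') * cnj (f r))) \<le> \<epsilon> * K"
        using mult_mono[OF e[of r] K(2)[of r]] order_trans[OF norm_ge_zero e[of r]] by (simp add: norm_mult)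
    qed
    finally show ?thesis .
  qed
  show ?thesis by (rule bohr_ap_translate_bound[OF f _ le]) (use K in auto)
qed

text \<open>Multiplied by the triangle \<open>q\<close>, the autocorrelation has as transform the
  mean energy of a twisted mean divided by 2 * T, which lies between 0 and 8 * \<delta>^2 * T. By
  positivity its squared L^2 norm is at most 8 * \<delta>^2 * T * K. As \<open>q\<close> is at least
  1/2 on [-T, T], removing it costs a factor 4, and division by 2 * T leaves 16 * \<delta>^2 *
  K.\<close>

lemma ap_mean_autocorr_sq_le:
  assumes f: "bohr_ap f" and \<delta>: "\<delta> > 0" and coef: "\<And>x. cmod (ap_mean (\<lambda>t. f t * cis (- (x * t)))) \<le> \<delta>"
    and K: "\<And>y. cmod (autocorr f y) \<le> K"
  shows "Re (ap_mean (\<lambda>y. autocorr f y * cnj (autocorr f y))) \<le> 16 * \<delta>\<^sup>2 * K"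
proof -
  define F where "F = autocorr f"
  have F: "bohr_ap F" unfolding F_def by (rule bohr_ap_autocorr[OF f])
  have Fc: "continuous_on A F" for A by (rule bohr_ap_cont[OF F])
  have [measurable]: "F \<in> borel_measurable borel" using Fc by (rule borel_measurable_continuous_onI)
  have FK: "cmod (F y) \<le> K" for y using K by (simp add: F_def)
  have K0: "K \<ge> 0" using FK[of 0] norm_ge_zero order_trans by blast
  obtain N where N: "\<And>n x r. n \<ge> N \<Longrightarrow> cmod (twisted_mean f x (2 ^ n / 2) r) \<le> 2 * \<delta> * 2 ^ n"
    using twisted_mean_uniform[OF f \<delta> coef] by blast
  have avg: "Re (integral {-T..T} (\<lambda>y. F y * cnj (F y)) / of_real (2 * T)) \<le> 16 * \<delta>\<^sup>2 * K" if n: "n \<ge> N" and Tn: "T = 2 ^ n / 2" for n T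
  proof -
    have T: "T > 0" unfolding Tn by simp
    define q where "q y = max 0 (1 - \<bar>y\<bar> / (2 * T))" for y
    define \<Phi> where "\<Phi> y = of_real (q y) * F y" for y
    have q: "0 \<le> q y" "q y \<le> 1" for y using T by (auto simp: q_def)
    have qc: "continuous_on UNIV q" unfolding q_def using T by (intro continuous_intros) auto
    have [measurable]: "q \<in> borel_measurable borel" using qc by (rule borel_measurable_continuous_onI)
    have \<Phi>c: "continuous_on UNIV \<Phi>" unfolding \<Phi>_def by (intro continuous_intros qc Fc)
    have [measurable]: "\<Phi> \<in> borel_measurable borel" using \<Phi>c by (rule borel_measurable_continuous_onI)
    have \<Phi>K: "cmod (\<Phi> y) \<le> K" for y using mult_mono[OF q(2)[of y] FK[of y]] q by (simp add: \<Phi>_def norm_mult)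
    have q0: "q y = 0" if "y \<notin> {-(2 * T)..2 * T}" for y using that T by (auto simp: q_def field_simps)
    have \<Phi>i: "integrable lborel \<Phi>"
    proof (rule Bochner_Integration.integrable_bound)
      show "integrable lborel (\<lambda>y. K * indicat_real {-(2 * T)..2 * T} y)" by (intro integrable_mult_right integrable_real_indicator) (auto simp: emeasure_lborel_Icc_eq)
      show "AE y in lborel. norm (\<Phi> y) \<le> norm (K * indicat_real {-(2 * T)..2 * T} y)"
        using \<Phi>K q0 K0 by (intro AE_I2) (auto simp: indicator_def \<Phi>_def)
    qed simp
    have ft: "(LINT y|lborel. \<Phi> y * cis (- (x * y))) = ap_mean (\<lambda>r. of_real ((cmod (twisted_mean f x T r))\<^sup>2)) / of_real (2 * T)" for x
    proof -
      have "ap_mean (\<lambda>r. of_real ((cmod (twisted_mean f x T r))\<^sup>2)) = (LINT y|lborel. of_real (max 0 (2 * T - \<bar>y\<bar>)) * (F y * cis (- (x * y))))"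
        unfolding ap_mean_twisted_mean_sq[OF f less_imp_le[OF T]]
      proof (fold autocorr_def F_def, rule integral_difference_kernel)
        show "continuous_on UNIV (\<lambda>y. F y * cis (- (x * y)))" unfolding cis_conv_exp by (intro continuous_intros Fc)
      qed (use FK T in \<open>auto simp: norm_mult\<close>)
      also have "\<dots> = (LINT y|lborel. of_real (2 * T) * (\<Phi> y * cis (- (x * y))))"
      proof -
        have "max 0 (2 * T - \<bar>y\<bar>) = 2 * T * q y" for y using T by (auto simp: q_def max_def field_simps)
        then show ?thesis by (simp add: \<Phi>_def mult_ac)
      qed
      also have "\<dots> = of_real (2 * T) * (LINT y|lborel. \<Phi> y * cis (- (x * y)))" by (rule integral_mult_right_zero)
      finally show ?thesis using T by simp
    qed
    have J: "bohr_ap (\<lambda>r. of_real ((cmod (twisted_mean f x T r))\<^sup>2))" for x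
      unfolding complex_norm_square by (intro bohr_ap_mult bohr_ap_cnj bohr_ap_twisted_mean f) (use T in auto)
    have Jim: "Im (ap_mean (\<lambda>r. of_real ((cmod (twisted_mean f x T r))\<^sup>2))) = 0" for x
    proof -
      have "cnj (ap_mean (\<lambda>r. of_real ((cmod (twisted_mean f x T r))\<^sup>2))) = ap_mean (\<lambda>r. of_real ((cmod (twisted_mean f x T r))\<^sup>2))"
        by (subst ap_mean_cnj[OF J, symmetric]) simp
      then show ?thesis by (simp add: complex_eq_iff del: of_real_power)
    qed
    have J0: "0 \<le> Re (ap_mean (\<lambda>r. of_real ((cmod (twisted_mean f x T r))\<^sup>2)))" for x
      using ap_mean_Re_mono[OF bohr_ap_const J, of 0] by (simp add: ap_mean_const)
    have J1: "Re (ap_mean (\<lambda>r. of_real ((cmod (twisted_mean f x T r))\<^sup>2))) \<le> (2 * \<delta> * (2 * T))\<^sup>2" for x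
    proof -
      have "(cmod (twisted_mean f x T r))\<^sup>2 \<le> (2 * \<delta> * (2 * T))\<^sup>2" for r
        using N[OF n, of x r] by (intro power_mono) (auto simp: Tn)
      then have "Re (ap_mean (\<lambda>r. of_real ((cmod (twisted_mean f x T r))\<^sup>2))) \<le> Re (ap_mean (\<lambda>r::real. of_real ((2 * \<delta> * (2 * T))\<^sup>2)))"
        by (intro ap_mean_Re_mono J bohr_ap_const) (simp only: Re_complex_of_real)
      then show ?thesis by (simp only: ap_mean_const Re_complex_of_real)
    qed
    have "(LINT y|lborel. (cmod (\<Phi> y))\<^sup>2) \<le> (8 * \<delta>\<^sup>2 * T) * K"
    proof (rule positive_fourier_L2_bound[OF \<Phi>i \<Phi>c \<Phi>K])
      fix x
      show "Im (LINT t|lborel. \<Phi> t * cis (- (x * t))) = 0" unfolding ft by (simp only: Im_divide_of_real Jim div_0)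
      show "0 \<le> Re (LINT t|lborel. \<Phi> t * cis (- (x * t)))" unfolding ft Re_divide_of_real by (rule divide_nonneg_pos[OF J0]) (use T in simp)
      have "Re (ap_mean (\<lambda>r. of_real ((cmod (twisted_mean f x T r))\<^sup>2))) / (2 * T) \<le> (2 * \<delta> * (2 * T))\<^sup>2 / (2 * T)"
        by (rule divide_right_mono[OF J1]) (use T in simp)
      also have "\<dots> = 8 * \<delta>\<^sup>2 * T" using T by (simp add: power2_eq_square)
      finally show "Re (LINT t|lborel. \<Phi> t * cis (- (x * t))) \<le> 8 * \<delta>\<^sup>2 * T" unfolding ft Re_divide_of_real .
    qed
    moreover have "(LINT y|lborel. indicat_real {-T..T} y * (cmod (F y))\<^sup>2) \<le> (LINT y|lborel. 4 * (cmod (\<Phi> y))\<^sup>2)"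
    proof (rule integral_mono)
      show "integrable lborel (\<lambda>y. indicat_real {-T..T} y * (cmod (F y))\<^sup>2)"
      proof (rule Bochner_Integration.integrable_bound)
        show "integrable lborel (\<lambda>y. K\<^sup>2 * indicat_real {-T..T} y)" by (intro integrable_mult_right integrable_real_indicator) (auto simp: emeasure_lborel_Icc_eq)
        show "AE y in lborel. norm (indicat_real {-T..T} y * (cmod (F y))\<^sup>2) \<le> norm (K\<^sup>2 * indicat_real {-T..T} y)"
          using FK by (intro AE_I2) (auto simp: indicator_def intro!: power_mono)
      qed simp
      show "integrable lborel (\<lambda>y. 4 * (cmod (\<Phi> y))\<^sup>2)"
      proof (rule integrable_mult_right, rule Bochner_Integration.integrable_bound[OF integrable_mult_right[OF integrable_norm[OF \<Phi>i], of K]])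
        show "AE y in lborel. norm ((cmod (\<Phi> y))\<^sup>2) \<le> norm (K * norm (\<Phi> y))"
          using \<Phi>K K0 by (intro AE_I2) (auto simp: power2_eq_square intro!: mult_right_mono)
      qed simp
      fix y
      show "indicat_real {-T..T} y * (cmod (F y))\<^sup>2 \<le> 4 * (cmod (\<Phi> y))\<^sup>2"
      proof (cases "y \<in> {-T..T}")
        case True
        then have "\<bar>y\<bar> / (2 * T) \<le> 1 / 2" using T by (auto simp: field_simps)
        then have "1 / 2 \<le> q y" by (simp add: q_def)
        then have "(1 / 2)\<^sup>2 \<le> (q y)\<^sup>2" by (intro power_mono) auto
        then have "1 / 4 * (cmod (F y))\<^sup>2 \<le> (q y)\<^sup>2 * (cmod (F y))\<^sup>2" by (intro mult_right_mono) (auto simp: power2_eq_square)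
        then show ?thesis using True q by (simp add: \<Phi>_def norm_mult power_mult_distrib)
      qed simp
    qed
    ultimately have le: "(LINT y|lborel. indicat_real {-T..T} y * (cmod (F y))\<^sup>2) \<le> 32 * \<delta>\<^sup>2 * T * K" by simp
    have "integral {-T..T} (\<lambda>y. F y * cnj (F y)) = (LINT y|lborel. of_real (indicat_real {-T..T} y) * (F y * cnj (F y)))"
      by (intro integral_Icc_eq_lborel(1) continuous_intros Fc)
    also have "\<dots> = of_real (LINT y|lborel. indicat_real {-T..T} y * (cmod (F y))\<^sup>2)"
      by (simp only: complex_norm_square[symmetric] of_real_mult[symmetric] integral_complex_of_real)
    finally have "Re (integral {-T..T} (\<lambda>y. F y * cnj (F y)) / of_real (2 * T)) = (LINT y|lborel. indicat_real {-T..T} y * (cmod (F y))\<^sup>2) / (2 * T)"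
      by (simp only: Re_divide_of_real Re_complex_of_real)
    also have "\<dots> \<le> 32 * \<delta>\<^sup>2 * T * K / (2 * T)" using le T by (intro divide_right_mono) auto
    also have "\<dots> = 16 * \<delta>\<^sup>2 * K" using T by simp
    finally show ?thesis .
  qed
  \<comment> \<open>The mean exists as a full limit, so the dyadic lengths, for which the uniform
    estimate is available, determine it.\<close>
  have "filterlim (\<lambda>n. 2 ^ n / 2 :: real) at_top sequentially" by real_asymp
  from filterlim_compose[OF ap_mean_tendsto[OF bohr_ap_mult[OF F bohr_ap_cnj[OF F]]] this]
  have "(\<lambda>n. Re (integral {-(2 ^ n / 2)..2 ^ n / 2} (\<lambda>y. F y * cnj (F y)) / of_real (2 * (2 ^ n / 2)))) \<longlonglongrightarrow> Re (ap_mean (\<lambda>y. F y * cnj (F y)))"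
    by (rule tendsto_Re)
  then show ?thesis unfolding F_def[symmetric]
    by (rule LIMSEQ_le_const2) (intro exI[of _ N] allI impI, rule avg[OF _ refl], assumption)
qed

section \<open>Completeness of the exponentials\<close>

lemma cinner_add_right: "cinner x (y + z) = cinner x y + cinner (x :: 'a::complex_inner) z"
proof -
  have "cinner x (y + z) = cnj (cinner y x + cinner z x)" by (subst cinner_commute) (simp add: cinner_add_left)
  then show ?thesis by (simp add: cinner_commute[of x])
qed

lemma cinner_zero_left: "cinner 0 (x :: 'a::complex_inner) = 0"
  using cinner_add_left[of 0 0 x] by simp

lemma cinner_diff_left: "cinner (x - y) z = cinner x z - cinner y (z :: 'a::complex_inner)"
  using cinner_add_left[of "x - y" y z] by simp

lemma cinner_diff_right: "cinner x (y - z) = cinner x y - cinner (x :: 'a::complex_inner) z"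
  using cinner_add_right[of x "y - z" z] by simp

lemma cinner_sum_left: "cinner (sum f F) (x :: 'a::complex_inner) = (\<Sum>i\<in>F. cinner (f i) x)"
  by (induction F rule: infinite_finite_induct) (simp_all add: cinner_zero_left cinner_add_left)

lemma cinner_self: "cinner x x = of_real ((norm (x :: 'a::complex_inner))\<^sup>2)"
proof -
  have "Im (cinner x x) = 0" using cinner_commute[of x x] by (simp add: complex_eq_iff)
  then show ?thesis by (simp add: complex_eq_iff power2_norm_eq_inner inner_eq_Re_cinner del: of_real_power)
qed

text \<open>The real Cauchy-Schwarz inequality is applied after a rotation of x by the phase that
  makes the product nonnegative.\<close>

lemma norm_cinner_le: "cmod (cinner x y) \<le> norm x * norm (y :: 'a::complex_inner)"
proof -
  define z where "z = cinner x y"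
  have "cnj (sgn z) * z = of_real (cmod z)"
    by (cases "z = 0") (simp_all add: sgn_eq complex_norm_square[symmetric] mult.commute[of "cnj z"] power2_eq_square)
  then have "cmod z = Re (cinner (cnj (sgn z) *\<^sub>C x) y)" by (simp add: cinner_scaleC_left z_def)
  also have "\<dots> \<le> norm (cnj (sgn z) *\<^sub>C x) * norm y"
    unfolding inner_eq_Re_cinner[symmetric] by (rule norm_cauchy_schwarz)
  also have "\<dots> \<le> 1 * norm x * norm y"
    unfolding norm_scaleC by (intro mult_right_mono) (auto simp: norm_sgn)
  finally show ?thesis by (simp add: z_def)
qed

lemma tendsto_cinner_left:
  assumes "f \<longlonglongrightarrow> (x :: 'a::complex_inner)" shows "(\<lambda>n. cinner (f n) y) \<longlonglongrightarrow> cinner x y"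
proof -
  have "(\<lambda>n. norm (f n - x) * norm y) \<longlonglongrightarrow> 0 * norm y"
    by (intro tendsto_mult tendsto_const tendsto_norm_zero LIM_zero assms)
  then have lim: "(\<lambda>n. norm (f n - x) * norm y) \<longlonglongrightarrow> 0" by (simp only: mult_zero_left)
  have "(\<lambda>n. cinner (f n) y - cinner x y) \<longlonglongrightarrow> 0"
    unfolding cinner_diff_left[symmetric] by (rule Lim_null_comparison[OF always_eventually lim]) (intro allI norm_cinner_le)
  then show ?thesis by (simp add: LIM_zero_iff)
qed

lemma bohr_ap_ap_fun: "bohr_ap (ap_fun f)" using ap_fun by auto

lift_definition ap_shift :: "real \<Rightarrow> ap \<Rightarrow> ap" is "\<lambda>r f t. f (t + r)"
  using bohr_ap_shift by (simp add: add.commute)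

lemma norm_ap_shift: "norm (ap_shift r f) = norm f"
proof -
  have "bohr_ap (\<lambda>t. ap_fun f t * cnj (ap_fun f t))" by (intro bohr_ap_mult bohr_ap_cnj bohr_ap_ap_fun)
  from ap_mean_shift[OF this, of r] have "cinner (ap_shift r f) (ap_shift r f) = cinner f f"
    by (simp add: cinner_ap.rep_eq ap_shift.rep_eq add.commute)
  then show ?thesis by (simp add: cinner_self flip: of_real_power)
qed

lemma ap_shift_diff: "ap_shift r (f - g) = ap_shift r f - ap_shift r g" by transfer simp

lemma autocorr_ap_fun: "autocorr (ap_fun f) x = cinner (ap_shift x f) f"
  by (simp add: autocorr_def cinner_ap.rep_eq ap_shift.rep_eq)

text \<open>Translations are isometries, so the bound is uniform in x: convergence in norm forces
  uniform convergence of the autocorrelations.\<close>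

lemma autocorr_diff_le:
  "cmod (autocorr (ap_fun f) x - autocorr (ap_fun g) x) \<le> norm (f - g) * (norm f + norm g)"
proof -
  have "autocorr (ap_fun f) x - autocorr (ap_fun g) x = cinner (ap_shift x (f - g)) f + cinner (ap_shift x g) (f - g)"
    by (simp add: autocorr_ap_fun ap_shift_diff cinner_diff_left cinner_diff_right)
  also have "cmod \<dots> \<le> norm (f - g) * norm f + norm g * norm (f - g)"
    using norm_cinner_le[of "ap_shift x (f - g)" f] norm_cinner_le[of "ap_shift x g" "f - g"]
    by (intro order_trans[OF norm_triangle_ineq] add_mono) (simp_all add: norm_ap_shift)
  finally show ?thesis by (simp add: algebra_simps)
qed

lemma ap_fun_ap_exp: "ap_fun (ap_exp x) = (\<lambda>t. cis (x * t))"
  by (simp only: ap_exp.rep_eq cis_conv_exp)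

lemma cinner_ap_exp: "cinner f (ap_exp x) = ap_mean (\<lambda>t. ap_fun f t * cis (- (x * t)))"
  by (simp add: cinner_ap.rep_eq ap_fun_ap_exp cis_cnj)

lemma norm_ap_exp: "norm (ap_exp x) = 1"
proof -
  have "cinner (ap_exp x) (ap_exp x) = 1"
    by (simp add: cinner_ap_exp ap_fun_ap_exp cis_mult ap_mean_const)
  then have "complex_of_real ((norm (ap_exp x))\<^sup>2) = of_real 1" by (simp only: cinner_self of_real_1)
  then have "(norm (ap_exp x))\<^sup>2 = 1" by (simp only: of_real_eq_iff)
  then show ?thesis by (simp add: power2_eq_1_iff) (use norm_ge_zero[of "ap_exp x"] in linarith)
qed

lemma bohr_ap_uniform_limit:
  assumes f: "\<And>n. bohr_ap (f n)" and lim: "\<And>\<epsilon>. \<epsilon> > 0 \<Longrightarrow> \<exists>n. \<forall>t. cmod (f n t - F t) \<le> \<epsilon>"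
  shows "bohr_ap F"
proof -
  have tri: "cmod (F s - F t) \<le> \<epsilon>" if "\<forall>t. cmod (f n t - F t) \<le> \<epsilon> / 3" "cmod (f n s - f n t) \<le> \<epsilon> / 3" for n s t \<epsilon>
  proof -
    have "F s - F t = (f n s - f n t) - (f n s - F s) + (f n t - F t)" by simp
    then have "cmod (F s - F t) \<le> cmod (f n s - f n t) + cmod (f n s - F s) + cmod (f n t - F t)"
      by (metis norm_triangle_ineq norm_triangle_ineq4 add_mono_thms_linordered_semiring(3) order_trans)
    then show ?thesis using that(1)[rule_format, of s] that(1)[rule_format, of t] that(2) by linarith
  qed
  show ?thesis
  proof (rule bohr_apI_net)
    show "continuous_on UNIV F"
      unfolding continuous_on_iff
    proof safe
      fix t \<epsilon> :: real assume e: "\<epsilon> > 0"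
      then have e': "\<epsilon> / 2 / 3 > 0" by simp
      obtain n where n: "\<forall>t. cmod (f n t - F t) \<le> \<epsilon> / 2 / 3" using lim[OF e'] by blast
      obtain d where d: "d > 0" "\<And>s t. \<bar>s - t\<bar> < d \<Longrightarrow> cmod (f n s - f n t) < \<epsilon> / 2 / 3" using bohr_ap_uniform[OF f e'] by blast
      have "dist (F s) (F t) < \<epsilon>" if "dist s t < d" for s
      proof -
        have "cmod (F s - F t) \<le> \<epsilon> / 2" using that d(2)[of s t] by (intro tri[OF n] less_imp_le) (simp add: dist_real_def)
        then show ?thesis using e by (simp add: dist_norm)
      qed
      then show "\<exists>d>0. \<forall>s\<in>UNIV. dist s t < d \<longrightarrow> dist (F s) (F t) < \<epsilon>" using d(1) by blast
    qed
    fix \<epsilon> :: real assume "\<epsilon> > 0"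
    then have e': "\<epsilon> / 3 > 0" by simp
    obtain n where n: "\<forall>t. cmod (f n t - F t) \<le> \<epsilon> / 3" using lim[OF e'] by blast
    obtain S where S: "finite S" "\<And>s. \<exists>s'\<in>S. \<forall>t. cmod (f n (t + s) - f n (t + s')) \<le> \<epsilon> / 3" using bohr_ap_net[OF f e'] by blast
    then show "\<exists>S. finite S \<and> (\<forall>s. \<exists>s'\<in>S. \<forall>t. cmod (F (t + s) - F (t + s')) \<le> \<epsilon>)" using tri[OF n] by meson
  qed
qed

lemma fourier_coeff_zero_imp_zero:
  assumes u: "\<And>\<mu>. fourier_coeff u \<mu> = 0" shows "u = 0"
proof -
  have "\<exists>f. dist (to_completion f) u < 1 / real (Suc n)" for n
  proof -
    have "u \<in> closure (range to_completion)" by (simp add: closure_to_completion)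
    then have "\<exists>y\<in>range to_completion. dist y u < 1 / real (Suc n)" unfolding closure_approachable by simp
    then show ?thesis by blast
  qed
  then obtain f where f: "\<And>n. norm (to_completion (f n) - u) < 1 / real (Suc n)" unfolding dist_norm by metis
  define B where "B = norm u + 1"
  have fB: "norm (f n) \<le> B" for n
  proof -
    have "norm (f n) \<le> norm u + norm (to_completion (f n) - u)"
      using norm_triangle_ineq[of u "to_completion (f n) - u"] by (simp add: norm_to_completion)
    also have "norm (to_completion (f n) - u) \<le> 1" by (rule order_trans[OF less_imp_le[OF f]]) simp
    finally show ?thesis by (simp add: B_def)
  qed
  have B: "B > 0" by (simp add: B_def add_nonneg_pos)
  have fd: "norm (f n - f k) \<le> 1 / real (Suc n) + 1 / real (Suc k)" for n k
  proof -
    have "norm (f n - f k) = norm ((to_completion (f n) - u) - (to_completion (f k) - u))"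
      by (simp add: to_completion_diff norm_to_completion)
    also have "\<dots> \<le> norm (to_completion (f n) - u) + norm (to_completion (f k) - u)" by (rule norm_triangle_ineq4)
    finally show ?thesis using f[of n] f[of k] by linarith
  qed
  define F where "F n = autocorr (ap_fun (f n))" for n
  have F: "bohr_ap (F n)" for n unfolding F_def by (intro bohr_ap_autocorr bohr_ap_ap_fun)
  have Fd: "cmod (F n x - F k x) \<le> 2 * B * (1 / real (Suc n) + 1 / real (Suc k))" for n k x
  proof -
    have "cmod (F n x - F k x) \<le> norm (f n - f k) * (norm (f n) + norm (f k))" unfolding F_def by (rule autocorr_diff_le)
    also have "\<dots> \<le> (1 / real (Suc n) + 1 / real (Suc k)) * (B + B)" by (intro mult_mono fd add_mono fB) auto
    finally show ?thesis by (simp add: mult.commute)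
  qed
  note inv0 = LIMSEQ_inverse_Suc
  have FC: "Cauchy (\<lambda>n. F n x)" for x
  proof (rule CauchyI')
    fix e :: real assume e: "e > 0"
    have "(\<lambda>n. 2 * B * (1 / real (Suc n) + 1 / real (Suc n))) \<longlonglongrightarrow> 2 * B * (0 + 0)" by (intro tendsto_intros inv0)
    then have "\<forall>\<^sub>F n in sequentially. 2 * B * (1 / real (Suc n) + 1 / real (Suc n)) < e" using e by (intro order_tendstoD(2)) auto
    then obtain N where N: "2 * B * (1 / real (Suc N) + 1 / real (Suc N)) < e" using eventually_happens' sequentially_bot by blast
    have "dist (F m x) (F n x) < e" if "m \<ge> N" "n > m" for m n
    proof -
      have "2 * B * (1 / real (Suc m) + 1 / real (Suc n)) \<le> 2 * B * (1 / real (Suc N) + 1 / real (Suc N))"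
        using that B by (intro mult_left_mono add_mono divide_left_mono) auto
      then show ?thesis using Fd[of m x n] N by (simp add: dist_norm)
    qed
    then show "\<exists>M. \<forall>m\<ge>M. \<forall>n>m. dist (F m x) (F n x) < e" by blast
  qed
  define G where "G x = lim (\<lambda>n. F n x)" for x
  have G: "(\<lambda>n. F n x) \<longlonglongrightarrow> G x" for x
    using Cauchy_convergent[OF FC[of x]] unfolding G_def by (simp add: convergent_LIMSEQ_iff)
  have FG: "cmod (F n x - G x) \<le> 2 * B * (1 / real (Suc n))" for n x
  proof (rule LIMSEQ_le[OF tendsto_norm[OF tendsto_diff[OF tendsto_const G]]])
    have "(\<lambda>k. 2 * B * (1 / real (Suc n) + 1 / real (Suc k))) \<longlonglongrightarrow> 2 * B * (1 / real (Suc n) + 0)" by (intro tendsto_intros inv0)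
    then show "(\<lambda>k. 2 * B * (1 / real (Suc n) + 1 / real (Suc k))) \<longlonglongrightarrow> 2 * B * (1 / real (Suc n))" by simp
  qed (use Fd in blast)
  have Gap: "bohr_ap G"
  proof (rule bohr_ap_uniform_limit[OF F])
    fix \<epsilon> :: real assume "\<epsilon> > 0"
    have "(\<lambda>n. 2 * B * (1 / real (Suc n))) \<longlonglongrightarrow> 2 * B * 0" by (intro tendsto_intros inv0)
    then have "\<forall>\<^sub>F n in sequentially. 2 * B * (1 / real (Suc n)) < \<epsilon>" using \<open>\<epsilon> > 0\<close> by (intro order_tendstoD(2)) auto
    then obtain n where "2 * B * (1 / real (Suc n)) < \<epsilon>" using eventually_happens' sequentially_bot by blast
    then show "\<exists>n. \<forall>t. cmod (F n t - G t) \<le> \<epsilon>" using FG by (meson order_trans less_imp_le)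
  qed
  \<comment> \<open>All coefficients of \<open>u\<close> vanish, so each coefficient of
    \<open>f n\<close> is one of the difference \<open>to_completion (f n) - u\<close> and inherits
    its small norm.\<close>
  have coef: "cmod (ap_mean (\<lambda>t. ap_fun (f n) t * cis (- (x * t)))) \<le> 1 / real (Suc n)" for n x
  proof -
    have "ap_mean (\<lambda>t. ap_fun (f n) t * cis (- (x * t))) = cinner (to_completion (f n) - u) (to_completion (ap_exp x))"
      using u[of x] by (simp add: cinner_ap_exp[symmetric] cinner_diff_left cinner_to_completion fourier_coeff_def)
    then show ?thesis
      using norm_cinner_le[of "to_completion (f n) - u" "to_completion (ap_exp x)"] f[of n] by (simp add: norm_to_completion norm_ap_exp)
  qed
  have FB: "cmod (F n y) \<le> B\<^sup>2" for n y
  proof -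
    have "cmod (F n y) \<le> norm (f n) * norm (f n)"
      unfolding F_def autocorr_ap_fun using norm_cinner_le[of "ap_shift y (f n)" "f n"] by (simp add: norm_ap_shift)
    also have "\<dots> \<le> B * B" using B by (intro mult_mono fB) auto
    finally show ?thesis by (simp add: power2_eq_square)
  qed
  \<comment> \<open>The bound for \<open>F n\<close> is transferred by (a + b)^2 <= 2 * a^2 + 2 *
    b^2 with the uniform distance 2 * B / Suc n. The constant is 2 * 16 + 8 = 40.\<close>
  have mean: "Re (ap_mean (\<lambda>y. G y * cnj (G y))) \<le> 40 * B\<^sup>2 * (1 / real (Suc n))\<^sup>2" for n
  proof -
    define D where "D y = 2 * (F n y * cnj (F n y)) + of_real (8 * B\<^sup>2 * (1 / real (Suc n))\<^sup>2)" for y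
    have FF: "bohr_ap (\<lambda>y. F n y * cnj (F n y))" by (intro bohr_ap_mult bohr_ap_cnj F)
    have D: "bohr_ap D" unfolding D_def by (intro bohr_ap_add bohr_ap_mult[OF bohr_ap_const FF] bohr_ap_const)
    have "Re (ap_mean (\<lambda>y. G y * cnj (G y))) \<le> Re (ap_mean D)"
    proof (rule ap_mean_Re_mono[OF bohr_ap_mult[OF Gap bohr_ap_cnj[OF Gap]] D])
      fix y
      have "cmod (G y) \<le> cmod (F n y) + 2 * B * (1 / real (Suc n))"
        using FG[of n y] norm_triangle_ineq2[of "G y" "F n y"] by (simp add: norm_minus_commute)
      then have "(cmod (G y))\<^sup>2 \<le> (cmod (F n y) + 2 * B * (1 / real (Suc n)))\<^sup>2" by (intro power_mono) auto
      also have "\<dots> \<le> 2 * (cmod (F n y))\<^sup>2 + 2 * (2 * B * (1 / real (Suc n)))\<^sup>2"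
        using zero_le_power2[of "cmod (F n y) - 2 * B * (1 / real (Suc n))"] unfolding power2_sum power2_diff by linarith
      also have "\<dots> = 2 * (cmod (F n y))\<^sup>2 + 8 * B\<^sup>2 * (1 / real (Suc n))\<^sup>2" by (simp add: power_mult_distrib power_divide)
      finally have le: "(cmod (G y))\<^sup>2 \<le> 2 * (cmod (F n y))\<^sup>2 + 8 * B\<^sup>2 * (1 / real (Suc n))\<^sup>2" .
      have "D y = of_real (2 * (cmod (F n y))\<^sup>2 + 8 * B\<^sup>2 * (1 / real (Suc n))\<^sup>2)"
        unfolding D_def by (simp only: complex_norm_square[symmetric] of_real_add of_real_mult of_real_numeral)
      with le show "Re (G y * cnj (G y)) \<le> Re (D y)"
        by (simp only: complex_norm_square[symmetric] Re_complex_of_real)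
    qed
    also have "\<dots> = Re (2 * ap_mean (\<lambda>y. F n y * cnj (F n y)) + of_real (8 * B\<^sup>2 * (1 / real (Suc n))\<^sup>2))"
      unfolding D_def by (subst ap_mean_add[OF bohr_ap_mult[OF bohr_ap_const FF] bohr_ap_const]) (simp only: ap_mean_cmult[OF FF] ap_mean_const)
    also have "\<dots> = 2 * Re (ap_mean (\<lambda>y. F n y * cnj (F n y))) + 8 * B\<^sup>2 * (1 / real (Suc n))\<^sup>2"
      by (simp only: plus_complex.sel Re_complex_of_real) simp
    also have "\<dots> \<le> 2 * (16 * (1 / real (Suc n))\<^sup>2 * B\<^sup>2) + 8 * B\<^sup>2 * (1 / real (Suc n))\<^sup>2"
      unfolding F_def
      by (intro add_mono mult_left_mono ap_mean_autocorr_sq_le bohr_ap_ap_fun coef FB[unfolded F_def]) auto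
    finally show ?thesis by simp
  qed
  have "(\<lambda>n. 40 * B\<^sup>2 * (1 / real (Suc n))\<^sup>2) \<longlonglongrightarrow> 40 * B\<^sup>2 * 0\<^sup>2" by (intro tendsto_intros inv0)
  then have "Re (ap_mean (\<lambda>y. G y * cnj (G y))) \<le> 40 * B\<^sup>2 * 0\<^sup>2" by (rule LIMSEQ_le_const) (use mean in blast)
  moreover have nn: "0 \<le> Re (G y * cnj (G y))" for y by (simp flip: complex_norm_square of_real_power)
  moreover have "0 \<le> Re (ap_mean (\<lambda>y. G y * cnj (G y)))"
    using ap_mean_Re_mono[OF bohr_ap_const bohr_ap_mult[OF Gap bohr_ap_cnj[OF Gap]], of 0] nn by (simp add: ap_mean_const)
  ultimately have "Re (ap_mean (\<lambda>y. G y * cnj (G y))) = 0" by simp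
  from ap_mean_pos_definite[OF bohr_ap_mult[OF Gap bohr_ap_cnj[OF Gap]] nn this, of 0]
  have G0: "G 0 = 0" by (simp flip: complex_norm_square of_real_power)
  \<comment> \<open>At 0 the autocorrelations are the squared norms of \<open>f n\<close>, so
    \<open>G 0\<close> is also the squared norm of \<open>u\<close>.\<close>
  have "(\<lambda>n. to_completion (f n) - u) \<longlonglongrightarrow> 0"
    by (rule Lim_null_comparison[OF always_eventually inv0]) (use f in \<open>auto intro: less_imp_le\<close>)
  then have "(\<lambda>n. norm (to_completion (f n))) \<longlonglongrightarrow> norm u" by (intro tendsto_norm) (simp add: LIM_zero_iff)
  then have "(\<lambda>n. complex_of_real ((norm (f n))\<^sup>2)) \<longlonglongrightarrow> of_real ((norm u)\<^sup>2)" by (intro tendsto_intros) (simp add: norm_to_completion)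
  moreover have "complex_of_real ((norm (f n))\<^sup>2) = F n 0" for n
  proof -
    have "ap_shift 0 (f n) = f n" by transfer simp
    then show ?thesis by (simp only: F_def autocorr_ap_fun cinner_self)
  qed
  ultimately have "(\<lambda>n. F n 0) \<longlonglongrightarrow> of_real ((norm u)\<^sup>2)" by simp
  from LIMSEQ_unique[OF this G[of 0]] show ?thesis by (simp add: G0)
qed

section \<open>Fourier expansions in AP_2\<close>

definition expo :: "real \<Rightarrow> ap2" where "expo \<mu> = to_completion (ap_exp \<mu>)"

lemma fourier_coeff_expo: "fourier_coeff f \<mu> = cinner f (expo \<mu>)"
  by (simp add: fourier_coeff_def expo_def)

lemma norm_expo: "norm (expo \<mu>) = 1" by (simp add: expo_def norm_to_completion norm_ap_exp)

lemma ap_mean_cis_nonzero: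
  assumes "x \<noteq> 0" shows "ap_mean (\<lambda>t. cis (x * t)) = 0"
proof (rule ap_mean_eqI, rule Lim_null_comparison)
  show "((\<lambda>T. (2 / \<bar>x\<bar>) / (2 * T)) \<longlongrightarrow> 0) at_top" by real_asymp
  show "\<forall>\<^sub>F T in at_top. norm (integral {-T..T} (\<lambda>t. cis (x * t)) / of_real (2 * T)) \<le> (2 / \<bar>x\<bar>) / (2 * T)"
    using eventually_gt_at_top[of "0::real"]
  proof eventually_elim
    case (elim T)
    have "((\<lambda>t. cis (x * t)) has_integral (cis (x * T) / (\<i> * of_real x) - cis (x * (-T)) / (\<i> * of_real x))) {-T..T}"
    proof (rule fundamental_theorem_of_calculus)
      fix t show "((\<lambda>t. cis (x * t) / (\<i> * of_real x)) has_vector_derivative cis (x * t)) (at t within {-T..T})"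
        unfolding cis_conv_exp of_real_mult
        by (rule has_vector_derivative_real_field[where f="\<lambda>z. exp (\<i> * (of_real x * z)) / (\<i> * of_real x)"])
           ((rule derivative_eq_intros refl | use assms in \<open>simp add: field_simps\<close>)+)
    qed (use elim in auto)
    then have "integral {-T..T} (\<lambda>t. cis (x * t)) = cis (x * T) / (\<i> * of_real x) - cis (x * (-T)) / (\<i> * of_real x)"
      by (rule integral_unique)
    also have "cmod \<dots> \<le> cmod (cis (x * T) / (\<i> * of_real x)) + cmod (cis (x * (-T)) / (\<i> * of_real x))" by (rule norm_triangle_ineq4)
    also have "\<dots> = 2 / \<bar>x\<bar>" by (simp add: norm_divide norm_mult)
    finally have "cmod (integral {-T..T} (\<lambda>t. cis (x * t))) / (2 * T) \<le> 2 / \<bar>x\<bar> / (2 * T)"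
      using elim by (intro divide_right_mono) auto
    moreover have "cmod (of_real (2 * T)) = 2 * T" using elim by simp
    ultimately show ?case by (simp only: norm_divide)
  qed
qed

lemma cinner_expo: "cinner (expo \<mu>) (expo \<nu>) = (if \<mu> = \<nu> then 1 else 0)"
proof -
  have "cinner (expo \<mu>) (expo \<nu>) = ap_mean (\<lambda>t. cis ((\<mu> - \<nu>) * t))"
    unfolding expo_def cinner_to_completion cinner_ap_exp ap_fun_ap_exp by (simp add: cis_mult left_diff_distrib)
  then show ?thesis using ap_mean_cis_nonzero[of "\<mu> - \<nu>"] by (simp add: ap_mean_const)
qed

lemma fourier_coeff_sum:
  assumes "finite F" shows "fourier_coeff (\<Sum>\<mu>\<in>F. c \<mu> *\<^sub>C expo \<mu>) \<nu> = (if \<nu> \<in> F then c \<nu> else 0)"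
  using assms by (simp add: fourier_coeff_expo cinner_sum_left cinner_scaleC_left cinner_expo if_distrib sum.delta' cong: if_cong)

lemma cinner_trig_left: "cinner (\<Sum>\<mu>\<in>F. c \<mu> *\<^sub>C expo \<mu>) f = (\<Sum>\<mu>\<in>F. c \<mu> * cnj (fourier_coeff f \<mu>))"
  unfolding cinner_sum_left cinner_scaleC_left fourier_coeff_expo by (subst cinner_commute) (rule refl)

lemma norm_trig_sq:
  assumes "finite F" shows "(norm (\<Sum>\<mu>\<in>F. c \<mu> *\<^sub>C expo \<mu>))\<^sup>2 = (\<Sum>\<mu>\<in>F. (cmod (c \<mu>))\<^sup>2)"
proof -
  have "complex_of_real ((norm (\<Sum>\<mu>\<in>F. c \<mu> *\<^sub>C expo \<mu>))\<^sup>2) = (\<Sum>\<mu>\<in>F. c \<mu> * cnj (c \<mu>))"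
    unfolding cinner_self[symmetric] cinner_trig_left using assms by (simp add: fourier_coeff_sum)
  also have "\<dots> = of_real (\<Sum>\<mu>\<in>F. (cmod (c \<mu>))\<^sup>2)" by (simp only: complex_norm_square[symmetric] of_real_sum)
  finally show ?thesis by (simp only: of_real_eq_iff)
qed

lemma tendsto_fourier_coeff: "f \<longlonglongrightarrow> h \<Longrightarrow> (\<lambda>n. fourier_coeff (f n) \<mu>) \<longlonglongrightarrow> fourier_coeff h \<mu>"
  unfolding fourier_coeff_expo by (rule tendsto_cinner_left)

text \<open>Increasing finite sets with tails below (1 / Suc n)^2 reduce the uncountable index set
  to a Cauchy sequence of partial sums. The second conclusion retains that these partial sums
  approximate the limit.\<close>

lemma riesz_fischer:
  assumes c: "(\<lambda>\<mu>. (cmod (c \<mu>))\<^sup>2) summable_on UNIV"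
  obtains h where "\<And>\<mu>. fourier_coeff h \<mu> = c \<mu>"
    "\<And>\<epsilon>. \<epsilon> > 0 \<Longrightarrow> \<exists>F. finite F \<and> norm (h - (\<Sum>\<mu>\<in>F. c \<mu> *\<^sub>C expo \<mu>)) < \<epsilon>"
proof -
  have "\<forall>n. \<exists>L. finite L \<and> (\<forall>F. finite F \<longrightarrow> F \<inter> L = {} \<longrightarrow> (\<Sum>\<mu>\<in>F. (cmod (c \<mu>))\<^sup>2) \<le> (1 / real (Suc n))\<^sup>2)"
  proof
    fix n
    have "(1 / real (Suc n))\<^sup>2 > 0" by simp
    from summable_on_finite_tail[OF c _ this] show "\<exists>L. finite L \<and> (\<forall>F. finite F \<longrightarrow> F \<inter> L = {} \<longrightarrow> (\<Sum>\<mu>\<in>F. (cmod (c \<mu>))\<^sup>2) \<le> (1 / real (Suc n))\<^sup>2)"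
      by (metis zero_le_power2)
  qed
  from choice[OF this] obtain L where L: "\<And>n. finite (L n)"
    "\<And>n F. finite F \<Longrightarrow> F \<inter> L n = {} \<Longrightarrow> (\<Sum>\<mu>\<in>F. (cmod (c \<mu>))\<^sup>2) \<le> (1 / real (Suc n))\<^sup>2"
    by blast
  define S where "S n = (\<Union>k\<le>n. L k)" for n
  have S: "finite (S n)" "L n \<subseteq> S n" for n using L(1) by (auto simp: S_def)
  have Sm: "S m \<subseteq> S n" if "m \<le> n" for m n unfolding S_def using that by (intro UN_mono) auto
  define g where "g n = (\<Sum>\<mu>\<in>S n. c \<mu> *\<^sub>C expo \<mu>)" for n
  have gd: "norm (g n - g m) \<le> 1 / real (Suc m)" if "m \<le> n" for m n
  proof -
    have "g n - g m = (\<Sum>\<mu>\<in>S n - S m. c \<mu> *\<^sub>C expo \<mu>)"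
      unfolding g_def using Sm[OF that] S(1) by (simp add: sum_diff)
    then have "(norm (g n - g m))\<^sup>2 = (\<Sum>\<mu>\<in>S n - S m. (cmod (c \<mu>))\<^sup>2)" using S(1) by (simp add: norm_trig_sq)
    also have "\<dots> \<le> (1 / real (Suc m))\<^sup>2" using S by (intro L(2)) auto
    finally show ?thesis by (rule power2_le_imp_le) simp
  qed
  note inv0 = LIMSEQ_inverse_Suc
  have small: "\<exists>N. 1 / real (Suc N) < e" if "e > 0" for e :: real
    using order_tendstoD(2)[OF inv0 that] eventually_happens' sequentially_bot by blast
  have "Cauchy g"
  proof (rule CauchyI')
    fix e :: real assume "e > 0"
    then obtain N where N: "1 / real (Suc N) < e" using small by blast
    have "dist (g m) (g n) < e" if "m \<ge> N" "n > m" for m n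
    proof -
      have "1 / real (Suc m) \<le> 1 / real (Suc N)" using that by (intro divide_left_mono) auto
      then show ?thesis using gd[of m n] that N by (simp add: dist_norm norm_minus_commute)
    qed
    then show "\<exists>M. \<forall>m\<ge>M. \<forall>n>m. dist (g m) (g n) < e" by blast
  qed
  then obtain h where h: "g \<longlonglongrightarrow> h" using Cauchy_convergent unfolding convergent_def by blast
  show ?thesis
  proof (rule that[of h])
    fix \<mu>
    have "(\<lambda>n. fourier_coeff (g n) \<mu>) \<longlonglongrightarrow> c \<mu>"
    proof (cases "\<exists>N. \<mu> \<in> S N")
      case True
      then obtain N where "\<mu> \<in> S N" by blast
      then have "\<forall>n\<ge>N. fourier_coeff (g n) \<mu> = c \<mu>" using Sm S(1) by (auto simp: g_def fourier_coeff_sum)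
      then show ?thesis by (intro tendsto_eventually) (auto simp: eventually_sequentially)
    next
      \<comment> \<open>An index outside all \<open>S n\<close> is bounded by every tail, so its
        coefficient is 0, in agreement with all partial sums.\<close>
      case False
      have "(cmod (c \<mu>))\<^sup>2 \<le> (1 / real (Suc n))\<^sup>2" for n
        using L(2)[of "{\<mu>}" n] False S(2)[of n] by auto
      then have "cmod (c \<mu>) \<le> 1 / real (Suc n)" for n by (rule power2_le_imp_le) simp
      then have "cmod (c \<mu>) \<le> 0" by (intro LIMSEQ_le_const[OF inv0]) blast
      then show ?thesis using False S(1) by (simp add: g_def fourier_coeff_sum)
    qed
    then show "fourier_coeff h \<mu> = c \<mu>" using tendsto_fourier_coeff[OF h] LIMSEQ_unique by blast
  next
    fix \<epsilon> :: real assume "\<epsilon> > 0"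
    then obtain n where "dist (g n) h < \<epsilon>" using h[THEN tendstoD] eventually_happens' sequentially_bot by blast
    then show "\<exists>F. finite F \<and> norm (h - (\<Sum>\<mu>\<in>F. c \<mu> *\<^sub>C expo \<mu>)) < \<epsilon>"
      using S(1) by (intro exI[of _ "S n"]) (simp add: g_def dist_norm norm_minus_commute)
  qed
qed

lemma fourier_coeff_diff: "fourier_coeff (f - g) \<mu> = fourier_coeff f \<mu> - fourier_coeff g \<mu>"
  by (simp add: fourier_coeff_expo cinner_diff_left)

lemma fourier_coeff_eqI: "(\<And>\<mu>. fourier_coeff f \<mu> = fourier_coeff g \<mu>) \<Longrightarrow> f = g"
  using fourier_coeff_zero_imp_zero[of "f - g"] by (simp add: fourier_coeff_diff)

text \<open>Bessel's inequality: a partial sum of f has squared norm S and inner product S with f,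
  so S^2 is at most S times the squared norm of f.\<close>

lemma fourier_coeff_summable: "(\<lambda>\<mu>. (cmod (fourier_coeff f \<mu>))\<^sup>2) summable_on UNIV"
proof (rule nonneg_bdd_above_summable_on)
  have "(\<Sum>\<mu>\<in>F. (cmod (fourier_coeff f \<mu>))\<^sup>2) \<le> (norm f)\<^sup>2" if F: "finite F" for F
  proof -
    define S where "S = (\<Sum>\<mu>\<in>F. (cmod (fourier_coeff f \<mu>))\<^sup>2)"
    define g where "g = (\<Sum>\<mu>\<in>F. fourier_coeff f \<mu> *\<^sub>C expo \<mu>)"
    have S0: "S \<ge> 0" by (auto simp: S_def intro!: sum_nonneg)
    have "cinner g f = of_real S" unfolding g_def cinner_trig_left S_def by (simp only: complex_norm_square[symmetric] of_real_sum)
    then have "S \<le> norm g * norm f" using norm_cinner_le[of g f] S0 by simp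
    then have "S\<^sup>2 \<le> (norm g * norm f)\<^sup>2" using S0 by (intro power_mono)
    also have "\<dots> = S * (norm f)\<^sup>2" unfolding power_mult_distrib g_def norm_trig_sq[OF F] S_def ..
    finally have "S * S \<le> S * (norm f)\<^sup>2" by (simp add: power2_eq_square)
    then show ?thesis unfolding S_def[symmetric] using S0 by (cases "S = 0") auto
  qed
  then show "bdd_above (sum (\<lambda>\<mu>. (cmod (fourier_coeff f \<mu>))\<^sup>2) ` {F. F \<subseteq> UNIV \<and> finite F})" by (intro bdd_aboveI2) auto
qed auto

text \<open>An element rebuilt from the coefficients of f is f itself, because the exponentials are
  complete. Restricting to the spectrum keeps the approximants in \<open>AP2_on M\<close> whenever f
  lies there.\<close>

lemma trig_dense:
  assumes "\<epsilon> > 0" obtains F where "finite F" "F \<subseteq> ap2_spectrum f" "norm (f - (\<Sum>\<mu>\<in>F. fourier_coeff f \<mu> *\<^sub>C expo \<mu>)) < \<epsilon>"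
proof -
  obtain h where h: "\<And>\<mu>. fourier_coeff h \<mu> = fourier_coeff f \<mu>"
    "\<And>\<epsilon>. \<epsilon> > 0 \<Longrightarrow> \<exists>F. finite F \<and> norm (h - (\<Sum>\<mu>\<in>F. fourier_coeff f \<mu> *\<^sub>C expo \<mu>)) < \<epsilon>"
    using riesz_fischer[OF fourier_coeff_summable[of f]] by blast
  have "h = f" by (rule fourier_coeff_eqI) (rule h(1))
  then obtain F where F: "finite F" "norm (f - (\<Sum>\<mu>\<in>F. fourier_coeff f \<mu> *\<^sub>C expo \<mu>)) < \<epsilon>" using h(2)[OF assms] by blast
  have "0 *\<^sub>C x = 0" for x :: ap2 using scaleR_scaleC[of 0 x] by simp
  then have "(\<Sum>\<mu>\<in>F. fourier_coeff f \<mu> *\<^sub>C expo \<mu>) = (\<Sum>\<mu>\<in>F \<inter> ap2_spectrum f. fourier_coeff f \<mu> *\<^sub>C expo \<mu>)"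
    using F(1) by (intro sum.mono_neutral_right) (auto simp: ap2_spectrum_def)
  then show ?thesis using F by (intro that[of "F \<inter> ap2_spectrum f"]) auto
qed

section \<open>Separability of the subspace, and its orthogonal projection\<close>

lemma AP2_on_iff: "f \<in> AP2_on M \<longleftrightarrow> (\<forall>\<mu>. \<mu> \<notin> M \<longrightarrow> fourier_coeff f \<mu> = 0)"
  by (auto simp: AP2_on_def ap2_spectrum_def)

lemma separable_hilbert_space_AP2_on:
  assumes M: "countable M" shows "separable_hilbert_space (AP2_on M)"
  unfolding separable_hilbert_space_def
proof (intro conjI)
  show "complex_subspace (AP2_on M)"
    by (auto simp: complex_subspace_def AP2_on_iff fourier_coeff_expo cinner_zero_left cinner_add_left cinner_scaleC_left)
  show "complete (AP2_on M)"
    unfolding complete_def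
  proof (intro allI impI)
    fix f assume f: "(\<forall>n. f n \<in> AP2_on M) \<and> Cauchy f"
    then obtain h where h: "f \<longlonglongrightarrow> h" using Cauchy_convergent unfolding convergent_def by blast
    have "fourier_coeff h \<mu> = 0" if "\<mu> \<notin> M" for \<mu>
    proof -
      have "(\<lambda>n. fourier_coeff (f n) \<mu>) = (\<lambda>_. 0)" using f that by (auto simp: AP2_on_iff)
      then show ?thesis using tendsto_fourier_coeff[OF h, of \<mu>] by (simp add: LIMSEQ_const_iff)
    qed
    then show "\<exists>l\<in>AP2_on M. f \<longlonglongrightarrow> l" using h by (auto simp: AP2_on_iff)
  qed
  show "separable_space (top_of_set (AP2_on M))"
  proof -
    obtain D :: "complex set" where D: "countable D" "\<And>X. open X \<Longrightarrow> X \<noteq> {} \<Longrightarrow> \<exists>d\<in>D. d \<in> X"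
      using countable_dense_exists by metis
    \<comment> \<open>Finite combinations are encoded as lists of frequency-coefficient pairs,
      because lists over a countable set are countable.\<close>
    define C where "C = (\<lambda>xs. \<Sum>(\<mu>, q)\<leftarrow>xs. q *\<^sub>C expo \<mu>) ` lists (M \<times> D)"
    have cC: "countable C" unfolding C_def using M D(1) by (intro countable_image countable_lists countable_SIGMA)
    have CV: "C \<subseteq> AP2_on M"
    proof -
      have "(\<Sum>(\<mu>, q)\<leftarrow>xs. q *\<^sub>C expo \<mu>) \<in> AP2_on M" if "xs \<in> lists (M \<times> D)" for xs
        using that
      proof (induction xs)
        case Nil then show ?case by (simp add: AP2_on_iff fourier_coeff_expo cinner_zero_left)
      next
        case (Cons a xs)
        then show ?case
          by (cases a) (auto simp: AP2_on_iff fourier_coeff_expo cinner_add_left cinner_scaleC_left cinner_expo)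
      qed
      then show ?thesis by (auto simp: C_def)
    qed
    have "f \<in> closure C" if f: "f \<in> AP2_on M" for f
      unfolding closure_approachable
    proof (intro allI impI)
      fix e :: real assume "e > 0"
      then have e: "e / 2 > 0" by simp
      obtain F where F: "finite F" "F \<subseteq> ap2_spectrum f" "norm (f - (\<Sum>\<mu>\<in>F. fourier_coeff f \<mu> *\<^sub>C expo \<mu>)) < e / 2"
        using trig_dense[OF e] by blast
      have FM: "F \<subseteq> M" using F(2) f by (auto simp: AP2_on_def)
      \<comment> \<open>The total rounding error of the coefficients is at most e / 2; the summand 1
        covers an empty \<open>F\<close>.\<close>
      define \<eta> where "\<eta> = e / 2 / (real (card F) + 1)"
      have \<eta>: "\<eta> > 0" using e by (simp add: \<eta>_def add_nonneg_pos)
      have "\<exists>q\<in>D. q \<in> ball (fourier_coeff f \<mu>) \<eta>" for \<mu> using D(2)[of "ball (fourier_coeff f \<mu>) \<eta>"] \<eta> by auto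
      then obtain q where q: "\<And>\<mu>. q \<mu> \<in> D" "\<And>\<mu>. cmod (fourier_coeff f \<mu> - q \<mu>) < \<eta>" unfolding mem_ball dist_norm by metis
      obtain ys where ys: "distinct ys" "set ys = F" using finite_distinct_list[OF F(1)] by blast
      define g where "g = (\<Sum>\<mu>\<in>F. q \<mu> *\<^sub>C expo \<mu>)"
      have "g = (\<Sum>(\<mu>, q)\<leftarrow>map (\<lambda>\<mu>. (\<mu>, q \<mu>)) ys. q *\<^sub>C expo \<mu>)"
        using ys by (simp add: g_def sum_list_distinct_conv_sum_set o_def)
      moreover have "map (\<lambda>\<mu>. (\<mu>, q \<mu>)) ys \<in> lists (M \<times> D)" using ys FM q(1) by auto
      ultimately have gC: "g \<in> C" unfolding C_def by blast
      have "(\<Sum>\<mu>\<in>F. fourier_coeff f \<mu> *\<^sub>C expo \<mu>) - g = (\<Sum>\<mu>\<in>F. (fourier_coeff f \<mu> - q \<mu>) *\<^sub>C expo \<mu>)"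
      proof -
        have "(a - b) *\<^sub>C x = a *\<^sub>C x - b *\<^sub>C x" for a b and x :: ap2 using scaleC_add_left[of "a - b" b x] by simp
        then show ?thesis by (simp add: g_def sum_subtractf)
      qed
      also have "norm \<dots> \<le> (\<Sum>\<mu>\<in>F. \<eta>)"
        using q(2) by (intro sum_norm_le) (simp add: norm_scaleC norm_expo less_imp_le)
      also have "\<dots> \<le> (real (card F) + 1) * \<eta>" using \<eta> by (simp add: algebra_simps)
      also have "\<dots> = e / 2" unfolding \<eta>_def by (rule nonzero_mult_div_cancel_left[of "real (card F) + 1" "e / 2", unfolded times_divide_eq_right[symmetric]]) simp
      finally have "norm ((\<Sum>\<mu>\<in>F. fourier_coeff f \<mu> *\<^sub>C expo \<mu>) - g) \<le> e / 2" .
      then have "dist g f < e"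
        using F(3) norm_triangle_ineq[of "f - (\<Sum>\<mu>\<in>F. fourier_coeff f \<mu> *\<^sub>C expo \<mu>)" "(\<Sum>\<mu>\<in>F. fourier_coeff f \<mu> *\<^sub>C expo \<mu>) - g"]
        by (simp add: dist_norm norm_minus_commute)
      then show "\<exists>y\<in>C. dist y f < e" using gC by blast
    qed
    then have "top_of_set (AP2_on M) closure_of C = AP2_on M"
      using CV by (auto simp: closure_of_subtopology Int_absorb1)
    then show ?thesis unfolding separable_space_def using cC CV by auto
  qed
qed

text \<open>The projection truncates the coefficients to M. By the second part, testing f in
  \<open>AP2_on M\<close> with a projected vector is the same as testing with the vector itself, so
  frame bounds of the ambient space restrict with the same constants.\<close>

lemma orth_proj_AP2_on:
  shows "orth_proj (AP2_on M) h \<in> AP2_on M" "f \<in> AP2_on M \<Longrightarrow> cinner f (orth_proj (AP2_on M) h) = cinner f h"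
proof -
  define c where "c \<mu> = (if \<mu> \<in> M then fourier_coeff h \<mu> else 0)" for \<mu>
  have "(\<lambda>\<mu>. (cmod (c \<mu>))\<^sup>2) summable_on UNIV"
    by (rule summable_on_comparison_test[OF fourier_coeff_summable[of h]]) (auto simp: c_def)
  then obtain g where g: "\<And>\<mu>. fourier_coeff g \<mu> = c \<mu>" using riesz_fischer by blast
  have gV: "g \<in> AP2_on M" by (simp add: AP2_on_iff g c_def)
  have orth: "cinner v (h - g) = 0" if v: "v \<in> AP2_on M" for v
  proof -
    have "cmod (cinner v (h - g)) \<le> 0 + e" if "e > 0" for e
    proof -
      have e: "e / (norm (h - g) + 1) > 0" using that by (simp add: add_nonneg_pos)
      obtain F where F: "finite F" "F \<subseteq> ap2_spectrum v" "norm (v - (\<Sum>\<mu>\<in>F. fourier_coeff v \<mu> *\<^sub>C expo \<mu>)) < e / (norm (h - g) + 1)"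
        using trig_dense[OF e] by blast
      define p where "p = (\<Sum>\<mu>\<in>F. fourier_coeff v \<mu> *\<^sub>C expo \<mu>)"
      \<comment> \<open>All frequencies of \<open>p\<close> lie in M, where \<open>h\<close> and
        \<open>g\<close> have the same coefficients.\<close>
      have "cinner p (h - g) = 0"
        unfolding p_def cinner_trig_left fourier_coeff_diff g c_def using F(2) v by (intro sum.neutral) (auto simp: AP2_on_def)
      then have "cinner v (h - g) = cinner (v - p) (h - g)" by (simp add: cinner_diff_left)
      also have "cmod \<dots> \<le> norm (v - p) * norm (h - g)" by (rule norm_cinner_le)
      also have "\<dots> \<le> e / (norm (h - g) + 1) * (norm (h - g) + 1)"
        using F(3) e by (intro mult_mono) (auto simp: p_def)
      also have "\<dots> = e" using add_nonneg_pos[OF norm_ge_zero zero_less_one, of "h - g"] by simp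
      finally show ?thesis by simp
    qed
    then have "cmod (cinner v (h - g)) \<le> 0" by (rule field_le_epsilon)
    then show ?thesis by simp
  qed
  have orth': "cinner (h - g) v = 0" if "v \<in> AP2_on M" for v
    using orth[OF that] by (subst cinner_commute) simp
  have "orth_proj (AP2_on M) h = g"
    unfolding orth_proj_def
  proof (rule the_equality)
    show "g \<in> AP2_on M \<and> (\<forall>v\<in>AP2_on M. cinner (h - g) v = 0)" using gV orth' by blast
    fix g' assume g': "g' \<in> AP2_on M \<and> (\<forall>v\<in>AP2_on M. cinner (h - g') v = 0)"
    have d: "g' - g \<in> AP2_on M" using g' gV by (auto simp: AP2_on_iff fourier_coeff_diff)
    have "cinner (g' - g) (g' - g) = cinner (h - g) (g' - g) - cinner (h - g') (g' - g)" by (simp flip: cinner_diff_left)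
    also have "\<dots> = 0" using d g' orth' by simp
    finally show "g' = g" by (simp add: cinner_self)
  qed
  then show "orth_proj (AP2_on M) h \<in> AP2_on M" "f \<in> AP2_on M \<Longrightarrow> cinner f (orth_proj (AP2_on M) h) = cinner f h"
    using gV orth[of f] by (auto simp: cinner_diff_right)
qed

text \<open>The frame inequalities extend from a dense set because the analysis operator is bounded there.\<close>

lemma frame_bounds_dense:
  fixes h :: "'i \<Rightarrow> 'a::complex_inner"
  assumes AB: "A > 0" "B > 0" and dense: "\<And>f \<epsilon>. \<epsilon> > 0 \<Longrightarrow> \<exists>d\<in>D. norm (f - d) < \<epsilon>"
    and sm: "\<And>d. d \<in> D \<Longrightarrow> (\<lambda>i. (cmod (cinner d (h i)))\<^sup>2) summable_on I"
    and lo: "\<And>d. d \<in> D \<Longrightarrow> A * (norm d)\<^sup>2 \<le> (\<Sum>\<^sub>\<infinity>i\<in>I. (cmod (cinner d (h i)))\<^sup>2)"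
    and up: "\<And>d. d \<in> D \<Longrightarrow> (\<Sum>\<^sub>\<infinity>i\<in>I. (cmod (cinner d (h i)))\<^sup>2) \<le> B * (norm d)\<^sup>2"
  shows "(\<lambda>i. (cmod (cinner f (h i)))\<^sup>2) summable_on I"
    and "A * (norm f)\<^sup>2 \<le> (\<Sum>\<^sub>\<infinity>i\<in>I. (cmod (cinner f (h i)))\<^sup>2)"
    and "(\<Sum>\<^sub>\<infinity>i\<in>I. (cmod (cinner f (h i)))\<^sup>2) \<le> B * (norm f)\<^sup>2"
proof -
  have split: "sqrt (\<Sum>i\<in>F. (cmod (cinner x (h i)))\<^sup>2) \<le> sqrt (\<Sum>i\<in>F. (cmod (cinner y (h i)))\<^sup>2) + sqrt (\<Sum>i\<in>F. (cmod (cinner (x - y) (h i)))\<^sup>2)" for x y F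
    using sqrt_sum_norm_triangle[of "\<lambda>i. cinner y (h i)" "\<lambda>i. cinner (x - y) (h i)" F] by (simp add: cinner_diff_left)
  have fin: "(\<Sum>i\<in>F. (cmod (cinner f (h i)))\<^sup>2) \<le> B * (norm f)\<^sup>2" if F: "finite F" "F \<subseteq> I" for F f
  proof -
    \<comment> \<open>A crude bound for the analysis of the remainder on the fixed finite set F. It
      may depend on F, since \<open>d\<close> is chosen after it.\<close>
    define C where "C = sqrt (\<Sum>i\<in>F. (norm (h i))\<^sup>2)"
    have C0: "C \<ge> 0" by (simp add: C_def sum_nonneg)
    have "sqrt (\<Sum>i\<in>F. (cmod (cinner f (h i)))\<^sup>2) \<le> sqrt B * norm f + e" if e: "e > 0" for e
    proof -
      have e': "e / (sqrt B + C + 1) > 0" using e AB C0 by (intro divide_pos_pos add_nonneg_pos add_nonneg_nonneg) auto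
      then obtain d where d: "d \<in> D" "norm (f - d) < e / (sqrt B + C + 1)" using dense by blast
      have 1: "sqrt (\<Sum>i\<in>F. (cmod (cinner d (h i)))\<^sup>2) \<le> sqrt B * norm d"
      proof -
        have "(\<Sum>i\<in>F. (cmod (cinner d (h i)))\<^sup>2) \<le> B * (norm d)\<^sup>2"
          using finite_sum_le_infsum[OF sm[OF d(1)] F] up[OF d(1)] by simp
        then have "sqrt (\<Sum>i\<in>F. (cmod (cinner d (h i)))\<^sup>2) \<le> sqrt (B * (norm d)\<^sup>2)" by (rule real_sqrt_le_mono)
        then show ?thesis by (simp add: real_sqrt_mult)
      qed
      have 2: "sqrt (\<Sum>i\<in>F. (cmod (cinner (f - d) (h i)))\<^sup>2) \<le> norm (f - d) * C"
      proof -
        have "(\<Sum>i\<in>F. (cmod (cinner (f - d) (h i)))\<^sup>2) \<le> (\<Sum>i\<in>F. (norm (f - d) * norm (h i))\<^sup>2)"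
          by (intro sum_mono power_mono norm_cinner_le) auto
        also have "\<dots> = (norm (f - d))\<^sup>2 * (\<Sum>i\<in>F. (norm (h i))\<^sup>2)" by (simp add: power_mult_distrib sum_distrib_left)
        finally have "sqrt (\<Sum>i\<in>F. (cmod (cinner (f - d) (h i)))\<^sup>2) \<le> sqrt ((norm (f - d))\<^sup>2 * (\<Sum>i\<in>F. (norm (h i))\<^sup>2))"
          by (rule real_sqrt_le_mono)
        then show ?thesis by (simp add: real_sqrt_mult C_def)
      qed
      have "norm d \<le> norm f + norm (f - d)" using norm_triangle_ineq2[of d f] by (simp add: norm_minus_commute)
      then have "sqrt B * norm d \<le> sqrt B * norm f + sqrt B * norm (f - d)"
        using AB by (simp flip: distrib_left)
      then have "sqrt (\<Sum>i\<in>F. (cmod (cinner f (h i)))\<^sup>2) \<le> sqrt B * norm f + norm (f - d) * (sqrt B + C)"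
        using split[where F=F and x=f and y=d] 1 2 by (simp add: algebra_simps)
      also have "norm (f - d) * (sqrt B + C) \<le> e / (sqrt B + C + 1) * (sqrt B + C + 1)"
        using d(2) AB C0 less_imp_le[OF e'] by (intro mult_mono) auto
      also have "\<dots> = e" using AB C0 by (simp add: add_nonneg_pos[THEN less_imp_neq, symmetric])
      finally show ?thesis by simp
    qed
    then have "sqrt (\<Sum>i\<in>F. (cmod (cinner f (h i)))\<^sup>2) \<le> sqrt B * norm f" by (rule field_le_epsilon)
    then have "sqrt (\<Sum>i\<in>F. (cmod (cinner f (h i)))\<^sup>2) \<le> sqrt (B * (norm f)\<^sup>2)" by (simp add: real_sqrt_mult)
    then show ?thesis by (simp only: real_sqrt_le_iff)
  qed
  show smf: "(\<lambda>i. (cmod (cinner f (h i)))\<^sup>2) summable_on I"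
    using fin by (intro nonneg_bdd_above_summable_on bdd_aboveI2[of _ _ "B * (norm f)\<^sup>2"]) auto
  show "(\<Sum>\<^sub>\<infinity>i\<in>I. (cmod (cinner f (h i)))\<^sup>2) \<le> B * (norm f)\<^sup>2"
    by (rule infsum_le_finite_sums[OF smf]) (rule fin)
  define S where "S = (\<Sum>\<^sub>\<infinity>i\<in>I. (cmod (cinner f (h i)))\<^sup>2)"
  have S0: "S \<ge> 0" by (auto simp: S_def intro!: infsum_nonneg)
  have "sqrt A * norm f \<le> sqrt S + e" if e: "e > 0" for e
  proof -
    \<comment> \<open>The approximation error enters once through the upper bound, with sqrt B, and
      once through the norm of f, with sqrt A.\<close>
    have e': "e / (sqrt A + sqrt B) > 0" using e AB by (simp add: add_pos_pos)
    then obtain d where d: "d \<in> D" "norm (f - d) < e / (sqrt A + sqrt B)" using dense by blast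
    have dF: "(\<Sum>i\<in>F. (cmod (cinner d (h i)))\<^sup>2) \<le> (sqrt S + sqrt B * norm (f - d))\<^sup>2" if F: "finite F" "F \<subseteq> I" for F
    proof (rule sqrt_le_D)
      have "sqrt (\<Sum>i\<in>F. (cmod (cinner f (h i)))\<^sup>2) \<le> sqrt S"
        unfolding S_def using finite_sum_le_infsum[OF smf F] by simp
      moreover have "sqrt (\<Sum>i\<in>F. (cmod (cinner (d - f) (h i)))\<^sup>2) \<le> sqrt B * norm (f - d)"
        using real_sqrt_le_mono[OF fin[OF F, of "d - f"]] by (simp add: real_sqrt_mult norm_minus_commute)
      ultimately show "sqrt (\<Sum>i\<in>F. (cmod (cinner d (h i)))\<^sup>2) \<le> sqrt S + sqrt B * norm (f - d)"
        using split[where F=F and x=d and y=f] by linarith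
    qed
    have "A * (norm d)\<^sup>2 \<le> (sqrt S + sqrt B * norm (f - d))\<^sup>2"
      using lo[OF d(1)] infsum_le_finite_sums[OF sm[OF d(1)] dF] by linarith
    then have "sqrt (A * (norm d)\<^sup>2) \<le> sqrt S + sqrt B * norm (f - d)" using S0 AB by (intro real_le_lsqrt) auto
    then have 1: "sqrt A * norm d \<le> sqrt S + sqrt B * norm (f - d)" by (simp add: real_sqrt_mult)
    have "norm f \<le> norm d + norm (f - d)" using norm_triangle_ineq[of d "f - d"] by simp
    then have "sqrt A * norm f \<le> sqrt A * norm d + sqrt A * norm (f - d)" using AB by (simp flip: distrib_left)
    with 1 have "sqrt A * norm f \<le> sqrt S + (sqrt A + sqrt B) * norm (f - d)" by (simp add: distrib_right)
    also have "(sqrt A + sqrt B) * norm (f - d) \<le> (sqrt A + sqrt B) * (e / (sqrt A + sqrt B))"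
      using d(2) AB by (intro mult_left_mono) auto
    also have "\<dots> = e" using AB by (simp add: add_pos_pos[THEN less_imp_neq, symmetric])
    finally show ?thesis by simp
  qed
  then have "sqrt A * norm f \<le> sqrt S" by (rule field_le_epsilon)
  then have "sqrt (A * (norm f)\<^sup>2) \<le> sqrt S" by (simp add: real_sqrt_mult)
  then show "A * (norm f)\<^sup>2 \<le> (\<Sum>\<^sub>\<infinity>i\<in>I. (cmod (cinner f (h i)))\<^sup>2)" by (simp add: S_def)
qed

section \<open>Assembly over the cosets of the frequency lattice\<close>

lemma coset_representative:
  assumes "g > 0"
  shows "0 \<le> \<mu> - g * of_int \<lfloor>\<mu> / g\<rfloor>" "\<mu> - g * of_int \<lfloor>\<mu> / g\<rfloor> < g"
    and "0 \<le> w \<Longrightarrow> w < g \<Longrightarrow> (\<exists>p::int. \<mu> = w + g * of_int p) \<longleftrightarrow> w = \<mu> - g * of_int \<lfloor>\<mu> / g\<rfloor>"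
proof -
  show "0 \<le> \<mu> - g * of_int \<lfloor>\<mu> / g\<rfloor>" "\<mu> - g * of_int \<lfloor>\<mu> / g\<rfloor> < g"
    using assms floor_divide_lower[OF assms, of \<mu>] floor_divide_upper[OF assms, of \<mu>] by (simp_all add: algebra_simps)
  assume w: "0 \<le> w" "w < g"
  have "\<lfloor>\<mu> / g\<rfloor> = p" if "\<mu> = w + g * of_int p" for p
    using w assms that by (intro floor_unique) (simp_all add: field_simps)
  then show "(\<exists>p::int. \<mu> = w + g * of_int p) \<longleftrightarrow> w = \<mu> - g * of_int \<lfloor>\<mu> / g\<rfloor>"
    by (metis add_diff_cancel_right' diff_add_cancel)
qed

theorem mainTheorem6:
  fixes \<alpha> \<beta> :: real and \<psi> :: "real \<Rightarrow> complex" and M :: "real set"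
  assumes "\<alpha> > 0" and "\<beta> > 0"
    and "\<psi> \<in> wiener_space \<or>
         (integrable lebesgue \<psi> \<and> fourier_transform \<psi> \<in> wiener_space)"
    and "gabor_frame \<psi> \<alpha> \<beta>"
    and "countable M"
  shows "separable_hilbert_space (AP2_on M) \<and>
    hilbert_frame (AP2_on M) cinner ({0..<2 * pi / \<alpha>} \<times> (UNIV :: int set))
      (\<lambda>i. orth_proj (AP2_on M) (ap2_gabor \<psi> \<alpha> \<beta> i))"
proof
  show "separable_hilbert_space (AP2_on M)" by (rule separable_hilbert_space_AP2_on[OF assms(5)])
  define \<gamma> where "\<gamma> = 2 * pi / \<alpha>"
  have \<gamma>: "\<gamma> > 0" using assms(1) by (simp add: \<gamma>_def)
  define \<phi> where "\<phi> = fourier_transform \<psi>"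
  define h where "h = ap2_gabor \<psi> \<alpha> \<beta>"
  define r where "r \<mu> = \<mu> - \<gamma> * of_int \<lfloor>\<mu> / \<gamma>\<rfloor>" for \<mu>
  note r = coset_representative[OF \<gamma>, folded r_def]
  obtain A B where AB: "A > 0" "B > 0" and fiber:
    "\<And>G c w. finite G \<Longrightarrow> (\<And>\<mu>. \<mu> \<in> G \<Longrightarrow> \<exists>p::int. \<mu> = w + \<gamma> * of_int p) \<Longrightarrow>
      (\<lambda>l::int. (cmod (\<Sum>\<mu>\<in>G. c \<mu> * cnj (\<phi> (\<mu> - \<beta> * of_int l))))\<^sup>2) summable_on UNIV \<and>
      A * (\<Sum>\<mu>\<in>G. (cmod (c \<mu>))\<^sup>2) \<le> (\<Sum>\<^sub>\<infinity>l::int. (cmod (\<Sum>\<mu>\<in>G. c \<mu> * cnj (\<phi> (\<mu> - \<beta> * of_int l))))\<^sup>2) \<and>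
      (\<Sum>\<^sub>\<infinity>l::int. (cmod (\<Sum>\<mu>\<in>G. c \<mu> * cnj (\<phi> (\<mu> - \<beta> * of_int l))))\<^sup>2) \<le> B * (\<Sum>\<mu>\<in>G. (cmod (c \<mu>))\<^sup>2)"
    using gabor_fiber_inequality[OF assms(1-4)] unfolding \<gamma>_def \<phi>_def by blast
  \<comment> \<open>The description by \<open>THE\<close> is meaningful once an element with these
    coefficients exists; it is then unique by completeness of the exponentials.\<close>
  have h: "fourier_coeff (h (w, l)) \<mu> = (if \<exists>p::int. \<mu> = w + \<gamma> * of_int p then \<phi> (\<mu> - \<beta> * of_int l) else 0)" for w l \<mu>
  proof -
    define c where "c \<mu> = (if \<exists>p::int. \<mu> = w + \<gamma> * of_int p then \<phi> (\<mu> - \<beta> * of_int l) else 0)" for \<mu>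
    have "(\<lambda>\<mu>. (cmod (c \<mu>))\<^sup>2) summable_on UNIV"
    proof (rule nonneg_bdd_above_summable_on)
      have "(\<Sum>\<mu>\<in>F. (cmod (c \<mu>))\<^sup>2) \<le> B" if F: "finite F" for F
      proof -
        define G where "G = {\<mu>\<in>F. \<exists>p::int. \<mu> = w + \<gamma> * of_int p}"
        \<comment> \<open>The fiber bound is tested with the samples themselves as coefficients: the
          single index l contributes S^2, and the whole sum is at most B * S. Hence S is at most
          B.\<close>
        define S where "S = (\<Sum>\<mu>\<in>G. (cmod (c \<mu>))\<^sup>2)"
        have G: "finite G" "\<And>\<mu>. \<mu> \<in> G \<Longrightarrow> \<exists>p::int. \<mu> = w + \<gamma> * of_int p" using F by (auto simp: G_def)
        have S0: "S \<ge> 0" by (auto simp: S_def intro!: sum_nonneg)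
        have SF: "(\<Sum>\<mu>\<in>F. (cmod (c \<mu>))\<^sup>2) = S"
          unfolding S_def G_def using F by (intro sum.mono_neutral_right) (auto simp: c_def)
        have "(\<Sum>\<mu>\<in>G. c \<mu> * cnj (\<phi> (\<mu> - \<beta> * of_int l))) = (\<Sum>\<mu>\<in>G. c \<mu> * cnj (c \<mu>))"
          using G(2) by (intro sum.cong refl) (simp add: c_def)
        also have "\<dots> = of_real S" unfolding S_def by (simp only: complex_norm_square[symmetric] of_real_sum)
        finally have "cmod (\<Sum>\<mu>\<in>G. c \<mu> * cnj (\<phi> (\<mu> - \<beta> * of_int l))) = S" using S0 by simp
        then have "S\<^sup>2 \<le> (\<Sum>\<^sub>\<infinity>l::int. (cmod (\<Sum>\<mu>\<in>G. c \<mu> * cnj (\<phi> (\<mu> - \<beta> * of_int l))))\<^sup>2)"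
          using finite_sum_le_infsum[of _ UNIV "{l}", OF conjunct1[OF fiber[OF G, of c]]] by simp
        also have "\<dots> \<le> B * S" unfolding S_def using fiber[OF G, of c] by blast
        finally have "S * S \<le> B * S" by (simp add: power2_eq_square)
        then show ?thesis unfolding SF using S0 AB by (cases "S = 0") auto
      qed
      then show "bdd_above (sum (\<lambda>\<mu>. (cmod (c \<mu>))\<^sup>2) ` {F. F \<subseteq> UNIV \<and> finite F})" by (intro bdd_aboveI2) auto
    qed auto
    then obtain g where g: "\<And>\<mu>. fourier_coeff g \<mu> = c \<mu>" using riesz_fischer by blast
    have "h (w, l) = g"
      unfolding h_def ap2_gabor_def prod.case \<phi>_def[symmetric] \<gamma>_def[symmetric] c_def[symmetric]
      by (rule the_equality) (auto simp: g intro: fourier_coeff_eqI)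
    then show ?thesis by (simp add: g c_def)
  qed
  define E where "E = {0..<\<gamma>} \<times> (UNIV :: int set)"
  define D where "D = {d. \<exists>F c. finite F \<and> d = (\<Sum>\<mu>\<in>F. c \<mu> *\<^sub>C expo \<mu>)}"
  have trig: "(\<lambda>i. (cmod (cinner d (h i)))\<^sup>2) summable_on E \<and>
      A * (norm d)\<^sup>2 \<le> (\<Sum>\<^sub>\<infinity>i\<in>E. (cmod (cinner d (h i)))\<^sup>2) \<and> (\<Sum>\<^sub>\<infinity>i\<in>E. (cmod (cinner d (h i)))\<^sup>2) \<le> B * (norm d)\<^sup>2"
    if "d \<in> D" for d
  proof -
    obtain F c where F: "finite F" and d: "d = (\<Sum>\<mu>\<in>F. c \<mu> *\<^sub>C expo \<mu>)" using \<open>d \<in> D\<close> unfolding D_def by blast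
    \<comment> \<open>The frequencies are sorted by their coset representative in the index range;
      the vectors \<open>h (w, l)\<close> with w in that range see only the part
      \<open>Fw w\<close>.\<close>
    define Fw where "Fw w = {\<mu>\<in>F. r \<mu> = w}" for w
    define T where "T w = (\<Sum>\<^sub>\<infinity>l::int. (cmod (\<Sum>\<mu>\<in>Fw w. c \<mu> * cnj (\<phi> (\<mu> - \<beta> * of_int l))))\<^sup>2)" for w
    have W: "r ` F \<subseteq> {0..<\<gamma>}" using r(1,2) by auto
    have ci: "cinner d (h (w, l)) = (\<Sum>\<mu>\<in>Fw w. c \<mu> * cnj (\<phi> (\<mu> - \<beta> * of_int l)))" if "w \<in> {0..<\<gamma>}" for w l
    proof -
      have "cinner d (h (w, l)) = (\<Sum>\<mu>\<in>F. if r \<mu> = w then c \<mu> * cnj (\<phi> (\<mu> - \<beta> * of_int l)) else 0)"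
        unfolding d cinner_trig_left h using that r(3)[of w] by (intro sum.cong refl) auto
      also have "\<dots> = (\<Sum>\<mu>\<in>Fw w. c \<mu> * cnj (\<phi> (\<mu> - \<beta> * of_int l)))"
        unfolding Fw_def using F by (simp add: sum.inter_filter)
      finally show ?thesis .
    qed
    have fw: "(\<lambda>l::int. (cmod (\<Sum>\<mu>\<in>Fw w. c \<mu> * cnj (\<phi> (\<mu> - \<beta> * of_int l))))\<^sup>2) summable_on UNIV \<and>
        A * (\<Sum>\<mu>\<in>Fw w. (cmod (c \<mu>))\<^sup>2) \<le> T w \<and> T w \<le> B * (\<Sum>\<mu>\<in>Fw w. (cmod (c \<mu>))\<^sup>2)" if "w \<in> {0..<\<gamma>}" for w
      unfolding T_def
    proof (rule fiber[where w=w])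
      show "finite (Fw w)" using F by (simp add: Fw_def)
      show "\<exists>p::int. \<mu> = w + \<gamma> * of_int p" if "\<mu> \<in> Fw w" for \<mu>
        using \<open>w \<in> {0..<\<gamma>}\<close> that r(3)[of w \<mu>] by (auto simp: Fw_def)
    qed
    have hs: "((\<lambda>l. (cmod (cinner d (h (w, l))))\<^sup>2) has_sum T w) UNIV" if "w \<in> r ` F" for w
      using has_sum_infsum[OF conjunct1[OF fw[of w]]] that W unfolding T_def by (subst has_sum_cong[OF arg_cong[OF ci]]) auto
    have sm: "(\<lambda>i. (cmod (cinner d (h i)))\<^sup>2) summable_on (r ` F \<times> UNIV)"
      by (rule summable_on_SigmaI[where g=T]) (use hs F in auto)
    have "((\<lambda>i. (cmod (cinner d (h i)))\<^sup>2) has_sum (\<Sum>w\<in>r ` F. T w)) (r ` F \<times> UNIV)"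
      by (rule has_sum_SigmaI[OF hs _ sm]) (use F in auto)
    \<comment> \<open>Fibers that contain no frequency of \<open>d\<close> contribute 0, which
      reduces the uncountable index set to finitely many w.\<close>
    moreover have "(cmod (cinner d (h i)))\<^sup>2 = 0" if "i \<in> E - r ` F \<times> UNIV" for i
    proof -
      obtain w l where i: "i = (w, l)" by (cases i)
      then have "Fw w = {}" using that by (auto simp: Fw_def)
      then show ?thesis using that ci[of w l] by (simp add: i E_def)
    qed
    ultimately have total: "((\<lambda>i. (cmod (cinner d (h i)))\<^sup>2) has_sum (\<Sum>w\<in>r ` F. T w)) E"
      using W by (subst has_sum_cong_neutral[where T="r ` F \<times> UNIV"]) (auto simp: E_def)
    have nd: "(norm d)\<^sup>2 = (\<Sum>w\<in>r ` F. \<Sum>\<mu>\<in>Fw w. (cmod (c \<mu>))\<^sup>2)"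
      unfolding d norm_trig_sq[OF F] Fw_def by (rule sum.image_gen[OF F])
    have "A * (norm d)\<^sup>2 \<le> (\<Sum>w\<in>r ` F. T w)" "(\<Sum>w\<in>r ` F. T w) \<le> B * (norm d)\<^sup>2"
      unfolding nd sum_distrib_left[where A="r ` F"] using fw W by (auto intro!: sum_mono)
    then show ?thesis using total by (auto simp: infsumI has_sum_imp_summable)
  qed
  have dense: "\<exists>d\<in>D. norm (f - d) < \<epsilon>" if e: "\<epsilon> > 0" for f \<epsilon>
  proof -
    obtain F where "finite F" and F: "norm (f - (\<Sum>\<mu>\<in>F. fourier_coeff f \<mu> *\<^sub>C expo \<mu>)) < \<epsilon>"
      by (rule trig_dense[OF e])
    then have "(\<Sum>\<mu>\<in>F. fourier_coeff f \<mu> *\<^sub>C expo \<mu>) \<in> D" unfolding D_def by blast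
    with F show ?thesis by (rule bexI)
  qed
  have bounds: "(\<lambda>i. (cmod (cinner f (h i)))\<^sup>2) summable_on E \<and>
      A * Re (cinner f f) \<le> (\<Sum>\<^sub>\<infinity>i\<in>E. (cmod (cinner f (h i)))\<^sup>2) \<and>
      (\<Sum>\<^sub>\<infinity>i\<in>E. (cmod (cinner f (h i)))\<^sup>2) \<le> B * Re (cinner f f)" for f
    unfolding cinner_self Re_complex_of_real
    by (intro conjI frame_bounds_dense[OF AB dense trig[THEN conjunct1] trig[THEN conjunct2, THEN conjunct1] trig[THEN conjunct2, THEN conjunct2]])
  show "hilbert_frame (AP2_on M) cinner ({0..<2 * pi / \<alpha>} \<times> (UNIV :: int set)) (\<lambda>i. orth_proj (AP2_on M) (ap2_gabor \<psi> \<alpha> \<beta> i))"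
    unfolding hilbert_frame_def \<gamma>_def[symmetric] E_def[symmetric] h_def[symmetric]
  proof (intro conjI ballI)
    show "orth_proj (AP2_on M) (h i) \<in> AP2_on M" for i by (rule orth_proj_AP2_on(1))
    \<comment> \<open>For f in the subspace each projected vector can be replaced by
      \<open>h i\<close>, so the constants of the ambient space work for every M.\<close>
    show "\<exists>A>0. \<exists>B>0. \<forall>f\<in>AP2_on M. (\<lambda>i. (cmod (cinner f (orth_proj (AP2_on M) (h i))))\<^sup>2) summable_on E \<and>
        A * Re (cinner f f) \<le> (\<Sum>\<^sub>\<infinity>i\<in>E. (cmod (cinner f (orth_proj (AP2_on M) (h i))))\<^sup>2) \<and>
        (\<Sum>\<^sub>\<infinity>i\<in>E. (cmod (cinner f (orth_proj (AP2_on M) (h i))))\<^sup>2) \<le> B * Re (cinner f f)"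
      using AB bounds by (intro exI[of _ A] exI[of _ B] conjI ballI) (simp_all only: orth_proj_AP2_on(2))
  qed
qed

end
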